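(* Let $K_1,K_2:\mathbb{R}\to\mathbb{R}$ be admissible, and let $\Phi_1,\Phi_2:X\to Y$ be the corresponding scattering maps. Then there is a constant $C>0$, depending on $K_1$ and $K_2$, such that $$\|K_2-K_1\|_{L^\infty}\le C\left[\sup_{(u_0,u_1)\in X\setminus\{0\}}\frac{\|\Phi_2((u_0,u_1))-\Phi_1((u_0,u_1))\|_Y}{\|(u_0,u_1)\|_{\dot H^1\times L^2}}\right]^{\frac18}.$$ In particular, if $\Phi_1\equiv\Phi_2$ then $K_1\equiv K_2$.
   Context: All functions are real-valued; $t$ is time and $x\in\mathbb{R}$ is the one-dimensional space variable. $\langle x\rangle=\sqrt{1+x^2}$. Admissible: $K:\mathbb{R}\to\mathbb{R}$ is called admissible if $K$ is smooth, nonnegative, compactly supported in $[-1,1]$, and satisfies (i) $K(0)>0$ and (ii) $xK'(x)\le 0$ for all $x\in\mathbb{R}$. Equation and global solution: for admissible $K$, consider $-\partial_t^2u+\partial_x^2u=K(x)u^3$ with $(u,\partial_tu)|_{t=0}=(u_0,u_1)$. For $(u_0,u_1)\in H^1(\mathbb{R})\times L^2(\mathbb{R})$, its solution is the unique function $u\in C(\mathbb{R};H^1)\cap C^1(\mathbb{R};L^2)$ satisfying $$u(t,x)=u_L(t,x)-\tfrac12\int_0^t\int_{x-(t-s)}^{x+(t-s)}K(y)u(s,y)^3\,dy\,ds,$$ where $u_L(t,x)=\tfrac12(u_0(x+t)+u_0(x-t))+\tfrac12\int_{x-t}^{x+t}u_1(s)\,ds$ is the solution of the linear wave equation with the same data.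 Spaces: $X=\{(u_0,u_1)\in H^1(\mathbb{R})\times L^2(\mathbb{R}): (u_0,u_1)\text{ compactly supported}\}$, and $Y=\dot H^1(\mathbb{R},\langle x\rangle^{-1}dx)\times L^2(\mathbb{R},\langle x\rangle^{-1}dx)$, with norm given by $\|(f,g)\|_Y^2=\int_{\mathbb{R}}\langle x\rangle^{-1}|\partial_xf(x)|^2dx+\int_{\mathbb{R}}\langle x\rangle^{-1}|g(x)|^2dx$; as usual for homogeneous spaces, the first component is understood modulo additive constants. Also $\|(u_0,u_1)\|_{\dot H^1\times L^2}^2=\|\partial_xu_0\|_{L^2}^2+\|u_1\|_{L^2}^2$. Linear group: $S(t)$, $t\in\mathbb{R}$, is the linear solution operator, $S(t)(f,g)=(w(t),\partial_tw(t))$ with $w(t,x)=\tfrac12(f(x+t)+f(x-t))+\tfrac12\int_{x-t}^{x+t}g(s)\,ds$. Scattering map: for admissible $K$ and every $(u_0,u_1)\in X$, with $u$ the corresponding global solution, there exist unique $(U_+,V_+)\in Y$ such that $\lim_{t\to\infty}\|S(-t)(u(t),\partial_tu(t))-(U_+,V_+)\|_Y=0$. The scattering map $\Phi:X\to Y$ associated with $K$ is defined by $\Phi((u_0,u_1))=(U_+,V_+)$. Here $\Phi_j$ is the scattering map associated with $K=K_j$, $j=1,2$. *)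

theory Defs
  imports "HOL-Probability.Essential_Supremum"
begin

section \<open>Admissible coefficients\<close>

definition smooth_real :: "(real \<Rightarrow> real) \<Rightarrow> bool" where
  "smooth_real f \<longleftrightarrow> (\<forall>n x. (deriv ^^ n) f field_differentiable at x)"

definition admissible :: "(real \<Rightarrow> real) \<Rightarrow> bool" where
  "admissible K \<longleftrightarrow>
     smooth_real K \<and> (\<forall>x. 0 \<le> K x) \<and> (\<forall>x. 1 < \<bar>x\<bar> \<longrightarrow> K x = 0) \<and>
     0 < K 0 \<and> (\<forall>x. x * deriv K x \<le> 0)"


section \<open>Function spaces\<close>

text \<open>Elements of \<open>L\<^sup>2\<close>-type spaces are represented by Borel functions; two representatives of the
  same class agree almost everywhere, and no notion below distinguishes them.  The parameter
  \<open>\<rho>\<close> is the density of the measure \<open>\<rho>(x) dx\<close>.\<close>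

definition L2w :: "(real \<Rightarrow> real) \<Rightarrow> (real \<Rightarrow> real) set" where
  "L2w \<rho> = {f \<in> borel_measurable lborel. integrable lborel (\<lambda>x. \<rho> x * (f x)\<^sup>2)}"

definition L2w_norm :: "(real \<Rightarrow> real) \<Rightarrow> (real \<Rightarrow> real) \<Rightarrow> real" where
  "L2w_norm \<rho> f = sqrt (LINT x|lborel. \<rho> x * (f x)\<^sup>2)"

abbreviation L2 :: "(real \<Rightarrow> real) set" where
  "L2 \<equiv> L2w (\<lambda>_. 1)"

abbreviation L2_norm :: "(real \<Rightarrow> real) \<Rightarrow> real" where
  "L2_norm \<equiv> L2w_norm (\<lambda>_. 1)"

definition jap :: "real \<Rightarrow> real" where
  "jap x = sqrt (1 + x\<^sup>2)"

definition jap_inv :: "real \<Rightarrow> real" where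
  "jap_inv x = inverse (jap x)"

definition test_function :: "(real \<Rightarrow> real) \<Rightarrow> bool" where
  "test_function \<phi> \<longleftrightarrow> smooth_real \<phi> \<and> (\<exists>R. \<forall>x. R < \<bar>x\<bar> \<longrightarrow> \<phi> x = 0)"

definition locally_integrable :: "(real \<Rightarrow> real) \<Rightarrow> bool" where
  "locally_integrable f \<longleftrightarrow>
     f \<in> borel_measurable lborel \<and> (\<forall>a b. set_integrable lborel {a..b} f)"

definition is_weak_deriv :: "(real \<Rightarrow> real) \<Rightarrow> (real \<Rightarrow> real) \<Rightarrow> bool" where
  "is_weak_deriv f h \<longleftrightarrow>
     locally_integrable f \<and> locally_integrable h \<and>
     (\<forall>\<phi>. test_function \<phi> \<longrightarrow>
        (LINT x|lborel. f x * deriv \<phi> x) = - (LINT x|lborel. h x * \<phi> x))"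

text \<open>A weak derivative is determined up to a null set; \<open>wderiv\<close> selects a representative.\<close>

definition wderiv :: "(real \<Rightarrow> real) \<Rightarrow> real \<Rightarrow> real" where
  "wderiv f = (SOME h. is_weak_deriv f h)"

text \<open>In one dimension every class with a locally integrable weak derivative has exactly one
  continuous representative.  Such classes are identified with it, so that point values such as
  \<open>u\<^sub>0(x + t)\<close> and \<open>u(t, x)\<close> are meaningful.\<close>

definition H1 :: "(real \<Rightarrow> real) set" where
  "H1 = {f \<in> L2. continuous_on UNIV f \<and> (\<exists>h \<in> L2. is_weak_deriv f h)}"

definition H1_norm :: "(real \<Rightarrow> real) \<Rightarrow> real" where
  "H1_norm f = sqrt ((L2_norm f)\<^sup>2 + (L2_norm (wderiv f))\<^sup>2)"

type_synonym data = "(real \<Rightarrow> real) \<times> (real \<Rightarrow> real)"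

definition ess_compact_support :: "(real \<Rightarrow> real) \<Rightarrow> bool" where
  "ess_compact_support f \<longleftrightarrow> (\<exists>R. AE x in lborel. R < \<bar>x\<bar> \<longrightarrow> f x = 0)"

definition X_space :: "data set" where
  "X_space = {(u0, u1). u0 \<in> H1 \<and> u1 \<in> L2 \<and> ess_compact_support u0 \<and> ess_compact_support u1}"

text \<open>The representatives of the zero element of \<open>X\<close>.\<close>

definition X_zero :: "data set" where
  "X_zero = {(u0, u1) \<in> X_space. AE x in lborel. u0 x = 0 \<and> u1 x = 0}"

definition energy_norm :: "data \<Rightarrow> real" where
  "energy_norm = (\<lambda>(f, g). sqrt ((L2_norm (wderiv f))\<^sup>2 + (L2_norm g)\<^sup>2))"

definition Y_space :: "data set" where
  "Y_space = {(f, g). continuous_on UNIV f \<and> (\<exists>h \<in> L2w jap_inv. is_weak_deriv f h) \<and> g \<in> L2w jap_inv}"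

definition Y_norm :: "data \<Rightarrow> real" where
  "Y_norm = (\<lambda>(f, g). sqrt ((L2w_norm jap_inv (wderiv f))\<^sup>2 + (L2w_norm jap_inv g)\<^sup>2))"

text \<open>Equality in \<open>Y\<close>: first components modulo additive constants, second components a.e.\<close>

definition Y_eq :: "data \<Rightarrow> data \<Rightarrow> bool" where
  "Y_eq = (\<lambda>(f, g) (f', g').
     (\<exists>c. AE x in lborel. f x - f' x = c) \<and> (AE x in lborel. g x = g' x))"


section \<open>Time-dependent functions\<close>

text \<open>Functions of space-time are curried as \<open>w t x\<close>.  Time derivatives are those of
  \<open>C\<^sup>1(\<real>; L\<^sup>2)\<close>, i.e. limits of difference quotients in \<open>L\<^sup>2\<close>.\<close>

definition has_L2_time_deriv :: "(real \<Rightarrow> real \<Rightarrow> real) \<Rightarrow> real \<Rightarrow> (real \<Rightarrow> real) \<Rightarrow> bool" where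
  "has_L2_time_deriv w t z \<longleftrightarrow>
     z \<in> L2 \<and> ((\<lambda>s. L2_norm (\<lambda>x. (w s x - w t x) / (s - t) - z x)) \<longlongrightarrow> 0) (at t)"

definition dt :: "(real \<Rightarrow> real \<Rightarrow> real) \<Rightarrow> real \<Rightarrow> real \<Rightarrow> real" where
  "dt w t = (SOME z. has_L2_time_deriv w t z)"

definition C0_H1 :: "(real \<Rightarrow> real \<Rightarrow> real) set" where
  "C0_H1 = {w. (\<forall>t. w t \<in> H1) \<and> (\<forall>t. ((\<lambda>s. H1_norm (w s - w t)) \<longlongrightarrow> 0) (at t))}"

definition C1_L2 :: "(real \<Rightarrow> real \<Rightarrow> real) set" where
  "C1_L2 = {w. (\<forall>t. w t \<in> L2) \<and>
     (\<exists>z. (\<forall>t. has_L2_time_deriv w t (z t)) \<and>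
          (\<forall>t. ((\<lambda>s. L2_norm (z s - z t)) \<longlongrightarrow> 0) (at t)))}"


section \<open>The linear and the nonlinear flow\<close>

text \<open>The integrals \<open>LBINT s=a..b\<close> are oriented, so these formulas also cover \<open>t < 0\<close>.\<close>

definition lin_sol :: "data \<Rightarrow> real \<Rightarrow> real \<Rightarrow> real" where
  "lin_sol = (\<lambda>(f, g) t x.
     (f (x + t) + f (x - t)) / 2 + (1/2) * (LBINT s=ereal (x - t)..ereal (x + t). g s))"

definition lin_group :: "real \<Rightarrow> data \<Rightarrow> data" where
  "lin_group t d = (lin_sol d t, dt (lin_sol d) t)"

definition is_global_solution :: "(real \<Rightarrow> real) \<Rightarrow> data \<Rightarrow> (real \<Rightarrow> real \<Rightarrow> real) \<Rightarrow> bool" where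
  "is_global_solution K d u \<longleftrightarrow>
     u \<in> C0_H1 \<and> u \<in> C1_L2 \<and>
     (\<forall>t x. u t x = lin_sol d t x -
        (1/2) * (LBINT s=ereal 0..ereal t.
                   (LBINT y=ereal (x - (t - s))..ereal (x + (t - s)). K y * (u s y) ^ 3)))"

text \<open>As a map into functions, \<open>\<Phi>\<close> is determined by \<open>K\<close> only up to the choice of representatives
  of elements of \<open>Y\<close>; hence being the scattering map of \<open>K\<close> is a predicate on \<open>\<Phi>\<close>.\<close>

definition is_scattering_map :: "(real \<Rightarrow> real) \<Rightarrow> (data \<Rightarrow> data) \<Rightarrow> bool" where
  "is_scattering_map K \<Phi> \<longleftrightarrow>
     (\<forall>d \<in> X_space. \<Phi> d \<in> Y_space \<and>
        (\<exists>u. is_global_solution K d u \<and>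
             ((\<lambda>t. Y_norm (lin_group (- t) (u t, dt u t) - \<Phi> d)) \<longlongrightarrow> 0) at_top))"


section \<open>Norms with values in \<open>[0, \<infinity>]\<close>\<close>

definition Linfty_norm :: "(real \<Rightarrow> real) \<Rightarrow> ennreal" where
  "Linfty_norm f = esssup lborel (\<lambda>x. ennreal \<bar>f x\<bar>)"

text \<open>The supremum is taken in \<open>[0, \<infinity>]\<close>, since the difference quotients need not be bounded.\<close>

definition scattering_distance :: "(data \<Rightarrow> data) \<Rightarrow> (data \<Rightarrow> data) \<Rightarrow> ennreal" where
  "scattering_distance \<Phi>\<^sub>1 \<Phi>\<^sub>2 =
     (SUP d \<in> X_space - X_zero. ennreal (Y_norm (\<Phi>\<^sub>2 d - \<Phi>\<^sub>1 d) / energy_norm d))"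

text \<open>Powers with a positive real exponent on \<open>[0, \<infinity>]\<close>.\<close>

definition ennreal_powr :: "ennreal \<Rightarrow> real \<Rightarrow> ennreal" where
  "ennreal_powr a p = (if a = \<infinity> then \<infinity> else ennreal (enn2real a powr p))"

end

theory Submission
  imports Defs
begin

text \<open>The proof needs one explicit family of data for each point \<open>x\<close>, and only finite times.

  Data of the form \<open>(f, -f')\<close> evolve linearly into the right-moving wave \<open>f(x - t)\<close>.  Let \<open>f\<close> be a
  bump of height of order 1 and width \<open>h\<close>, centred at \<open>-2\<close>, to the left of the support of \<open>K\<close>.
  For a solution \<open>u\<close>, the quantity \<open>\<partial>\<^sub>tu + \<partial>\<^sub>xu\<close> is transported to the left and
  changes only through the source \<open>K u\<^sup>3\<close>; hence, if \<open>(U, V)\<close> is the scattering state,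
  \<open>U' + V\<close> at \<open>y\<close> equals minus the integral of \<open>K(y - s) u(s, y - s)\<^sup>3\<close> over \<open>s > 0\<close>.
  For \<open>-1 \<le> y \<le> 5\<close> the integrand vanishes for \<open>s > 6\<close>, so no
  global information on \<open>u\<close> is needed.  Replacing \<open>u\<close> by \<open>f(x - t)\<close> turns the integral into an
  average of \<open>K\<close> near \<open>(y - 2)/2\<close> of total mass of order \<open>h\<close>: the backscattered wave displays the
  values of \<open>K\<close> (\<open>scattering_pairing\<close>).

  A continuity argument gives \<open>|u - f(x - t)| \<le> N h\<close> on the support of \<open>K\<close> up to time 6
  (\<open>remainder_bound\<close>), so the replacement costs only \<open>O(h\<^sup>2)\<close> (\<open>nonlinear_error\<close>).  Let
  \<open>m = |K\<^sub>2(x) - K\<^sub>1(x)|\<close> and \<open>h = c' m\<close> with a small constant \<open>c'\<close>.  Then the two states differ by at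
  least \<open>c m h / 2\<close>, with a fixed sign, for \<open>y\<close> within \<open>h\<close> of \<open>2 x + 2\<close>.  Testing with a bump of width \<open>h\<close>
  bounds a multiple of \<open>m h\<^sup>2\<close> by \<open>h\<^bsup>1/2\<^esup>\<close> times the norm of the difference of the states in \<open>Y\<close>,
  hence by \<open>h\<^bsup>1/2\<^esup>\<close> times the distance of the scattering maps times the energy norm \<open>O(h\<^bsup>-1/2\<^esup>)\<close> of the
  data.  The powers of \<open>h\<close> on the right cancel, and \<open>m\<^sup>3\<close> is at most a multiple of the distance
  (\<open>coefficient_difference_cubed\<close>).  As \<open>m\<close> is bounded, the exponent \<open>1/3\<close> may be lowered to \<open>1/8\<close>.

  All bumps are rescaled copies of \<open>K\<^sub>1\<close> itself, which is a nontrivial nonnegative test function; its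
  primitive provides the smooth cutoffs behind the uniqueness of weak derivatives
  (\<open>du_Bois_Reymond\<close>) and the Sobolev bound (\<open>sobolev_sup_bound\<close>).\<close>

section \<open>Smooth functions, cutoffs and the du Bois-Reymond lemma\<close>

lemma smooth_real_has_deriv:
  "smooth_real f \<Longrightarrow> (f has_real_derivative deriv f x) (at x)"
  unfolding smooth_real_def by (metis DERIV_deriv_iff_field_differentiable funpow_0)

lemma smooth_real_deriv: "smooth_real f \<Longrightarrow> smooth_real (deriv f)"
  unfolding smooth_real_def by (metis comp_apply funpow_Suc_right)

lemma smooth_real_coinduct:
  assumes "P f"
    and step: "\<And>f. P f \<Longrightarrow> (\<forall>x. f field_differentiable at x) \<and> P (deriv f)"
  shows "smooth_real f"
proof -
  have "P ((deriv ^^ n) f)" for n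
    by (induction n) (auto simp: assms(1) step)
  then show ?thesis unfolding smooth_real_def using step by blast
qed

lemma smooth_real_antideriv:
  assumes "smooth_real g" "\<And>x. (f has_real_derivative g x) (at x)"
  shows "smooth_real f"
proof -
  have d: "deriv f = g" using assms(2) by (auto intro: DERIV_imp_deriv)
  have "(deriv ^^ n) f field_differentiable at x" for n x
  proof (cases n)
    case 0
    then show ?thesis using assms(2) by (auto simp: field_differentiable_def)
  next
    case (Suc m)
    then show ?thesis using assms(1) d by (simp add: smooth_real_def funpow_Suc_right del: funpow.simps)
  qed
  then show ?thesis by (simp add: smooth_real_def)
qed

lemma smooth_real_rescale_has_deriv:
  assumes "smooth_real f"
  shows "((\<lambda>x. a * f ((x - c) / r)) has_real_derivative a / r * deriv f ((x - c) / r)) (at x)"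
proof -
  have "((\<lambda>x. x - c) has_real_derivative 1) (at x)" by (auto intro!: derivative_eq_intros)
  then have "((\<lambda>x. (x - c) / r) has_real_derivative 1 / r) (at x)" by (rule DERIV_cdivide)
  then have "((\<lambda>x. f ((x - c) / r)) has_real_derivative deriv f ((x - c) / r) * (1 / r)) (at x)"
    by (rule DERIV_chain2[OF smooth_real_has_deriv[OF assms]])
  from DERIV_cmult[OF this, of a] show ?thesis by (simp add: mult_ac)
qed

lemma smooth_real_rescale_add:
  assumes "smooth_real f" "smooth_real g"
  shows "smooth_real (\<lambda>x. a * f ((x - c) / r) + b * g ((x - d) / q))"
proof -
  let ?P = "\<lambda>w. \<exists>a b f g. smooth_real f \<and> smooth_real g \<and>
    w = (\<lambda>x::real. a * f ((x - c) / r) + b * g ((x - d) / q))"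
  have "(\<forall>x. w field_differentiable at x) \<and> ?P (deriv w)" if P: "?P w" for w
  proof -
    obtain a b f g where s: "smooth_real f" "smooth_real g"
      and w: "w = (\<lambda>x. a * f ((x - c) / r) + b * g ((x - d) / q))" using P by blast
    have D: "(w has_real_derivative a / r * deriv f ((x - c) / r) + b / q * deriv g ((x - d) / q)) (at x)" for x
      unfolding w by (intro DERIV_add smooth_real_rescale_has_deriv s)
    then have "deriv w = (\<lambda>x. a / r * deriv f ((x - c) / r) + b / q * deriv g ((x - d) / q))"
      by (auto intro: DERIV_imp_deriv)
    moreover have "\<forall>x. w field_differentiable at x" using D by (auto simp: field_differentiable_def)
    ultimately show ?thesis using s smooth_real_deriv by blast
  qed
  then show ?thesis
    by (intro smooth_real_coinduct[of ?P]) (use assms in blast)+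
qed

lemma smooth_real_rescale:
  assumes "smooth_real f" shows "smooth_real (\<lambda>x. f ((x - c) / r))"
  using smooth_real_rescale_add[OF assms assms, of 1 c r 0 0 0] by simp

lemma smooth_real_continuous: "smooth_real f \<Longrightarrow> continuous_on A f"
  by (meson DERIV_continuous_on has_field_derivative_at_within smooth_real_has_deriv)

lemma deriv_eq_0_off_support:
  fixes f :: "real \<Rightarrow> real"
  assumes "\<And>x. R < \<bar>x\<bar> \<Longrightarrow> f x = 0" "R < \<bar>x\<bar>"
  shows "deriv f x = 0"
proof -
  have "((\<lambda>_. 0) has_real_derivative 0) (at x)" by simp
  moreover have "open {y::real. R < \<bar>y\<bar>}" by (intro open_Collect_less continuous_intros)
  ultimately have "(f has_real_derivative 0) (at x)"
    by (rule has_field_derivative_transform_within_open[where S = "{y. R < \<bar>y\<bar>}"]) (use assms in auto)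
  then show ?thesis by (rule DERIV_imp_deriv)
qed

lemma continuous_compact_support_bounded:
  fixes f :: "real \<Rightarrow> real"
  assumes "continuous_on UNIV f" "\<And>x. R < \<bar>x\<bar> \<Longrightarrow> f x = 0"
  obtains B where "0 < B" "\<And>x. \<bar>f x\<bar> \<le> B"
proof -
  have "compact (f ` {-R..R})" using assms(1) continuous_on_subset by (blast intro: compact_continuous_image)
  then obtain B where B: "\<forall>y \<in> f ` {-R..R}. norm y \<le> B" using compact_imp_bounded bounded_iff by metis
  have "\<bar>f x\<bar> \<le> max B 1" for x
  proof (cases "R < \<bar>x\<bar>")
    case False
    then have "x \<in> {-R..R}" by auto
    then have "f x \<in> f ` {-R..R}" by (rule imageI)
    then have "norm (f x) \<le> B" using B by blast
    then show ?thesis by (simp add: le_max_iff_disj)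
  qed (simp add: assms(2))
  then show ?thesis using that[of "max B 1"] by auto
qed

lemma continuous_imp_borel_lborel:
  fixes f :: "real \<Rightarrow> real"
  shows "continuous_on UNIV f \<Longrightarrow> f \<in> borel_measurable lborel"
  by (simp add: borel_measurable_continuous_onI)

lemma test_function_props:
  assumes "test_function \<phi>"
  obtains R B where "0 < R" "0 < B" "\<And>x. R < \<bar>x\<bar> \<Longrightarrow> \<phi> x = 0" "\<And>x. R < \<bar>x\<bar> \<Longrightarrow> deriv \<phi> x = 0"
    "\<And>x. \<bar>\<phi> x\<bar> \<le> B" "\<And>x. \<bar>deriv \<phi> x\<bar> \<le> B"
proof -
  obtain R where R: "\<And>x. R < \<bar>x\<bar> \<Longrightarrow> \<phi> x = 0" and s: "smooth_real \<phi>"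
    using assms unfolding test_function_def by blast
  define R' where "R' = max R 1"
  have R1: "\<And>x. R' < \<bar>x\<bar> \<Longrightarrow> \<phi> x = 0" unfolding R'_def using R by auto
  have R2: "\<And>x. R' < \<bar>x\<bar> \<Longrightarrow> deriv \<phi> x = 0" using deriv_eq_0_off_support R1 by blast
  obtain B1 where "0 < B1" "\<And>x. \<bar>\<phi> x\<bar> \<le> B1"
    using continuous_compact_support_bounded[OF smooth_real_continuous[OF s] R1] by blast
  moreover obtain B2 where "0 < B2" "\<And>x. \<bar>deriv \<phi> x\<bar> \<le> B2"
    using continuous_compact_support_bounded[OF smooth_real_continuous[OF smooth_real_deriv[OF s]] R2] by blast
  moreover have "0 < R'" by (simp add: R'_def)
  ultimately show ?thesis using R1 R2 that[of R' "max B1 B2"] by (simp add: le_max_iff_disj)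
qed

lemma test_function_continuous:
  assumes "test_function \<phi>"
  shows "continuous_on UNIV \<phi>" "continuous_on UNIV (deriv \<phi>)"
  using assms unfolding test_function_def by (auto intro: smooth_real_continuous smooth_real_deriv)

lemma locally_integrable_mult:
  assumes g: "locally_integrable g" and [measurable]: "\<phi> \<in> borel_measurable lborel"
    and B: "\<And>x. \<bar>\<phi> x\<bar> \<le> B" and R: "\<And>x. R < \<bar>x\<bar> \<Longrightarrow> \<phi> x = 0"
  shows "integrable lborel (\<lambda>x. g x * \<phi> x)"
proof -
  have [measurable]: "g \<in> borel_measurable lborel" using g by (simp add: locally_integrable_def)
  have i: "integrable lborel (\<lambda>x. B * \<bar>indicator {-R..R} x * g x\<bar>)"
    using g unfolding locally_integrable_def set_integrable_def by (intro integrable_mult_right integrable_abs) auto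
  show ?thesis
  proof (rule Bochner_Integration.integrable_bound[OF i])
    show "AE x in lborel. norm (g x * \<phi> x) \<le> norm (B * \<bar>indicator {-R..R} x * g x\<bar>)"
    proof (intro AE_I2)
      fix x
      have "0 \<le> B" using B[of x] by linarith
      show "norm (g x * \<phi> x) \<le> norm (B * \<bar>indicator {-R..R} x * g x\<bar>)"
      proof (cases "R < \<bar>x\<bar>")
        case False
        then have "x \<in> {-R..R}" by auto
        then show ?thesis using B[of x] \<open>0 \<le> B\<close> by (simp add: abs_mult mult.commute[of B] mult_left_mono)
      qed (simp add: R)
    qed
  qed measurable
qed

lemma locally_integrable_test:
  assumes "locally_integrable g" "test_function \<phi>"
  shows "integrable lborel (\<lambda>x. g x * \<phi> x)" "integrable lborel (\<lambda>x. g x * deriv \<phi> x)"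
proof -
  obtain R B where RB: "\<And>x. R < \<bar>x\<bar> \<Longrightarrow> \<phi> x = 0" "\<And>x. R < \<bar>x\<bar> \<Longrightarrow> deriv \<phi> x = 0"
    "\<And>x. \<bar>\<phi> x\<bar> \<le> B" "\<And>x. \<bar>deriv \<phi> x\<bar> \<le> B" using test_function_props[OF assms(2)] by metis
  note c = test_function_continuous[OF assms(2)]
  show "integrable lborel (\<lambda>x. g x * \<phi> x)" "integrable lborel (\<lambda>x. g x * deriv \<phi> x)"
    using locally_integrable_mult[OF assms(1) continuous_imp_borel_lborel[OF c(1)] RB(3,1)]
      locally_integrable_mult[OF assms(1) continuous_imp_borel_lborel[OF c(2)] RB(4,2)] by auto
qed

lemma admissibleD:
  assumes "admissible K"
  shows "smooth_real K" "0 \<le> K x" "1 < \<bar>x\<bar> \<Longrightarrow> K x = 0" "0 < K 0"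
  using assms unfolding admissible_def by auto

text \<open>A smooth transition from 0 to 1 taking place in \<open>[-1, 1]\<close>.  Differences of rescaled
  transitions are test functions that approximate indicators of intervals.\<close>

definition transition :: "(real \<Rightarrow> real) \<Rightarrow> bool" where
  "transition \<Psi> \<longleftrightarrow> smooth_real \<Psi> \<and> (\<forall>x < -1. \<Psi> x = 0) \<and> (\<forall>x > 1. \<Psi> x = 1) \<and> (\<forall>x. 0 \<le> \<Psi> x \<and> \<Psi> x \<le> 1)"

text \<open>The normalized primitive of an admissible function is a transition.\<close>

lemma transition_exists:
  assumes K: "admissible K"
  shows "\<exists>\<Psi>. transition \<Psi>"
proof -
  have c: "continuous_on UNIV K" using smooth_real_continuous admissibleD(1)[OF K] by blast
  obtain F where F: "\<And>x. (F has_real_derivative K x) (at x)"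
  proof -
    have "\<exists>F. \<forall>x::real. -\<infinity> < ereal x \<longrightarrow> ereal x < \<infinity> \<longrightarrow> (F has_vector_derivative K x) (at x)"
      by (rule einterval_antiderivative) (use c in \<open>auto simp: continuous_on_eq_continuous_at\<close>)
    then show ?thesis using that by (auto simp: has_real_derivative_iff_has_vector_derivative)
  qed
  have mono: "F x \<le> F y" if "x \<le> y" for x y
    using DERIV_nonneg_imp_nondecreasing[OF that] F admissibleD(2)[OF K] by blast
  have cF: "continuous_on A F" for A
    by (rule DERIV_continuous_on[OF has_field_derivative_at_within[OF F]])
  have const: "F x = F y" if "x < y" "\<And>z. x < z \<Longrightarrow> z < y \<Longrightarrow> K z = 0" for x y
    using DERIV_isconst_end[OF that(1) cF] F that(2) by (metis)
  have lo: "F x = F (-1)" if "x < -1" for x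
    by (rule const[OF that]) (use admissibleD(3)[OF K] in auto)
  have hi: "F x = F 1" if "x > 1" for x
    by (rule const[OF that, symmetric]) (use admissibleD(3)[OF K] in auto)
  have ne: "F (-1) < F 1"
  proof (rule ccontr)
    assume "\<not> F (-1) < F 1"
    then have "F x = F (-1)" if "x \<in> {-1<..<1}" for x using mono[of "-1" x] mono[of x 1] that by auto
    then have "(F has_real_derivative 0) (at 0)"
      using has_field_derivative_transform_within_open[OF DERIV_const, of "{-1<..<1}" 0 "F (-1)" F] by simp
    then have "K 0 = 0" using F[of 0] DERIV_unique by blast
    then show False using admissibleD(4)[OF K] by simp
  qed
  define \<Psi> where "\<Psi> x = (F x - F (-1)) / (F 1 - F (-1))" for x
  have bounds: "F (-1) \<le> F x \<and> F x \<le> F 1" for x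
    by (metis hi less_eq_real_def lo mono not_less)
  have sF: "smooth_real F" using smooth_real_antideriv F admissibleD(1)[OF K] by blast
  have "smooth_real \<Psi>"
  proof -
    have "(\<Psi> has_real_derivative (1 / (F 1 - F (-1))) * K ((x - 0) / 1) + 0 * K ((x - 0)/1)) (at x)" for x
      unfolding \<Psi>_def by (rule derivative_eq_intros F refl | use ne in simp)+
    then show ?thesis
      using smooth_real_antideriv[OF smooth_real_rescale_add[OF admissibleD(1)[OF K] admissibleD(1)[OF K]]] by blast
  qed
  moreover have "\<Psi> x = 0" if "x < -1" for x by (simp add: \<Psi>_def lo[OF that])
  moreover have "\<Psi> x = 1" if "x > 1" for x using ne by (simp add: \<Psi>_def hi[OF that])
  moreover have "0 \<le> \<Psi> x \<and> \<Psi> x \<le> 1" for x using ne bounds[of x] by (simp add: \<Psi>_def)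
  ultimately show ?thesis unfolding transition_def by blast
qed

lemma test_function_transition_diff:
  assumes "transition \<Psi>" "0 < r" "0 < q"
  shows "test_function (\<lambda>x. \<Psi> ((x - c) / r) - \<Psi> ((x - d) / q))"
    and "deriv (\<lambda>x. \<Psi> ((x - c) / r) - \<Psi> ((x - d) / q)) x = deriv \<Psi> ((x - c) / r) / r - deriv \<Psi> ((x - d) / q) / q"
proof -
  have s: "smooth_real \<Psi>" using assms by (simp add: transition_def)
  have "smooth_real (\<lambda>x. \<Psi> ((x - c) / r) - \<Psi> ((x - d) / q))"
    using smooth_real_rescale_add[OF s s, of 1 c r "-1" d q] by simp
  moreover have "\<Psi> ((x - c) / r) - \<Psi> ((x - d) / q) = 0" if "\<bar>c\<bar> + \<bar>d\<bar> + r + q < \<bar>x\<bar>" for x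
  proof (cases "x > 0")
    case True
    then have "(x - c) / r > 1" "(x - d) / q > 1" using that assms(2,3) by (auto simp: field_simps)
    then show ?thesis using assms(1) by (simp add: transition_def)
  next
    case False
    then have "(x - c) / r < -1" "(x - d) / q < -1" using that assms(2,3) by (auto simp: field_simps)
    then show ?thesis using assms(1) by (simp add: transition_def)
  qed
  ultimately show "test_function (\<lambda>x. \<Psi> ((x - c) / r) - \<Psi> ((x - d) / q))"
    unfolding test_function_def by blast
  show "deriv (\<lambda>x. \<Psi> ((x - c) / r) - \<Psi> ((x - d) / q)) x = deriv \<Psi> ((x - c) / r) / r - deriv \<Psi> ((x - d) / q) / q"
    using DERIV_diff[OF smooth_real_rescale_has_deriv[OF s, of 1 c r x] smooth_real_rescale_has_deriv[OF s, of 1 d q x]]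
    by (auto intro: DERIV_imp_deriv)
qed

text \<open>Testing with approximations of indicators of intervals shows that the integral of \<open>g\<close> over every
  interval vanishes.  On a bounded interval \<open>g\<close> is integrable, and a Dynkin system argument extends
  this to all Borel sets.\<close>

lemma du_Bois_Reymond:
  assumes tr: "transition \<Psi>" and g: "locally_integrable g"
    and z: "\<And>\<phi>. test_function \<phi> \<Longrightarrow> (LINT x|lborel. g x * \<phi> x) = 0"
  shows "AE x in lborel. g x = 0"
proof -
  have [measurable]: "g \<in> borel_measurable lborel" using g by (simp add: locally_integrable_def)
  have ival: "(LINT x:{a..b}|lborel. g x) = 0" for a b
  proof (cases "a < b")
    case True
    define \<theta> where "\<theta> n x = \<Psi> ((x - a) / (1 / real (Suc n))) - \<Psi> ((x - b) / (1 / real (Suc n)))" for n x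
    have t: "test_function (\<theta> n)" for n
      unfolding \<theta>_def by (rule test_function_transition_diff(1)[OF tr]) auto
    have c: "continuous_on UNIV (\<theta> n)" for n using test_function_continuous(1)[OF t] .
    \<comment> \<open>the transitions have width at most 1, so the majorant does not depend on \<open>n\<close>\<close>
    have b: "\<bar>\<theta> n x\<bar> \<le> indicator {a-1..b+1} x" for n x
    proof (cases "x \<in> {a-1..b+1}")
      case True
      have "0 \<le> \<Psi> y \<and> \<Psi> y \<le> 1" for y using tr by (simp add: transition_def)
      then have "\<bar>\<Psi> y - \<Psi> y'\<bar> \<le> 1" for y y' by (smt (verit))
      then show ?thesis using True by (simp add: \<theta>_def)
    next
      case False
      then consider "x < a - 1" | "x > b + 1" by force
      then show ?thesis
      proof cases
        case 1
        have "1 * 1 < (a - x) * real (Suc n)" "1 * 1 < (b - x) * real (Suc n)"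
          by (rule mult_less_le_imp_less; use 1 \<open>a < b\<close> in simp)+
        then have "(x - a) / (1 / real (Suc n)) < -1" "(x - b) / (1 / real (Suc n)) < -1" by (auto simp: field_simps)
        then show ?thesis using tr by (simp add: transition_def \<theta>_def)
      next
        case 2
        have "1 * 1 < (x - a) * real (Suc n)" "1 * 1 < (x - b) * real (Suc n)"
          by (rule mult_less_le_imp_less; use 2 \<open>a < b\<close> in simp)+
        then have "(x - a) / (1 / real (Suc n)) > 1" "(x - b) / (1 / real (Suc n)) > 1" by (auto simp: field_simps)
        then show ?thesis using tr by (simp add: transition_def \<theta>_def)
      qed
    qed
    have step: "(\<lambda>n. \<Psi> ((x - y) / (1 / real (Suc n)))) \<longlonglongrightarrow> (if y < x then 1 else 0)" if "x \<noteq> y" for x y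
    proof -
      have "0 < \<bar>x - y\<bar>" using that by simp
      then obtain N where N: "1 < real N * \<bar>x - y\<bar>" using reals_Archimedean3 by blast
      have "\<Psi> ((x - y) / (1 / real (Suc n))) = (if y < x then 1 else 0)" if "n \<ge> N" for n
      proof -
        have "1 < real (Suc n) * \<bar>x - y\<bar>"
          using N mult_right_mono[of "real N" "real (Suc n)" "\<bar>x - y\<bar>"] that by simp
        then have "if y < x then (x - y) / (1 / real (Suc n)) > 1 else (x - y) / (1 / real (Suc n)) < -1"
          by (auto simp: abs_if algebra_simps split: if_splits)
        then show ?thesis using tr by (auto simp: transition_def split: if_splits)
      qed
      then show ?thesis by (intro tendsto_eventually eventually_sequentiallyI)
    qed
    have lim: "(\<lambda>n. g x * \<theta> n x) \<longlonglongrightarrow> indicator {a..b} x * g x" if "x \<noteq> a" "x \<noteq> b" for x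
    proof -
      have "(\<lambda>n. g x * \<theta> n x) \<longlonglongrightarrow> g x * ((if a < x then 1 else 0) - (if b < x then 1 else 0))"
        unfolding \<theta>_def by (intro tendsto_intros step that)
      moreover have "((if a < x then 1 else 0) - (if b < x then 1 else 0)) = (indicator {a..b} x :: real)"
        using that \<open>a < b\<close> by (auto simp: indicator_def)
      ultimately show ?thesis by (simp add: mult.commute)
    qed
    have "(\<lambda>n. LINT x|lborel. g x * \<theta> n x) \<longlonglongrightarrow> (LINT x|lborel. indicator {a..b} x * g x)"
    proof (rule integral_dominated_convergence[where w = "\<lambda>x. \<bar>indicator {a-1..b+1} x * g x\<bar>"])
      show "integrable lborel (\<lambda>x. \<bar>indicator {a-1..b+1} x * g x\<bar>)"
        using g unfolding locally_integrable_def set_integrable_def by (intro integrable_abs) auto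
      show "AE x in lborel. (\<lambda>n. g x * \<theta> n x) \<longlonglongrightarrow> indicator {a..b} x * g x"
      proof -
        have "AE x in lborel. x \<noteq> a" "AE x in lborel. x \<noteq> b" by (auto simp: AE_lborel_singleton)
        then show ?thesis by eventually_elim (use lim in auto)
      qed
      show "AE x in lborel. norm (g x * \<theta> n x) \<le> \<bar>indicator {a-1..b+1} x * g x\<bar>" for n
        using mult_right_mono[OF b abs_ge_zero] by (intro AE_I2) (simp add: abs_mult mult.commute)
      show "(\<lambda>x. g x * \<theta> n x) \<in> borel_measurable lborel" for n
        using c[of n, THEN continuous_imp_borel_lborel] by measurable
    qed measurable
    then have "(\<lambda>n. 0) \<longlonglongrightarrow> (LINT x|lborel. indicator {a..b} x * g x)" using z[OF t] by simp
    then show ?thesis using LIMSEQ_unique[OF _ tendsto_const] by (fastforce simp: set_lebesgue_integral_def)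
  next
    case False
    then have "AE x in lborel. indicator {a..b} x * g x = 0"
      by (intro AE_I'[of "{a}"]) (auto simp: indicator_def)
    then show ?thesis unfolding set_lebesgue_integral_def by (intro integral_eq_zero_AE) auto
  qed
  have main: "AE x in lborel. indicator {-real n..real n} x * g x = 0" for n
  proof -
    define G where "G x = indicator {-real n..real n} x * g x" for x
    have iG: "integrable lborel G"
      using g unfolding locally_integrable_def set_integrable_def G_def by auto
    have iA: "set_integrable lborel A G" if "A \<in> sets borel" for A
      using iG that unfolding set_integrable_def by (intro integrable_mult_indicator) auto
    have "set_lebesgue_integral lborel A G = 0" if "A \<in> sets borel" for A
      using that
    proof (induction rule: borel_set_induct)
      case empty
      then show ?case by (simp add: set_lebesgue_integral_def)
    next
      case (interval a b)
      have "(LINT x:{a..b}|lborel. G x) = (LINT x:{max a (-real n)..min b (real n)}|lborel. g x)"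
        unfolding set_lebesgue_integral_def G_def
        by (intro Bochner_Integration.integral_cong) (auto simp: indicator_def)
      then show ?case using ival by simp
    next
      case (compl A)
      have "(LINT x:A|lborel. G x) + (LINT x:-A|lborel. G x) = (LINT x:A \<union> -A|lborel. G x)"
        by (rule set_integral_Un[symmetric]) (use compl iA in auto)
      also have "A \<union> -A = UNIV" by auto
      also have "(LINT x:UNIV|lborel. G x) = (LINT x:{-real n..real n}|lborel. g x)"
        unfolding set_lebesgue_integral_def G_def by simp
      finally show ?case using compl ival by simp
    next
      case (union A)
      have m: "(\<Union>i. A i) \<in> sets borel" using union by blast
      have "(LINT x:(\<Union>i. A i)|lborel. G x) = (\<Sum>i. (LINT x:A i|lborel. G x))"
        by (rule lebesgue_integral_countable_add)
           (use union(1,2) iA[OF m] in \<open>auto simp: disjoint_family_on_def\<close>)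
      then show ?case using union by simp
    qed
    then have "AE x in lborel. G x = 0" using density_unique_real[OF iG integrable_zero] by (simp add: set_lebesgue_integral_def)
    then show ?thesis unfolding G_def .
  qed
  have "AE x in lborel. \<forall>n. indicator {-real n..real n} x * g x = 0"
    using main by (intro AE_all_countable[THEN iffD2] allI)
  then show ?thesis
  proof eventually_elim
    case (elim x)
    obtain n where "\<bar>x\<bar> \<le> real n" using real_arch_simple by blast
    then show ?case using elim[rule_format, of n] by (auto simp: indicator_def split: if_splits)
  qed
qed

section \<open>Weak derivatives\<close>

lemma locally_integrable_diff:
  "locally_integrable f \<Longrightarrow> locally_integrable g \<Longrightarrow> locally_integrable (\<lambda>x. f x - g x)"
  unfolding locally_integrable_def by (auto intro: set_integral_diff(1))

lemma locally_integrable_continuous: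
  "continuous_on UNIV f \<Longrightarrow> locally_integrable f"
  unfolding locally_integrable_def
  using continuous_imp_borel_lborel[of f]
  by (auto intro!: borel_integrable_atLeastAtMost' intro: continuous_on_subset)

lemma is_weak_deriv_diff:
  assumes "is_weak_deriv f h" "is_weak_deriv f' h'"
  shows "is_weak_deriv (\<lambda>x. f x - f' x) (\<lambda>x. h x - h' x)"
  unfolding is_weak_deriv_def
proof (intro conjI allI impI)
  fix \<phi> assume t: "test_function \<phi>"
  have l: "locally_integrable f" "locally_integrable h" "locally_integrable f'" "locally_integrable h'"
    using assms by (auto simp: is_weak_deriv_def)
  show "(LINT x|lborel. (f x - f' x) * deriv \<phi> x) = - (LINT x|lborel. (h x - h' x) * \<phi> x)"
    using assms t l by (simp add: is_weak_deriv_def left_diff_distrib locally_integrable_test)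
qed (use assms in \<open>auto simp: is_weak_deriv_def intro: locally_integrable_diff\<close>)

lemma weak_deriv_unique:
  assumes tr: "transition \<Psi>" and "is_weak_deriv f h" "is_weak_deriv f h'"
  shows "AE x in lborel. h x = h' x"
proof -
  have l: "locally_integrable h" "locally_integrable h'" using assms by (auto simp: is_weak_deriv_def)
  have "AE x in lborel. h x - h' x = 0"
  proof (rule du_Bois_Reymond[OF tr locally_integrable_diff[OF l]])
    fix \<phi> assume "test_function \<phi>"
    then show "(LINT x|lborel. (h x - h' x) * \<phi> x) = 0"
      using assms(2,3) l by (simp add: is_weak_deriv_def left_diff_distrib locally_integrable_test)
  qed
  then show ?thesis by simp
qed

lemma wderiv_is_weak_deriv: "is_weak_deriv f h \<Longrightarrow> is_weak_deriv f (wderiv f)"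
  unfolding wderiv_def by (rule someI[of "is_weak_deriv f" h])

lemma wderiv_AE_eq:
  "transition \<Psi> \<Longrightarrow> is_weak_deriv f h \<Longrightarrow> AE x in lborel. wderiv f x = h x"
  using weak_deriv_unique wderiv_is_weak_deriv by blast

lemma LINT_derivative_compact_support:
  fixes F :: "real \<Rightarrow> real"
  assumes "\<And>x. (F has_real_derivative F' x) (at x)" "continuous_on UNIV F'" "\<And>x. R < \<bar>x\<bar> \<Longrightarrow> F x = 0"
  shows "(LINT x|lborel. F' x) = 0"
proof -
  define S where "S = max R 0 + 1"
  have F0: "F x = 0" if "S \<le> \<bar>x\<bar>" for x using assms(3)[of x] that by (auto simp: S_def)
  have F': "F' x = 0" if "S < \<bar>x\<bar>" for x
    using deriv_eq_0_off_support[of S F x] F0 that DERIV_imp_deriv[OF assms(1)] by fastforce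
  have "has_bochner_integral lborel (\<lambda>x. F' x * indicator {-S..S} x) (F S - F (-S))"
    by (rule has_bochner_integral_FTC_Icc_real) (use assms in \<open>auto simp: S_def continuous_on_eq_continuous_at\<close>)
  moreover have "(\<lambda>x. F' x * indicator {-S..S} x) = F'"
  proof
    fix x show "F' x * indicator {-S..S} x = F' x" using F'[of x] by (cases "x \<in> {-S..S}") (auto simp: abs_real_def split: if_splits)
  qed
  moreover have "0 \<le> S" by (simp add: S_def)
  ultimately show ?thesis using F0[of S] F0[of "-S"] by (simp add: has_bochner_integral_iff)
qed

lemma is_weak_deriv_C1:
  assumes D: "\<And>x. (F has_real_derivative F' x) (at x)" and c: "continuous_on UNIV F'"
  shows "is_weak_deriv F F'"
proof -
  have cF: "continuous_on UNIV F" by (rule DERIV_continuous_on[OF has_field_derivative_at_within[OF D]])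
  have l: "locally_integrable F" "locally_integrable F'" using cF c locally_integrable_continuous by auto
  have "(LINT x|lborel. F x * deriv \<phi> x) = - (LINT x|lborel. F' x * \<phi> x)" if t: "test_function \<phi>" for \<phi>
  proof -
    obtain R where R: "\<And>x. R < \<bar>x\<bar> \<Longrightarrow> \<phi> x = 0" using t unfolding test_function_def by blast
    have s: "smooth_real \<phi>" using t by (simp add: test_function_def)
    have "(LINT x|lborel. F x * deriv \<phi> x + F' x * \<phi> x) = 0"
      by (rule LINT_derivative_compact_support[where F = "\<lambda>x. F x * \<phi> x" and R = R])
         (auto intro!: derivative_eq_intros D smooth_real_has_deriv[OF s] continuous_intros cF c
            test_function_continuous[OF t] simp: R)
    then show ?thesis by (simp add: locally_integrable_test[OF l(1) t] locally_integrable_test[OF l(2) t])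
  qed
  then show ?thesis using l by (simp add: is_weak_deriv_def)
qed

section \<open>Weighted square-integrable functions\<close>

lemma jap_ge1: "1 \<le> jap x" by (simp add: jap_def)
lemma jap_pos: "0 < jap x" using jap_ge1[of x] by linarith
lemma jap_inv_pos: "0 < jap_inv x" by (simp add: jap_inv_def jap_pos)
lemma jap_inv_le1: "jap_inv x \<le> 1" using jap_ge1[of x] by (simp add: jap_inv_def inverse_le_1_iff)
lemma jap_inv_borel [measurable]: "jap_inv \<in> borel_measurable borel"
proof -
  have "continuous_on UNIV (\<lambda>x. inverse (sqrt (1 + x\<^sup>2)))"
    by (intro continuous_intros) (auto simp: add_nonneg_eq_0_iff)
  moreover have "jap_inv = (\<lambda>x. inverse (sqrt (1 + x\<^sup>2)))" by (auto simp: jap_inv_def jap_def)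
  ultimately show ?thesis by (metis borel_measurable_continuous_onI)
qed

text \<open>A common setting for the two densities in use, \<open>1\<close> and \<open>jap_inv\<close>.\<close>

definition weight :: "(real \<Rightarrow> real) \<Rightarrow> bool" where
  "weight \<rho> \<longleftrightarrow> \<rho> \<in> borel_measurable borel \<and> (\<forall>x. 0 < \<rho> x \<and> \<rho> x \<le> 1)"

lemma weight_simps [simp]: "weight jap_inv" "weight (\<lambda>_. 1)"
  by (auto simp: weight_def jap_inv_pos jap_inv_le1)

lemma L2_subset_L2w: assumes "weight \<rho>" "f \<in> L2" shows "f \<in> L2w \<rho>"
proof -
  have [measurable]: "\<rho> \<in> borel_measurable borel" "f \<in> borel_measurable borel" using assms by (auto simp: weight_def L2w_def)
  have "integrable lborel (\<lambda>x. \<rho> x * (f x)\<^sup>2)"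
  proof (rule Bochner_Integration.integrable_bound)
    show "integrable lborel (\<lambda>x. 1 * (f x)\<^sup>2)" using assms by (simp add: L2w_def)
    show "AE x in lborel. norm (\<rho> x * (f x)\<^sup>2) \<le> norm (1 * (f x)\<^sup>2)"
      using assms by (auto simp: weight_def abs_mult less_imp_le intro!: AE_I2 mult_left_le_one_le)
  qed measurable
  then show ?thesis by (simp add: L2w_def)
qed

lemma L2w_cong_AE:
  assumes "g \<in> borel_measurable lborel" "f \<in> borel_measurable lborel" "AE x in lborel. f x = g x" "weight \<rho>"
  shows "f \<in> L2w \<rho> \<longleftrightarrow> g \<in> L2w \<rho>" "L2w_norm \<rho> f = L2w_norm \<rho> g"
proof -
  have [measurable]: "\<rho> \<in> borel_measurable borel" "f \<in> borel_measurable borel" "g \<in> borel_measurable borel"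
    using assms by (auto simp: weight_def)
  have ae: "AE x in lborel. \<rho> x * (f x)\<^sup>2 = \<rho> x * (g x)\<^sup>2" using assms(3) by auto
  have "integrable lborel (\<lambda>x. \<rho> x * (f x)\<^sup>2) \<longleftrightarrow> integrable lborel (\<lambda>x. \<rho> x * (g x)\<^sup>2)"
    by (rule integrable_cong_AE[OF _ _ ae]) measurable
  then show "f \<in> L2w \<rho> \<longleftrightarrow> g \<in> L2w \<rho>" using assms by (simp add: L2w_def)
  have "(LINT x|lborel. \<rho> x * (f x)\<^sup>2) = (LINT x|lborel. \<rho> x * (g x)\<^sup>2)"
    by (rule integral_cong_AE[OF _ _ ae]) measurable
  then show "L2w_norm \<rho> f = L2w_norm \<rho> g" by (simp add: L2w_norm_def)
qed

lemma L2w_diff: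
  assumes w: "weight \<rho>" and "f \<in> L2w \<rho>" "g \<in> L2w \<rho>"
  shows "(\<lambda>x. f x - g x) \<in> L2w \<rho>"
proof -
  have [measurable]: "\<rho> \<in> borel_measurable borel" "f \<in> borel_measurable borel" "g \<in> borel_measurable borel"
    using assms by (auto simp: weight_def L2w_def)
  have "integrable lborel (\<lambda>x. \<rho> x * (f x - g x)\<^sup>2)"
  proof (rule Bochner_Integration.integrable_bound)
    show "integrable lborel (\<lambda>x. 2 * (\<rho> x * (f x)\<^sup>2) + 2 * (\<rho> x * (g x)\<^sup>2))" using assms by (auto simp: L2w_def)
    have "\<rho> x * (f x - g x)\<^sup>2 \<le> 2 * (\<rho> x * (f x)\<^sup>2) + 2 * (\<rho> x * (g x)\<^sup>2)" for x
    proof -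
      have "(f x - g x)\<^sup>2 \<le> 2 * (f x)\<^sup>2 + 2 * (g x)\<^sup>2"
        using zero_le_power2[of "f x + g x"] by (simp add: power2_eq_square algebra_simps)
      then have "\<rho> x * (f x - g x)\<^sup>2 \<le> \<rho> x * (2 * (f x)\<^sup>2 + 2 * (g x)\<^sup>2)"
        using w by (intro mult_left_mono) (auto simp: weight_def less_imp_le)
      then show ?thesis by (simp add: algebra_simps)
    qed
    then show "AE x in lborel. norm (\<rho> x * (f x - g x)\<^sup>2) \<le> norm (2 * (\<rho> x * (f x)\<^sup>2) + 2 * (\<rho> x * (g x)\<^sup>2))"
      using w by (intro AE_I2) (auto simp: weight_def less_imp_le abs_mult)
  qed measurable
  then show ?thesis by (simp add: L2w_def)
qed

lemma L2w_mult:
  assumes w: "weight \<rho>" and "f \<in> L2w \<rho>"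
  shows "(\<lambda>x. c * f x) \<in> L2w \<rho>"
proof -
  have "integrable lborel (\<lambda>x. c\<^sup>2 * (\<rho> x * (f x)\<^sup>2))" using assms by (auto simp: L2w_def)
  moreover have "(\<lambda>x. c * f x) \<in> borel_measurable lborel" using assms by (auto simp: L2w_def)
  ultimately show ?thesis by (simp add: L2w_def power_mult_distrib mult.left_commute)
qed

lemma L2w_norm_nonneg: "0 \<le> L2w_norm \<rho> f"
  if "weight \<rho>" using that unfolding L2w_norm_def weight_def
  by (auto intro!: Bochner_Integration.integral_nonneg simp: less_imp_le)

lemma L2w_norm_sq: "weight \<rho> \<Longrightarrow> (L2w_norm \<rho> f)\<^sup>2 = (LINT x|lborel. \<rho> x * (f x)\<^sup>2)"
  unfolding L2w_norm_def weight_def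
  by (intro real_sqrt_pow2 Bochner_Integration.integral_nonneg) (auto simp: less_imp_le)

text \<open>The second factor is measured with the dual weight \<open>1/\<rho>\<close>.\<close>

lemma Cauchy_Schwarz_L2w:
  assumes w: "weight \<rho>" and f: "f \<in> L2w \<rho>"
    and g: "g \<in> borel_measurable lborel" "integrable lborel (\<lambda>x. (g x)\<^sup>2 / \<rho> x)"
  shows "integrable lborel (\<lambda>x. f x * g x)"
    and "\<bar>LINT x|lborel. f x * g x\<bar> \<le> L2w_norm \<rho> f * sqrt (LINT x|lborel. (g x)\<^sup>2 / \<rho> x)"
proof -
  have [measurable]: "\<rho> \<in> borel_measurable borel" "f \<in> borel_measurable borel" "g \<in> borel_measurable borel"
    using assms by (auto simp: weight_def L2w_def)
  have pos: "0 < \<rho> x" for x using w by (simp add: weight_def)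
  define a where "a = (LINT x|lborel. \<rho> x * (f x)\<^sup>2)"
  define b where "b = (LINT x|lborel. (g x)\<^sup>2 / \<rho> x)"
  have if2: "integrable lborel (\<lambda>x. \<rho> x * (f x)\<^sup>2)" using f by (simp add: L2w_def)
  have ineq: "2 * \<bar>f x * g x\<bar> \<le> s * (\<rho> x * (f x)\<^sup>2) + (1/s) * ((g x)\<^sup>2 / \<rho> x)" if "s > 0" for s x
  proof -
    have "0 \<le> (sqrt (s * \<rho> x) * \<bar>f x\<bar> - \<bar>g x\<bar> / sqrt (s * \<rho> x))\<^sup>2" by simp
    also have "\<dots> = s * \<rho> x * (f x)\<^sup>2 + (g x)\<^sup>2 / (s * \<rho> x) - 2 * \<bar>f x * g x\<bar>"
      using that pos[of x] by (simp add: power2_diff power_mult_distrib power_divide abs_mult)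
    finally show ?thesis by (simp add: field_simps)
  qed
  have i1: "\<bar>f x * g x\<bar> \<le> \<bar>\<rho> x * (f x)\<^sup>2 + (g x)\<^sup>2 / \<rho> x\<bar>" for x
    using ineq[of 1 x] abs_ge_zero[of "f x * g x"] by linarith
  show i: "integrable lborel (\<lambda>x. f x * g x)"
    by (rule Bochner_Integration.integrable_bound[OF Bochner_Integration.integrable_add[OF if2 g(2)]])
       (use i1 in \<open>auto intro!: AE_I2\<close>)
  have I: "2 * \<bar>LINT x|lborel. f x * g x\<bar> \<le> s * a + (1/s) * b" if "s > 0" for s
  proof -
    have "\<bar>LINT x|lborel. f x * g x\<bar> \<le> (LINT x|lborel. \<bar>f x * g x\<bar>)" by (rule integral_abs_bound)
    moreover have "(LINT x|lborel. 2 * \<bar>f x * g x\<bar>) \<le> (LINT x|lborel. s * (\<rho> x * (f x)\<^sup>2) + (1/s) * ((g x)\<^sup>2 / \<rho> x))"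
    proof (rule integral_mono)
      show "integrable lborel (\<lambda>x. 2 * \<bar>f x * g x\<bar>)" using i by (intro integrable_mult_right integrable_abs)
      show "integrable lborel (\<lambda>x. s * (\<rho> x * (f x)\<^sup>2) + (1/s) * ((g x)\<^sup>2 / \<rho> x))"
        using if2 g(2) by (intro Bochner_Integration.integrable_add integrable_mult_right)
    qed (use ineq[OF that] in auto)
    moreover have "(LINT x|lborel. s * (\<rho> x * (f x)\<^sup>2) + (1/s) * ((g x)\<^sup>2 / \<rho> x)) = s * a + (1/s) * b"
    proof -
      have "(LINT x|lborel. s * (\<rho> x * (f x)\<^sup>2) + (1/s) * ((g x)\<^sup>2 / \<rho> x))
          = (LINT x|lborel. s * (\<rho> x * (f x)\<^sup>2)) + (LINT x|lborel. (1/s) * ((g x)\<^sup>2 / \<rho> x))"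
        using if2 g(2) by (intro Bochner_Integration.integral_add integrable_mult_right)
      then show ?thesis unfolding a_def b_def integral_mult_right_zero .
    qed
    ultimately show ?thesis unfolding integral_mult_right_zero by linarith
  qed
  have ab: "0 \<le> a" "0 \<le> b" unfolding a_def b_def using pos by (auto intro!: Bochner_Integration.integral_nonneg simp: less_imp_le)
  have "\<bar>LINT x|lborel. f x * g x\<bar> \<le> sqrt a * sqrt b"
  proof (rule field_le_epsilon)
    fix e :: real assume e: "0 < e"
    define \<eta> where "\<eta> = e / (sqrt a + sqrt b + 1)"
    have sp: "0 \<le> sqrt a" "0 \<le> sqrt b" using ab by auto
    then have P: "0 < sqrt a + sqrt b + 1" by linarith
    have \<eta>: "0 < \<eta>" "\<eta> * (sqrt a + sqrt b + 1) = e"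
      using e P by (auto simp: \<eta>_def)
    \<comment> \<open>the optimal parameter \<open>sqrt b / sqrt a\<close>, regularized to allow \<open>a = 0\<close> or \<open>b = 0\<close>\<close>
    define s where "s = (sqrt b + \<eta>) / (sqrt a + \<eta>)"
    have s: "0 < s" using sp \<eta> by (simp add: s_def add_nonneg_pos)
    have "s * a \<le> (sqrt b + \<eta>) * sqrt a"
    proof -
      have "a \<le> sqrt a * (sqrt a + \<eta>)" using ab \<eta> by (simp add: algebra_simps)
      then have "(sqrt b + \<eta>) * a \<le> (sqrt b + \<eta>) * (sqrt a * (sqrt a + \<eta>))"
        using sp \<eta> by (intro mult_left_mono) auto
      then show ?thesis unfolding s_def using sp \<eta> by (simp add: pos_divide_le_eq add_nonneg_pos mult_ac)
    qed
    moreover have "(1/s) * b \<le> (sqrt a + \<eta>) * sqrt b"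
    proof -
      have "b \<le> sqrt b * (sqrt b + \<eta>)" using ab \<eta> by (simp add: algebra_simps)
      then have "(sqrt a + \<eta>) * b \<le> (sqrt a + \<eta>) * (sqrt b * (sqrt b + \<eta>))"
        using sp \<eta> by (intro mult_left_mono) auto
      then show ?thesis unfolding s_def using sp \<eta> by (simp add: pos_divide_le_eq add_nonneg_pos mult_ac)
    qed
    ultimately have "2 * \<bar>LINT x|lborel. f x * g x\<bar> \<le> 2 * (sqrt a * sqrt b) + \<eta> * (sqrt a + sqrt b)"
      using I[OF s] by (simp add: algebra_simps)
    moreover have "\<eta> * (sqrt a + sqrt b) \<le> e" using \<eta> by (simp add: algebra_simps)
    ultimately show "\<bar>LINT x|lborel. f x * g x\<bar> \<le> sqrt a * sqrt b + e" using e by linarith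
  qed
  then show "\<bar>LINT x|lborel. f x * g x\<bar> \<le> L2w_norm \<rho> f * sqrt (LINT x|lborel. (g x)\<^sup>2 / \<rho> x)"
    by (simp add: a_def b_def L2w_norm_def)
qed

lemma mult_indicator_support:
  fixes f :: "real \<Rightarrow> real"
  assumes "\<And>x. R < \<bar>x\<bar> \<Longrightarrow> f x = 0" "R \<le> S"
  shows "(\<lambda>x. f x * indicator {-S..S} x) = f"
proof
  fix x show "f x * indicator {-S..S} x = f x"
    using assms by (cases "R < \<bar>x\<bar>") (auto simp: indicator_def)
qed

lemma continuous_compact_support_integrable:
  fixes f :: "real \<Rightarrow> real"
  assumes "continuous_on UNIV f" "\<And>x. R < \<bar>x\<bar> \<Longrightarrow> f x = 0"
  shows "integrable lborel f"
proof -
  have "set_integrable lborel {-R..R} f" using assms(1) by (intro borel_integrable_atLeastAtMost') (auto intro: continuous_on_subset)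
  then show ?thesis using mult_indicator_support[of R f R] assms(2) by (simp add: set_integrable_def mult.commute)
qed

lemma continuous_compact_support_L2:
  fixes f :: "real \<Rightarrow> real"
  assumes "continuous_on UNIV f" "\<And>x. R < \<bar>x\<bar> \<Longrightarrow> f x = 0"
  shows "f \<in> L2"
proof -
  have "integrable lborel (\<lambda>x. (f x)\<^sup>2)"
    by (rule continuous_compact_support_integrable[of _ R]) (use assms in \<open>auto intro!: continuous_intros\<close>)
  then show ?thesis using assms by (simp add: L2w_def borel_measurable_continuous_onI)
qed

lemma L2_norm_le_sup:
  assumes "f \<in> borel_measurable lborel" "\<And>x. S < \<bar>x\<bar> \<Longrightarrow> f x = 0" "\<And>x. \<bar>f x\<bar> \<le> e" "0 \<le> S"
  shows "f \<in> L2" "L2_norm f \<le> e * sqrt (2 * S)" "(LINT x|lborel. (f x)\<^sup>2) \<le> e\<^sup>2 * (2 * S)"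
proof -
  have [measurable]: "f \<in> borel_measurable borel" using assms(1) by simp
  have e: "0 \<le> e" using assms(3)[of 0] by linarith
  have le: "(f x)\<^sup>2 \<le> e\<^sup>2 * indicator {-S..S} x" for x
  proof (cases "S < \<bar>x\<bar>")
    case False
    then have "x \<in> {-S..S}" by auto
    then show ?thesis using power_mono[OF assms(3) abs_ge_zero, of x 2] by simp
  qed (simp add: assms(2))
  have i0: "integrable lborel (\<lambda>x. e\<^sup>2 * indicator {-S..S} x)"
    using assms(4) by (intro integrable_mult_right integrable_real_indicator) auto
  have i: "integrable lborel (\<lambda>x. (f x)\<^sup>2)"
    by (rule Bochner_Integration.integrable_bound[OF i0]) (use le in \<open>auto intro!: AE_I2 simp: abs_mult\<close>)
  then show "f \<in> L2" by (simp add: L2w_def)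
  have "(LINT x|lborel. (f x)\<^sup>2) \<le> (LINT x|lborel. e\<^sup>2 * indicator {-S..S} x)"
    by (rule integral_mono[OF i i0 le])
  also have "\<dots> = e\<^sup>2 * (2 * S)" using assms(4) by simp
  finally show *: "(LINT x|lborel. (f x)\<^sup>2) \<le> e\<^sup>2 * (2 * S)" .
  from real_sqrt_le_mono[OF this] show "L2_norm f \<le> e * sqrt (2 * S)"
    using e by (simp add: L2w_norm_def real_sqrt_mult)
qed

section \<open>The Sobolev bound\<close>

lemma transition_deriv:
  assumes tr: "transition \<Psi>"
  shows "smooth_real \<Psi>" "continuous_on UNIV (deriv \<Psi>)" "1 < \<bar>x\<bar> \<Longrightarrow> deriv \<Psi> x = 0"
    "integrable lborel (deriv \<Psi>)" "(LINT x|lborel. deriv \<Psi> x) = 1"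
proof -
  show s: "smooth_real \<Psi>" using tr by (simp add: transition_def)
  show c: "continuous_on UNIV (deriv \<Psi>)" using s smooth_real_deriv smooth_real_continuous by blast
  show z: "deriv \<Psi> x = 0" if "1 < \<bar>x\<bar>" for x
  proof (cases "x < 0")
    case True
    have "(\<Psi> has_real_derivative 0) (at x)"
      using has_field_derivative_transform_within_open[OF DERIV_const, of "{..<-1}" x 0 \<Psi>] True that tr
      by (simp add: transition_def)
    then show ?thesis by (rule DERIV_imp_deriv)
  next
    case False
    have "(\<Psi> has_real_derivative 0) (at x)"
      using has_field_derivative_transform_within_open[OF DERIV_const, of "{1<..}" x 1 \<Psi>] False that tr
      by (simp add: transition_def)
    then show ?thesis by (rule DERIV_imp_deriv)
  qed
  show "integrable lborel (deriv \<Psi>)" using continuous_compact_support_integrable c z by blast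
  have "has_bochner_integral lborel (\<lambda>x. deriv \<Psi> x * indicator {-2..2} x) (\<Psi> 2 - \<Psi> (-2))"
    by (rule has_bochner_integral_FTC_Icc_real)
       (use c in \<open>auto simp: continuous_on_eq_continuous_at smooth_real_has_deriv[OF s]\<close>)
  moreover have "(\<lambda>x. deriv \<Psi> x * indicator {-2..2} x) = deriv \<Psi>"
    by (rule mult_indicator_support[of 1]) (use z in auto)
  moreover have "\<Psi> 2 = 1" "\<Psi> (-2) = 0" using tr by (auto simp: transition_def)
  ultimately show "(LINT x|lborel. deriv \<Psi> x) = 1" by (simp add: has_bochner_integral_iff)
qed

text \<open>The value \<open>w x\<close> is the limit of averages of \<open>w\<close> against \<open>\<Psi>'\<close> rescaled to width \<open>r\<close>.  The average of
  width \<open>r\<close> differs from the one of width 1 by the integral of \<open>w\<close> against the derivative of a test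
  function with values in \<open>[-1, 1]\<close> and support in \<open>[x - 1, x + 1]\<close>, which is an integral of \<open>h\<close>.\<close>

lemma sobolev_sup_bound:
  assumes tr: "transition \<Psi>" and c: "continuous_on UNIV w" and w: "w \<in> L2" and h: "h \<in> L2" and wd: "is_weak_deriv w h"
  shows "\<bar>w x\<bar> \<le> sqrt (LINT x|lborel. (deriv \<Psi> x)\<^sup>2) * L2_norm w + sqrt 2 * L2_norm h"
proof -
  note d = transition_deriv[OF tr]
  have b: "0 \<le> \<Psi> y \<and> \<Psi> y \<le> 1" for y using tr by (simp add: transition_def)
  define M where "M = (LINT x|lborel. \<bar>deriv \<Psi> x\<bar>)"
  have M: "0 \<le> M" by (simp add: M_def)
  let ?B = "sqrt (LINT x|lborel. (deriv \<Psi> x)\<^sup>2) * L2_norm w + sqrt 2 * L2_norm h"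
  have "\<bar>w x\<bar> \<le> ?B + e * M" if e: "0 < e" for e
  proof -
    obtain r0 where r0: "0 < r0" "\<And>y. \<bar>y - x\<bar> < r0 \<Longrightarrow> \<bar>w y - w x\<bar> < e"
      using c e unfolding continuous_on_iff dist_real_def by (metis UNIV_I)
    define r where "r = min 1 (r0 / 2)"
    have r: "0 < r" "r \<le> 1" "r < r0" using r0 by (auto simp: r_def)
    define \<theta> where "\<theta> y = \<Psi> ((y - x) / r) - \<Psi> ((y - x) / 1)" for y
    have t: "test_function \<theta>" unfolding \<theta>_def using test_function_transition_diff(1)[OF tr r(1), of 1] by simp
    have dt: "deriv \<theta> y = deriv \<Psi> ((y - x) / r) / r - deriv \<Psi> (y - x)" for y
      unfolding \<theta>_def using test_function_transition_diff(2)[OF tr r(1), of 1] by simp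
    have c1: "continuous_on UNIV (\<lambda>y. deriv \<Psi> ((y - x) / r) / r)"
      by (intro continuous_intros continuous_on_compose2[OF d(2)]) (use r in auto)
    have c2: "continuous_on UNIV (\<lambda>y. deriv \<Psi> (y - x))"
      by (intro continuous_intros continuous_on_compose2[OF d(2)]) auto
    have z1: "deriv \<Psi> ((y - x) / r) / r = 0" if "\<bar>x\<bar> + 1 < \<bar>y\<bar>" for y
    proof -
      have "1 < \<bar>(y - x) / r\<bar>" using that r by (auto simp: abs_divide field_simps)
      then show ?thesis using d(3) by simp
    qed
    have z2: "deriv \<Psi> (y - x) = 0" if "\<bar>x\<bar> + 1 < \<bar>y\<bar>" for y
      by (rule d(3)) (use that in auto)
    have L: "locally_integrable w" using wd by (simp add: is_weak_deriv_def)
    have i1: "integrable lborel (\<lambda>y. w y * (deriv \<Psi> ((y - x) / r) / r))"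
      by (rule continuous_compact_support_integrable[OF continuous_on_mult[OF c c1], of "\<bar>x\<bar> + 1"]) (simp only: z1 mult_zero_right)
    have i2: "integrable lborel (\<lambda>y. w y * deriv \<Psi> (y - x))"
      by (rule continuous_compact_support_integrable[OF continuous_on_mult[OF c c2], of "\<bar>x\<bar> + 1"]) (simp only: z2 mult_zero_right)
    have e1: "(LINT y|lborel. w y * (deriv \<Psi> ((y - x) / r) / r)) - (LINT y|lborel. w y * deriv \<Psi> (y - x))
        = - (LINT y|lborel. h y * \<theta> y)"
    proof -
      have "(LINT y|lborel. w y * deriv \<theta> y) = (LINT y|lborel. w y * (deriv \<Psi> ((y - x) / r) / r)) - (LINT y|lborel. w y * deriv \<Psi> (y - x))"
        unfolding dt right_diff_distrib by (rule Bochner_Integration.integral_diff[OF i1 i2])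
      then show ?thesis using wd t unfolding is_weak_deriv_def by auto
    qed
    have e2: "(LINT y|lborel. w y * (deriv \<Psi> ((y - x) / r) / r)) = (LINT z|lborel. w (x + r * z) * deriv \<Psi> z)"
      using r by (subst lborel_integral_real_affine[where c = r and t = x]) auto
    have c3: "continuous_on UNIV (\<lambda>z. w (x + r * z))"
      by (intro continuous_intros continuous_on_compose2[OF c]) auto
    have i3: "integrable lborel (\<lambda>z. w (x + r * z) * deriv \<Psi> z)"
      by (rule continuous_compact_support_integrable[of _ 1]) (use c3 d in \<open>auto intro!: continuous_intros\<close>)
    have "\<bar>(LINT z|lborel. w (x + r * z) * deriv \<Psi> z) - w x\<bar> = \<bar>LINT z|lborel. (w (x + r * z) - w x) * deriv \<Psi> z\<bar>"
      using i3 d(4,5) by (simp add: left_diff_distrib)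
    also have "\<dots> \<le> (LINT z|lborel. \<bar>(w (x + r * z) - w x) * deriv \<Psi> z\<bar>)" by (rule integral_abs_bound)
    also have "\<dots> \<le> (LINT z|lborel. e * \<bar>deriv \<Psi> z\<bar>)"
    proof (rule integral_mono)
      show "integrable lborel (\<lambda>z. \<bar>(w (x + r * z) - w x) * deriv \<Psi> z\<bar>)"
        using i3 d(4) by (simp add: left_diff_distrib)
      show "integrable lborel (\<lambda>z. e * \<bar>deriv \<Psi> z\<bar>)" using d(4) by simp
      fix z
      show "\<bar>(w (x + r * z) - w x) * deriv \<Psi> z\<bar> \<le> e * \<bar>deriv \<Psi> z\<bar>"
      proof (cases "1 < \<bar>z\<bar>")
        case False
        then have "r * \<bar>z\<bar> \<le> r * 1" using r by (intro mult_left_mono) auto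
        then have "r * \<bar>z\<bar> < r0" using r by linarith
        then have "\<bar>(x + r * z) - x\<bar> < r0" using r by (simp add: abs_mult)
        from r0(2)[OF this] show ?thesis by (simp add: abs_mult mult_right_mono)
      qed (simp add: d(3))
    qed
    also have "\<dots> = e * M" by (simp add: M_def)
    finally have A: "\<bar>(LINT z|lborel. w (x + r * z) * deriv \<Psi> z) - w x\<bar> \<le> e * M" .
    have "\<bar>LINT y|lborel. w y * deriv \<Psi> (y - x)\<bar> \<le> L2_norm w * sqrt (LINT y|lborel. (deriv \<Psi> (y - x))\<^sup>2 / 1)"
      using Cauchy_Schwarz_L2w(2)[OF _ w continuous_imp_borel_lborel[OF c2]]
        continuous_compact_support_L2[OF c2 z2] by (simp add: L2w_def)
    also have "(LINT y|lborel. (deriv \<Psi> (y - x))\<^sup>2 / 1) = (LINT y|lborel. (deriv \<Psi> y)\<^sup>2)"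
      using lborel_integral_real_affine[where c = 1 and t = x and f = "\<lambda>y. (deriv \<Psi> (y - x))\<^sup>2"] by simp
    finally have B: "\<bar>LINT y|lborel. w y * deriv \<Psi> (y - x)\<bar> \<le> sqrt (LINT y|lborel. (deriv \<Psi> y)\<^sup>2) * L2_norm w"
      by (simp add: mult.commute)
    have tb: "\<bar>\<theta> y\<bar> \<le> 1" for y using b[of "(y - x) / r"] b[of "y - x"] by (simp add: \<theta>_def abs_le_iff)
    have tz: "\<theta> (x + y) = 0" if "1 < \<bar>y\<bar>" for y
    proof (cases "y > 0")
      case True
      then have "y / r > 1" using that r by (simp add: field_simps)
      then show ?thesis using True that tr by (simp add: \<theta>_def transition_def)
    next
      case False
      then have "y / r < -1" using that r by (simp add: field_simps)
      then show ?thesis using False that tr by (simp add: \<theta>_def transition_def)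
    qed
    have ct: "continuous_on UNIV \<theta>" using test_function_continuous[OF t] by simp
    have "\<bar>LINT y|lborel. h y * \<theta> y\<bar> \<le> L2_norm h * sqrt (LINT y|lborel. (\<theta> y)\<^sup>2 / 1)"
    proof -
      obtain R where "\<And>x. R < \<bar>x\<bar> \<Longrightarrow> \<theta> x = 0" using test_function_props[OF t] by metis
      then have "integrable lborel (\<lambda>y. (\<theta> y)\<^sup>2)" using continuous_compact_support_L2[OF ct] by (auto simp: L2w_def)
      then show ?thesis using Cauchy_Schwarz_L2w(2)[OF _ h continuous_imp_borel_lborel[OF ct]] by simp
    qed
    also have "(LINT y|lborel. (\<theta> y)\<^sup>2 / 1) = (LINT y|lborel. (\<theta> (x + y))\<^sup>2)"
      using lborel_integral_real_affine[where c = 1 and t = x and f = "\<lambda>y. (\<theta> y)\<^sup>2"] by simp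
    finally have B1: "\<bar>LINT y|lborel. h y * \<theta> y\<bar> \<le> L2_norm h * sqrt (LINT y|lborel. (\<theta> (x + y))\<^sup>2)" .
    have m: "(\<lambda>y. \<theta> (x + y)) \<in> borel_measurable lborel"
      by (intro continuous_imp_borel_lborel continuous_on_compose2[OF ct] continuous_intros) auto
    have "(LINT y|lborel. (\<theta> (x + y))\<^sup>2) \<le> 1\<^sup>2 * (2 * 1)"
      by (rule L2_norm_le_sup(3)) (use tz tb m in auto)
    then have "L2_norm h * sqrt (LINT y|lborel. (\<theta> (x + y))\<^sup>2) \<le> L2_norm h * sqrt 2"
      by (intro mult_left_mono real_sqrt_le_mono L2w_norm_nonneg) auto
    with B1 have C: "\<bar>LINT y|lborel. h y * \<theta> y\<bar> \<le> sqrt 2 * L2_norm h" by (simp add: mult.commute)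
    show ?thesis using e1 e2 A B C by linarith
  qed
  then have "\<bar>w x\<bar> \<le> ?B + e" if "0 < e" for e
  proof -
    assume *: "\<And>e. 0 < e \<Longrightarrow> \<bar>w x\<bar> \<le> ?B + e * M"
    have "e / (M + 1) * M \<le> e" using that M by (simp add: field_simps)
    then show ?thesis using *[of "e / (M + 1)"] that M by simp
  qed
  then show ?thesis by (rule field_le_epsilon)
qed


section \<open>Time derivatives in the mean\<close>

lemma difference_quotient_uniform:
  assumes D: "\<And>x. (A has_real_derivative A' x) (at x)" and c: "continuous_on UNIV A'"
    and z: "\<And>x. R < \<bar>x\<bar> \<Longrightarrow> A' x = 0" and e: "0 < e"
  obtains d where "0 < d" "d \<le> 1"
    "\<And>s x. 0 < \<bar>s\<bar> \<Longrightarrow> \<bar>s\<bar> < d \<Longrightarrow> \<bar>(A (x + s) - A x) / s - A' x\<bar> \<le> e"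
proof -
  have "uniformly_continuous_on {-R-2..R+2} A'"
    by (intro compact_uniformly_continuous continuous_on_subset[OF c]) auto
  then obtain d0 where d0: "0 < d0" "\<And>x y. x \<in> {-R-2..R+2} \<Longrightarrow> y \<in> {-R-2..R+2} \<Longrightarrow> \<bar>y - x\<bar> < d0 \<Longrightarrow> \<bar>A' y - A' x\<bar> < e"
    using e unfolding uniformly_continuous_on_def dist_real_def by metis
  define d where "d = min d0 1"
  have close: "\<bar>A' y - A' x\<bar> \<le> e" if "\<bar>y - x\<bar> < d" for x y
  proof (cases "\<bar>x\<bar> \<le> R + 1")
    case True
    then show ?thesis using d0(2)[of x y] that by (auto simp: d_def abs_le_iff abs_less_iff)
  next
    case False
    then have "A' x = 0" "A' y = 0" using that by (auto intro!: z simp: d_def abs_le_iff abs_less_iff)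
    then show ?thesis using e by simp
  qed
  have "\<bar>(A (x + s) - A x) / s - A' x\<bar> \<le> e" if s: "0 < \<bar>s\<bar>" "\<bar>s\<bar> < d" for s x
  proof (cases "s > 0")
    case True
    have "\<exists>\<xi>>x. \<xi> < x + s \<and> A (x + s) - A x = (x + s - x) * A' \<xi>"
      by (rule MVT2) (use True D in auto)
    then obtain \<xi> where \<xi>: "x < \<xi>" "\<xi> < x + s" "A (x + s) - A x = s * A' \<xi>" by auto
    then show ?thesis using close[of \<xi> x] s True by simp
  next
    case False
    have "\<exists>\<xi>>x+s. \<xi> < x \<and> A x - A (x + s) = (x - (x + s)) * A' \<xi>"
      by (rule MVT2) (use False s D in auto)
    then obtain \<xi> where \<xi>: "x + s < \<xi>" "\<xi> < x" "A x - A (x + s) = - s * A' \<xi>" by auto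
    then have "(A (x + s) - A x) / s = A' \<xi>" using s by (simp add: field_simps)
    then show ?thesis using close[of \<xi> x] \<xi> s False by simp
  qed
  then show ?thesis using that[of d] d0(1) by (simp add: d_def)
qed

text \<open>Only the derivatives of \<open>A\<close> and \<open>B\<close> have compact support; the functions themselves may tend to
  nonzero constants at infinity, so that the sum need not lie in \<open>L2\<close>.\<close>

lemma has_L2_time_deriv_dAlembert:
  assumes DA: "\<And>x. (A has_real_derivative A' x) (at x)" and cA: "continuous_on UNIV A'"
    and zA: "\<And>x. R < \<bar>x\<bar> \<Longrightarrow> A' x = 0"
    and DB: "\<And>x. (B has_real_derivative B' x) (at x)" and cB: "continuous_on UNIV B'"
    and zB: "\<And>x. R < \<bar>x\<bar> \<Longrightarrow> B' x = 0"
  shows "has_L2_time_deriv (\<lambda>\<tau> x. A (x + \<tau>) + B (x - \<tau>)) t (\<lambda>x. A' (x + t) - B' (x - t))"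
    and "(\<lambda>x. (A (x + s) + B (x - s)) - (A (x + t) + B (x - t))) \<in> L2"
    and "((\<lambda>s. ((A (x + s) + B (x - s)) - (A (x + t) + B (x - t))) / (s - t)) \<longlongrightarrow> A' (x + t) - B' (x - t)) (at t)"
proof -
  have kA: "continuous_on UNIV A" and kB: "continuous_on UNIV B"
    by (rule DERIV_continuous_on[OF has_field_derivative_at_within[OF DA]]
          DERIV_continuous_on[OF has_field_derivative_at_within[OF DB]])+
  have cont: "continuous_on UNIV (\<lambda>x. A (x + s))" "continuous_on UNIV (\<lambda>x. B (x - s))"
    "continuous_on UNIV (\<lambda>x. A' (x + s))" "continuous_on UNIV (\<lambda>x. B' (x - s))" for s
    by (intro continuous_on_compose2[OF kA] continuous_on_compose2[OF kB] continuous_on_compose2[OF cA]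
         continuous_on_compose2[OF cB] continuous_intros; simp)+
  have const: "F y = F z" if "\<And>x. (F has_real_derivative F' x) (at x)" "\<And>x. R < \<bar>x\<bar> \<Longrightarrow> F' x = 0"
      "(R < y \<and> R < z) \<or> (y < -R \<and> z < -R)" for F F' y z
  proof -
    have *: "F y = F z" if "y < z" "(R < y \<and> R < z) \<or> (y < -R \<and> z < -R)" for y z
    proof (rule DERIV_isconst_end[OF that(1), symmetric])
      show "continuous_on {y..z} F" by (rule DERIV_continuous_on[OF has_field_derivative_at_within]) (rule \<open>\<And>x. (F has_real_derivative F' x) (at x)\<close>)
      fix x assume "y < x" "x < z"
      then have "R < \<bar>x\<bar>" using that(2) by auto
      then show "(F has_real_derivative 0) (at x)" using \<open>\<And>x. (F has_real_derivative F' x) (at x)\<close>[of x] \<open>\<And>x. R < \<bar>x\<bar> \<Longrightarrow> F' x = 0\<close> by metis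
    qed
    then show ?thesis using that(3) *[of y z] *[of z y] by (metis linorder_neqE)
  qed
  have supp: "A (x + s) - A (x + t) = 0 \<and> B (x - s) - B (x - t) = 0" if "\<bar>R\<bar> + \<bar>s\<bar> + \<bar>t\<bar> < \<bar>x\<bar>" for x s
    using const[of A A', OF DA zA] const[of B B', OF DB zB] that
    by (smt (verit))
  show "(\<lambda>x. (A (x + s) + B (x - s)) - (A (x + t) + B (x - t))) \<in> L2" for s
    by (rule continuous_compact_support_L2[of _ "\<bar>R\<bar> + \<bar>s\<bar> + \<bar>t\<bar>"])
       (use supp in \<open>auto intro!: continuous_intros cont\<close>)
  have zL2: "(\<lambda>x. A' (x + t) - B' (x - t)) \<in> L2"
    by (rule continuous_compact_support_L2[of _ "\<bar>R\<bar> + \<bar>t\<bar>"])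
       (use zA zB in \<open>auto intro!: continuous_intros cont\<close>)
  show "((\<lambda>s. ((A (x + s) + B (x - s)) - (A (x + t) + B (x - t))) / (s - t)) \<longlongrightarrow> A' (x + t) - B' (x - t)) (at t)"
  proof -
    have "((\<lambda>s. A (x + s) + B (x - s)) has_real_derivative A' (x + t) * (0 + 1) + B' (x - t) * (0 - 1)) (at t)"
      by (intro DERIV_add DERIV_chain2[OF DA] DERIV_chain2[OF DB] DERIV_diff DERIV_const DERIV_ident)
    then show ?thesis by (simp add: has_field_derivative_iff)
  qed
  have "((\<lambda>s. L2_norm (\<lambda>x. ((A (x + s) + B (x - s)) - (A (x + t) + B (x - t))) / (s - t) - (A' (x + t) - B' (x - t)))) \<longlongrightarrow> 0) (at t)"
    (is "(?N \<longlongrightarrow> 0) (at t)")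
  proof (rule tendstoI)
    fix e :: real assume e: "0 < e"
    define S where "S = \<bar>R\<bar> + 2 * \<bar>t\<bar> + 1"
    define e' where "e' = e / (4 * (sqrt (2 * S) + 1))"
    have S: "0 \<le> sqrt (2 * S)" "0 \<le> S" by (auto simp: S_def)
    have e': "0 < e'" "2 * e' * sqrt (2 * S) < e"
    proof -
      show "0 < e'" using e S by (simp add: e'_def add_nonneg_pos)
      have "2 * e' * sqrt (2 * S) \<le> 2 * e' * (sqrt (2 * S) + 1)" using \<open>0 < e'\<close> by simp
      also have "\<dots> = e / 2" using S by (simp add: e'_def field_simps add_nonneg_eq_0_iff)
      finally show "2 * e' * sqrt (2 * S) < e" using e by linarith
    qed
    obtain d1 where d1: "0 < d1" "d1 \<le> 1"
      "\<And>s x. 0 < \<bar>s\<bar> \<Longrightarrow> \<bar>s\<bar> < d1 \<Longrightarrow> \<bar>(A (x + s) - A x) / s - A' x\<bar> \<le> e'"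
      using difference_quotient_uniform[OF DA cA zA e'(1)] by blast
    obtain d2 where d2: "0 < d2" "d2 \<le> 1"
      "\<And>s x. 0 < \<bar>s\<bar> \<Longrightarrow> \<bar>s\<bar> < d2 \<Longrightarrow> \<bar>(B (x + s) - B x) / s - B' x\<bar> \<le> e'"
      using difference_quotient_uniform[OF DB cB zB e'(1)] by blast
    have "dist (?N s) 0 < e" if s: "s \<noteq> t" "dist s t < min d1 d2" for s
    proof -
      have s': "0 < \<bar>s - t\<bar>" "\<bar>s - t\<bar> < d1" "0 < \<bar>t - s\<bar>" "\<bar>t - s\<bar> < d2" using s by (auto simp: dist_real_def)
      have "?N s \<le> (2 * e') * sqrt (2 * S)"
      proof (rule L2_norm_le_sup(2))
        show "(\<lambda>x. ((A (x + s) + B (x - s)) - (A (x + t) + B (x - t))) / (s - t) - (A' (x + t) - B' (x - t))) \<in> borel_measurable lborel"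
          by (rule continuous_imp_borel_lborel) (use s in \<open>auto intro!: continuous_intros cont\<close>)
        fix x
        have q1: "\<bar>(A (x + s) - A (x + t)) / (s - t) - A' (x + t)\<bar> \<le> e'"
          using d1(3)[OF s'(1,2), of "x + t"] by (simp add: add.assoc)
        have q2: "\<bar>(B (x - s) - B (x - t)) / (t - s) - B' (x - t)\<bar> \<le> e'"
          using d2(3)[OF s'(3,4), of "x - t"] by (simp add: algebra_simps)
        have eq: "((A (x + s) + B (x - s)) - (A (x + t) + B (x - t))) / (s - t) - (A' (x + t) - B' (x - t)) =
          ((A (x + s) - A (x + t)) / (s - t) - A' (x + t)) - ((B (x - s) - B (x - t)) / (t - s) - B' (x - t))"
        proof -
          have "y / (t - s) = - (y / (s - t))" for y by (metis minus_diff_eq minus_divide_right)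
          then show ?thesis by (simp add: diff_divide_distrib add_divide_distrib)
        qed
        show "\<bar>((A (x + s) + B (x - s)) - (A (x + t) + B (x - t))) / (s - t) - (A' (x + t) - B' (x - t))\<bar> \<le> 2 * e'"
          unfolding eq using q1 q2 by linarith
        assume x: "S < \<bar>x\<bar>"
        have "\<bar>s\<bar> \<le> \<bar>t\<bar> + 1" using s' d1(2) by linarith
        then have "\<bar>R\<bar> + \<bar>s\<bar> + \<bar>t\<bar> < \<bar>x\<bar>" using x by (simp add: S_def)
        moreover have "A' (x + t) = 0" "B' (x - t) = 0" using x by (auto intro!: zA zB simp: S_def)
        ultimately show "((A (x + s) + B (x - s)) - (A (x + t) + B (x - t))) / (s - t) - (A' (x + t) - B' (x - t)) = 0"
          unfolding eq using supp[of s x] by simp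
      qed (rule S)
      moreover have "0 \<le> ?N s" by (simp add: L2w_norm_nonneg)
      ultimately show ?thesis using e'(2) by simp
    qed
    moreover have "0 < min d1 d2" using d1 d2 by simp
    ultimately show "\<forall>\<^sub>F s in at t. dist (?N s) 0 < e" unfolding eventually_at by blast
  qed
  then show "has_L2_time_deriv (\<lambda>\<tau> x. A (x + \<tau>) + B (x - \<tau>)) t (\<lambda>x. A' (x + t) - B' (x - t))"
    using zL2 by (simp add: has_L2_time_deriv_def)
qed

text \<open>A derivative in the mean agrees with a pointwise derivative almost everywhere, by Fatou's lemma.
  This identifies the representatives chosen by \<open>dt\<close>.\<close>

lemma L2_time_deriv_pointwise:
  assumes d: "has_L2_time_deriv w t z'"
    and p: "\<And>x. ((\<lambda>s. (w s x - w t x) / (s - t)) \<longlongrightarrow> z x) (at t)"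
    and zm: "z \<in> borel_measurable lborel" and L: "\<And>s. (\<lambda>x. w s x - w t x) \<in> L2"
  shows "AE x in lborel. z' x = z x"
proof -
  define s where "s n = t + 1 / real (Suc n)" for n
  have sne: "s n \<noteq> t" for n by (simp add: s_def)
  have "s \<longlonglongrightarrow> t + 0" unfolding s_def by (intro tendsto_intros LIMSEQ_Suc[OF lim_1_over_n])
  then have st: "filterlim s (at t) sequentially" using sne by (simp add: filterlim_at)
  define q where "q n x = (w (s n) x - w t x) / (s n - t) - z' x" for n x
  have z': "z' \<in> L2" using d by (simp add: has_L2_time_deriv_def)
  have qL: "q n \<in> L2" for n
    using L2w_diff[OF _ L2w_mult[OF _ L[of "s n"], of "1 / (s n - t)"] z'] by (simp add: q_def[abs_def])
  have [measurable]: "z \<in> borel_measurable borel" "z' \<in> borel_measurable borel" "q n \<in> borel_measurable borel" for n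
    using zm z' qL[of n] by (auto simp: L2w_def)
  have "(\<lambda>n. L2_norm (q n)) \<longlonglongrightarrow> 0"
    using d filterlim_compose[OF _ st] unfolding has_L2_time_deriv_def q_def[abs_def] by fastforce
  then have "(\<lambda>n. (L2_norm (q n))\<^sup>2) \<longlonglongrightarrow> 0\<^sup>2" by (rule tendsto_power)
  then have lim0: "(\<lambda>n. ennreal ((L2_norm (q n))\<^sup>2)) \<longlonglongrightarrow> ennreal 0" by (intro tendsto_ennrealI) simp
  have nn: "(\<integral>\<^sup>+x. ennreal ((q n x)\<^sup>2) \<partial>lborel) = ennreal ((L2_norm (q n))\<^sup>2)" for n
    using qL[of n] by (subst nn_integral_eq_integral) (auto simp: L2w_norm_sq L2w_def)
  have lp: "(\<lambda>n. ennreal ((q n x)\<^sup>2)) \<longlonglongrightarrow> ennreal ((z x - z' x)\<^sup>2)" for x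
    unfolding q_def by (intro tendsto_ennrealI tendsto_intros filterlim_compose[OF p st])
  have "(\<integral>\<^sup>+x. ennreal ((z x - z' x)\<^sup>2) \<partial>lborel) = (\<integral>\<^sup>+x. liminf (\<lambda>n. ennreal ((q n x)\<^sup>2)) \<partial>lborel)"
    using lim_imp_Liminf[OF sequentially_bot lp] by (intro nn_integral_cong) simp
  also have "\<dots> \<le> liminf (\<lambda>n. \<integral>\<^sup>+x. ennreal ((q n x)\<^sup>2) \<partial>lborel)"
    by (rule nn_integral_liminf) measurable
  also have "\<dots> = 0" unfolding nn using lim_imp_Liminf[OF sequentially_bot lim0] by simp
  finally have "(\<integral>\<^sup>+x. ennreal ((z x - z' x)\<^sup>2) \<partial>lborel) = 0" by simp
  then have "AE x in lborel. ennreal ((z x - z' x)\<^sup>2) = 0" by (subst (asm) nn_integral_0_iff_AE) auto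
  then show ?thesis by eventually_elim (auto simp: ennreal_eq_0_iff)
qed

section \<open>Solutions with right-moving data\<close>

text \<open>The primitive of \<open>g\<close> that vanishes at 0.  Integrating over the fixed interval \<open>[0, 1]\<close> covers both signs
  of \<open>x\<close> and makes continuity in a parameter immediate.\<close>

definition primitive :: "(real \<Rightarrow> real) \<Rightarrow> real \<Rightarrow> real" where
  "primitive g x = x * integral {0..1} (\<lambda>r. g (x * r))"

lemma primitive_has_deriv:
  assumes c: "continuous_on UNIV (g)"
  shows "(primitive g has_real_derivative g x) (at x)"
proof -
  obtain G where G: "\<And>x. (G has_real_derivative g x) (at x)"
  proof -
    have "\<exists>G. \<forall>x::real. -\<infinity> < ereal x \<longrightarrow> ereal x < \<infinity> \<longrightarrow> (G has_vector_derivative g x) (at x)"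
      by (rule einterval_antiderivative) (use c in \<open>auto simp: continuous_on_eq_continuous_at\<close>)
    then show ?thesis using that by (auto simp: has_real_derivative_iff_has_vector_derivative)
  qed
  have "primitive g x = G x - G 0" for x
  proof -
    have "((\<lambda>r. x * g (x * r)) has_integral G (x * 1) - G (x * 0)) {0..1}"
    proof (rule fundamental_theorem_of_calculus)
      fix r :: real
      have "((\<lambda>r. x * r) has_real_derivative x) (at r within {0..1})" by (auto intro!: derivative_eq_intros)
      from DERIV_chain2[OF G this]
      show "((\<lambda>r. G (x * r)) has_vector_derivative x * g (x * r)) (at r within {0..1})"
        by (simp add: has_real_derivative_iff_has_vector_derivative mult.commute)
    qed simp
    then show ?thesis by (simp add: primitive_def integral_unique flip: integral_mult_right)
  qed
  then have "primitive g = (\<lambda>x. G x - G 0)" by auto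
  then show ?thesis using DERIV_diff[OF G DERIV_const[of "G 0"], of x] by simp
qed

lemma primitive_LBINT:
  assumes c: "continuous_on UNIV (g)"
  shows "(LBINT y=ereal a..ereal b. g y) = primitive g b - primitive g a"
  by (rule interval_integral_FTC_finite)
     (use primitive_has_deriv[OF c] c in \<open>auto simp flip: has_real_derivative_iff_has_vector_derivative
       intro: has_field_derivative_at_within continuous_on_subset\<close>)

lemma primitive_continuous:
  assumes c: "continuous_on UNIV (\<lambda>(s, y). F s y)"
  shows "continuous_on UNIV (\<lambda>(s, x). primitive (F s) x)"
proof -
  have "continuous_on (UNIV \<times> cbox 0 1) (\<lambda>(p, r). F (fst p) (snd p * r))"
    unfolding split_beta
    by (rule continuous_on_compose2[OF c, of _ "\<lambda>z. (fst (fst z), snd (fst z) * snd z)", unfolded split_beta fst_conv snd_conv])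
       (auto intro!: continuous_intros)
  from integral_continuous_on_param[OF this]
  have "continuous_on UNIV (\<lambda>p. integral {0..1::real} (\<lambda>r. F (fst p) (snd p * r)))" by simp
  then show ?thesis unfolding primitive_def split_beta by (intro continuous_intros)
qed

lemma continuous_on_slice:
  assumes "continuous_on UNIV (\<lambda>(s, y). F s y)"
  shows "continuous_on UNIV (F s)"
  using continuous_on_compose2[OF assms continuous_on_Pair[OF continuous_on_const[of UNIV s] continuous_on_id]] by simp

lemma continuous_on_pair_compose:
  assumes c: "continuous_on UNIV (\<lambda>(s, y). F s y)" and "continuous_on S a" "continuous_on S b"
  shows "continuous_on S (\<lambda>x. F (a x) (b x))"
  using continuous_on_compose2[OF c, of S "\<lambda>x. (a x, b x)"] assms(2,3) by (auto intro!: continuous_intros)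

lemma primitive_lipschitz:
  assumes c: "continuous_on UNIV (g)" and M: "\<And>y. \<bar>g y\<bar> \<le> M"
  shows "\<bar>primitive g b - primitive g a\<bar> \<le> M * \<bar>b - a\<bar>"
  using field_differentiable_bound[of UNIV "primitive g" "g" M b a] primitive_has_deriv[OF c] M by auto

text \<open>A solution of the equation with data \<open>(f, -f')\<close>, where \<open>f'\<close> is continuous with compact support;
  the corresponding linear solution is \<open>f(x - t)\<close>.  The transition \<open>\<Psi>\<close> only supplies test functions.\<close>

locale wave =
  fixes K f f' \<Psi> :: "real \<Rightarrow> real" and u :: "real \<Rightarrow> real \<Rightarrow> real" and R0 :: real
  assumes K: "admissible K" and tr: "transition \<Psi>"
    and Df: "\<And>x. (f has_real_derivative f' x) (at x)" and f'_continuous: "continuous_on UNIV f'"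
    and R0: "0 \<le> R0" and zf': "\<And>x. R0 < \<bar>x\<bar> \<Longrightarrow> f' x = 0"
    and sol: "is_global_solution K (f, \<lambda>x. - f' x) u"
begin

text \<open>The source term; it vanishes for \<open>|y| > 1\<close>.\<close>

definition F :: "real \<Rightarrow> real \<Rightarrow> real" where "F s y = K y * (u s y) ^ 3"

lemma f_continuous: "continuous_on UNIV f" by (rule DERIV_continuous_on[OF has_field_derivative_at_within[OF Df]])
lemma K_continuous: "continuous_on UNIV K" using smooth_real_continuous admissibleD(1)[OF K] by blast
lemma u_in_H1: "u t \<in> H1" using sol by (simp add: is_global_solution_def C0_H1_def)

lemma u_diff_bound: "\<bar>u s x - u t x\<bar> \<le> (sqrt (LINT x|lborel. (deriv \<Psi> x)\<^sup>2) + sqrt 2) * H1_norm (u s - u t)"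
proof -
  obtain hs ht where h: "is_weak_deriv (u s) hs" "is_weak_deriv (u t) ht" "hs \<in> L2" "ht \<in> L2" and
    uL: "u s \<in> L2" "u t \<in> L2" and c: "continuous_on UNIV (u s)" "continuous_on UNIV (u t)"
    using u_in_H1[of s] u_in_H1[of t] unfolding H1_def by blast
  let ?w = "\<lambda>x. u s x - u t x" and ?h = "\<lambda>x. hs x - ht x"
  have w: "u s - u t = ?w" by (simp add: fun_eq_iff)
  have wd: "is_weak_deriv ?w ?h" by (rule is_weak_deriv_diff[OF h(1,2)])
  have wL: "?w \<in> L2" "?h \<in> L2" using L2w_diff[OF _ uL] L2w_diff[OF _ h(3,4)] by auto
  have "wderiv ?w \<in> borel_measurable lborel"
    using wderiv_is_weak_deriv[OF wd] by (simp add: is_weak_deriv_def locally_integrable_def)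
  then have n: "L2_norm (wderiv ?w) = L2_norm ?h"
    using L2w_cong_AE(2)[OF _ _ wderiv_AE_eq[OF tr wd]] wL(2) by (auto simp: L2w_def)
  have "\<bar>?w x\<bar> \<le> sqrt (LINT x|lborel. (deriv \<Psi> x)\<^sup>2) * L2_norm ?w + sqrt 2 * L2_norm ?h"
    by (rule sobolev_sup_bound[OF tr _ wL wd]) (use c in \<open>auto intro!: continuous_intros\<close>)
  also have "\<dots> \<le> sqrt (LINT x|lborel. (deriv \<Psi> x)\<^sup>2) * H1_norm ?w + sqrt 2 * H1_norm ?w"
    unfolding H1_norm_def n by (intro add_mono mult_left_mono) (auto intro!: real_le_rsqrt Bochner_Integration.integral_nonneg)
  finally show ?thesis by (simp add: w algebra_simps)
qed

text \<open>By the Sobolev bound, continuity in time with values in \<open>H1\<close> implies continuity in the supremum norm.\<close>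

lemma u_cont: "continuous_on UNIV (\<lambda>(t, x). u t x)"
proof -
  have "isCont (\<lambda>(t, x). u t x) (t, x)" for t x
  proof -
    define C where "C = sqrt (LINT x|lborel. (deriv \<Psi> x)\<^sup>2) + sqrt 2"
    have H: "((\<lambda>s. H1_norm (u s - u t)) \<longlongrightarrow> 0) (at t)" using sol by (simp add: is_global_solution_def C0_H1_def)
    have H0: "H1_norm (u t - u t) = 0"
    proof -
      have wd: "is_weak_deriv (\<lambda>x. 0) (\<lambda>x. 0)" by (rule is_weak_deriv_C1) auto
      have "wderiv (\<lambda>x. 0) \<in> borel_measurable lborel"
        using wderiv_is_weak_deriv[OF wd] by (simp add: is_weak_deriv_def locally_integrable_def)
      then have "L2_norm (wderiv (\<lambda>x. 0)) = L2_norm (\<lambda>x. 0)"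
        by (intro L2w_cong_AE(2)) (auto intro: wderiv_AE_eq[OF tr wd])
      moreover have "u t - u t = (\<lambda>x. 0)" by (simp add: fun_eq_iff)
      ultimately show ?thesis by (simp add: H1_norm_def L2w_norm_def)
    qed
    have "((\<lambda>s. H1_norm (u s - u t)) \<longlongrightarrow> 0) (nhds t)"
      using tendsto_at_iff_tendsto_nhds[of "\<lambda>s. H1_norm (u s - u t)" t] H H0 by simp
    then have H': "((\<lambda>p. H1_norm (u (fst p) - u t)) \<longlongrightarrow> 0) (at (t, x))"
      by (rule filterlim_compose) (auto intro!: tendsto_eq_intros)
    have cu: "isCont (u t) x" using u_in_H1[of t] by (auto simp: H1_def continuous_on_eq_continuous_at)
    have cu': "((\<lambda>p. u t (snd p)) \<longlongrightarrow> u t x) (at (t, x))"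
      by (rule isCont_tendsto_compose[OF cu]) (auto intro!: tendsto_eq_intros)
    have "((\<lambda>p. u (fst p) (snd p) - u t (snd p)) \<longlongrightarrow> 0) (at (t, x))"
    proof (rule Lim_null_comparison)
      show "\<forall>\<^sub>F p in at (t, x). norm (u (fst p) (snd p) - u t (snd p)) \<le> C * H1_norm (u (fst p) - u t)"
        using u_diff_bound by (simp add: C_def)
      show "((\<lambda>p. C * H1_norm (u (fst p) - u t)) \<longlongrightarrow> 0) (at (t, x))"
        using tendsto_mult_left[OF H', of C] by simp
    qed
    from tendsto_add[OF this cu'] show ?thesis by (simp add: isCont_def case_prod_unfold)
  qed
  then show ?thesis by (simp add: continuous_on_eq_continuous_at split: prod.splits)
qed

lemma F_cont: "continuous_on UNIV (\<lambda>(s, y). F s y)"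
  unfolding F_def split_beta
  by (intro continuous_intros continuous_on_pair_compose[OF u_cont] continuous_on_compose2[OF K_continuous]) auto

lemma F_support: "1 < \<bar>y\<bar> \<Longrightarrow> F s y = 0" by (simp add: F_def admissibleD(3)[OF K])

text \<open>The space primitive of the source.\<close>

definition F_primitive where "F_primitive s = primitive (F s)"
lemma F_primitive_cont: "continuous_on UNIV (\<lambda>(s, x). F_primitive s x)" unfolding F_primitive_def by (rule primitive_continuous[OF F_cont])
lemma F_primitive_deriv: "(F_primitive s has_real_derivative F s x) (at x)"
  unfolding F_primitive_def by (rule primitive_has_deriv[OF continuous_on_slice[OF F_cont]])

text \<open>D'Alembert decomposition at time \<open>t\<close>: \<open>u(t, x) = A t (x + t) + B t (x - t)\<close>.  If the source is
  switched off after time \<open>t\<close>, the solution continues at time \<open>s\<close> as \<open>A t (x + s) + B t (x - s)\<close>, so \<open>A t\<close>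
  and \<open>B t\<close> also describe the linear wave that is pulled back to time 0.  The derivatives in space are
  \<open>A'\<close> and \<open>B'\<close>.\<close>

definition A where "A t \<xi> = - (1/2) * integral {0..t} (\<lambda>s. F_primitive s (\<xi> - s))"
definition A' where "A' t \<xi> = - (1/2) * integral {0..t} (\<lambda>s. F s (\<xi> - s))"
definition B where "B t \<xi> = f \<xi> + (1/2) * integral {0..t} (\<lambda>s. F_primitive s (\<xi> + s))"
definition B' where "B' t \<xi> = f' \<xi> + (1/2) * integral {0..t} (\<lambda>s. F s (\<xi> + s))"

text \<open>Integrals along the characteristics \<open>\<xi> - s\<close> and \<open>\<xi> + s\<close>.\<close>

lemma integral_char_deriv:
  assumes "c = 1 \<or> c = (-1::real)"
  shows "((\<lambda>\<xi>. integral {0..t} (\<lambda>s. F_primitive s (\<xi> + c * s))) has_real_derivative integral {0..t} (\<lambda>s. F s (\<xi> + c * s))) (at \<xi>)"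
proof -
  have "((\<lambda>\<xi>. integral (cbox 0 t) (\<lambda>s. F_primitive s (\<xi> + c * s))) has_real_derivative integral (cbox 0 t) (\<lambda>s. F s (\<xi> + c * s))) (at \<xi> within UNIV)"
  proof (rule leibniz_rule_field_derivative)
    fix x s
    have "((\<lambda>x. x + c * s) has_real_derivative 1) (at x)" by (auto intro!: derivative_eq_intros)
    from DERIV_chain2[OF F_primitive_deriv this]
    show "((\<lambda>x. F_primitive s (x + c * s)) has_real_derivative F s (x + c * s)) (at x within UNIV)" by simp
    show "(\<lambda>s. F_primitive s (x + c * s)) integrable_on cbox 0 t"
      by (intro integrable_continuous continuous_on_pair_compose[OF F_primitive_cont] continuous_intros)
  next
    show "continuous_on (UNIV \<times> cbox 0 t) (\<lambda>(x, s). F s (x + c * s))"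
      unfolding split_beta by (intro continuous_on_pair_compose[OF F_cont] continuous_intros)
  qed auto
  then show ?thesis by simp
qed

lemma integral_char_cont: "continuous_on UNIV (\<lambda>\<xi>. integral {0..t} (\<lambda>s. F s (\<xi> + c * s)))"
proof -
  have "continuous_on (UNIV \<times> cbox 0 t) (\<lambda>(x, s). F s (x + c * s))"
    unfolding split_beta by (intro continuous_on_pair_compose[OF F_cont] continuous_intros)
  from integral_continuous_on_param[OF this] show ?thesis by simp
qed

lemma A_deriv: "(A t has_real_derivative A' t \<xi>) (at \<xi>)"
  unfolding A_def[abs_def] A'_def using DERIV_cmult[OF integral_char_deriv[of "-1" t \<xi>], of "-(1/2)"] by simp

lemma B_deriv: "(B t has_real_derivative B' t \<xi>) (at \<xi>)"
  unfolding B_def[abs_def] B'_def using DERIV_add[OF Df[of \<xi>] DERIV_cmult[OF integral_char_deriv[of 1 t \<xi>], of "1/2"]] by simp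

lemma A'_cont: "continuous_on UNIV (A' t)"
  unfolding A'_def[abs_def] using integral_char_cont[of t "-1"] by (auto intro!: continuous_intros)

lemma B'_cont: "continuous_on UNIV (B' t)"
  unfolding B'_def[abs_def] using integral_char_cont[of t 1] f'_continuous by (auto intro!: continuous_intros)

lemma A'_support: assumes "R0 + \<bar>t\<bar> + 1 < \<bar>\<xi>\<bar>" shows "A' t \<xi> = 0"
proof -
  have "integral {0..t} (\<lambda>s. F s (\<xi> - s)) = integral {0..t} (\<lambda>s. 0)"
    by (rule integral_cong) (use assms R0 in \<open>auto intro!: F_support\<close>)
  then show ?thesis by (simp add: A'_def)
qed

lemma B'_support: assumes "R0 + \<bar>t\<bar> + 1 < \<bar>\<xi>\<bar>" shows "B' t \<xi> = 0"
proof -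
  have "integral {0..t} (\<lambda>s. F s (\<xi> + s)) = integral {0..t} (\<lambda>s. 0)"
    by (rule integral_cong) (use assms R0 in \<open>auto intro!: F_support\<close>)
  then show ?thesis using assms zf'[of \<xi>] by (simp add: B'_def)
qed

text \<open>The inner integral of Duhamel's formula, i.e. the source at time \<open>s\<close> integrated over the section of the
  backward light cone of \<open>(t, x)\<close>.\<close>

definition G where "G x t s = F_primitive s (x + (t - s)) - F_primitive s (x - (t - s))"

lemma G_cont: "continuous_on S (G x t)"
  unfolding G_def[abs_def] by (intro continuous_intros continuous_on_pair_compose[OF F_primitive_cont])

lemma u_formula: assumes "0 \<le> t" shows "u t x = f (x - t) - (1/2) * integral {0..t} (G x t)"
proof -
  have ls: "lin_sol (f, \<lambda>x. - f' x) t x = f (x - t)"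
  proof -
    have "(LBINT s=ereal (x - t)..ereal (x + t). - f' s) = - f (x + t) - (- f (x - t))"
    proof (rule interval_integral_FTC_finite)
      show "continuous_on {min (x - t) (x + t)..max (x - t) (x + t)} (\<lambda>s. - f' s)"
        by (rule continuous_on_subset[OF continuous_on_minus[OF f'_continuous]]) simp
      show "((\<lambda>y. - f y) has_vector_derivative - f' y) (at y within {min (x - t) (x + t)..max (x - t) (x + t)})" for y
        using has_field_derivative_at_within[OF DERIV_minus[OF Df[of y]]]
        by (simp add: has_real_derivative_iff_has_vector_derivative)
    qed
    then show ?thesis by (simp add: lin_sol_def add_divide_distrib diff_divide_distrib)
  qed
  have "(LBINT s=ereal 0..ereal t. (LBINT y=ereal (x - (t - s))..ereal (x + (t - s)). K y * (u s y) ^ 3))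
     = (LBINT s=ereal 0..ereal t. G x t s)"
    unfolding F_def[symmetric] primitive_LBINT[OF continuous_on_slice[OF F_cont]] G_def F_primitive_def ..
  also have "\<dots> = integral {0..t} (G x t)"
    by (rule interval_integral_eq_integral[OF assms borel_integrable_atLeastAtMost'[OF G_cont]])
  finally have e: "(LBINT s=ereal 0..ereal t. (LBINT y=ereal (x - (t - s))..ereal (x + (t - s)). K y * (u s y) ^ 3)) = integral {0..t} (G x t)" .
  have "u t x = lin_sol (f, \<lambda>x. - f' x) t x - (1/2) *
      (LBINT s=ereal 0..ereal t. (LBINT y=ereal (x - (t - s))..ereal (x + (t - s)). K y * (u s y) ^ 3))"
    using sol unfolding is_global_solution_def by blast
  then show ?thesis unfolding ls e .
qed

lemma AB_formula: "A t (x + s) + B t (x - s) = f (x - s) - (1/2) * integral {0..t} (G x s)"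
proof -
  have "integral {0..t} (G x s) = integral {0..t} (\<lambda>r. F_primitive r (x + s - r)) - integral {0..t} (\<lambda>r. F_primitive r (x - s + r))"
    unfolding G_def[abs_def]
    by (subst integral_diff[symmetric])
       (auto intro!: integrable_continuous_interval continuous_on_pair_compose[OF F_primitive_cont] continuous_intros simp: algebra_simps)
  then show ?thesis by (simp add: A_def B_def algebra_simps)
qed

lemma u_AB: "0 \<le> t \<Longrightarrow> u t x = A t (x + t) + B t (x - t)"
  unfolding AB_formula by (rule u_formula)

lemma F_bounded: obtains M where "0 < M" "\<And>s y. s \<in> {0..T} \<Longrightarrow> \<bar>F s y\<bar> \<le> M"
proof -
  have "compact ((\<lambda>(s, y). F s y) ` ({0..T} \<times> {-1..1}))"
    by (intro compact_continuous_image continuous_on_subset[OF F_cont] compact_Times) auto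
  then obtain M where M: "\<forall>z \<in> (\<lambda>(s, y). F s y) ` ({0..T} \<times> {-1..1}). norm z \<le> M" using compact_imp_bounded bounded_iff by metis
  have "\<bar>F s y\<bar> \<le> max M 1" if "s \<in> {0..T}" for s y
  proof (cases "1 < \<bar>y\<bar>")
    case False
    then have "(s, y) \<in> {0..T} \<times> {-1..1}" using that by auto
    from imageI[OF this, of "\<lambda>(s, y). F s y"] have "F s y \<in> (\<lambda>(s, y). F s y) ` ({0..T} \<times> {-1..1})" by simp
    with M have "norm (F s y) \<le> M" by blast
    then show ?thesis by simp
  qed (simp add: F_support)
  then show ?thesis using that[of "max M 1"] by simp
qed

text \<open>Switching the source off at time \<open>t\<close> changes \<open>u\<close> at time \<open>s\<close> by an integral over a triangle of area
  \<open>O((s - t)\<^sup>2)\<close>, which does not contribute to the derivative.\<close>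

lemma u_time_deriv:
  assumes t: "0 < t"
  shows "((\<lambda>s. (u s x - u t x) / (s - t)) \<longlongrightarrow> A' t (x + t) - B' t (x - t)) (at t)"
proof -
  obtain M where M: "0 < M" "\<And>s y. s \<in> {0..t+1} \<Longrightarrow> \<bar>F s y\<bar> \<le> M" using F_bounded by blast
  define w where "w s = A t (x + s) + B t (x - s)" for s
  have Gb: "\<bar>G x s r\<bar> \<le> 2 * M * \<bar>s - r\<bar>" if "r \<in> {0..t+1}" for s r
  proof -
    have "\<bar>G x s r\<bar> \<le> M * \<bar>(x + (s - r)) - (x - (s - r))\<bar>"
      unfolding G_def F_primitive_def by (rule primitive_lipschitz[OF continuous_on_slice[OF F_cont] M(2)[OF that]])
    also have "\<bar>(x + (s - r)) - (x - (s - r))\<bar> = 2 * \<bar>s - r\<bar>"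
    proof -
      have e: "(x + (s - r)) - (x - (s - r)) = 2 * (s - r)" by simp
      show ?thesis unfolding e abs_mult by simp
    qed
    finally show ?thesis by (simp add: mult_ac)
  qed
  have gi: "G x s integrable_on {a..b}" for s a b by (rule integrable_continuous_interval[OF G_cont])
  have Rb: "\<bar>u s x - w s\<bar> \<le> M * \<bar>s - t\<bar> * \<bar>s - t\<bar>" if s: "0 < s" "s < t + 1" for s
  proof -
    have b: "\<bar>integral {a..b} (G x s)\<bar> \<le> 2 * M * \<bar>s - t\<bar> * (b - a)" if "a \<le> b" "0 \<le> a" "b \<le> t + 1" "\<And>r. r \<in> {a..b} \<Longrightarrow> \<bar>s - r\<bar> \<le> \<bar>s - t\<bar>" for a b
    proof -
      have "norm (integral {a..b} (G x s)) \<le> 2 * M * \<bar>s - t\<bar> * (b - a)"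
      proof (rule integral_bound[OF that(1) G_cont])
        fix r assume r: "r \<in> {a..b}"
        have "2 * M * \<bar>s - r\<bar> \<le> 2 * M * \<bar>s - t\<bar>" using that(4)[OF r] M(1) by simp
        then show "norm (G x s r) \<le> 2 * M * \<bar>s - t\<bar>" using Gb[of r s] r that by simp
      qed
      then show ?thesis by simp
    qed
    have "u s x - w s = (1/2) * (integral {0..t} (G x s) - integral {0..s} (G x s))"
      unfolding w_def AB_formula using u_formula[of s x] s by (simp add: field_simps)
    also have "\<bar>\<dots>\<bar> \<le> M * \<bar>s - t\<bar> * \<bar>s - t\<bar>"
    proof (cases "t \<le> s")
      case True
      have "integral {0..t} (G x s) + integral {t..s} (G x s) = integral {0..s} (G x s)"
        by (rule Henstock_Kurzweil_Integration.integral_combine) (use t True gi in auto)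
      moreover have "\<bar>integral {t..s} (G x s)\<bar> \<le> 2 * M * \<bar>s - t\<bar> * (s - t)" by (rule b) (use True s t in auto)
      ultimately show ?thesis using True by simp
    next
      case False
      have "integral {0..s} (G x s) + integral {s..t} (G x s) = integral {0..t} (G x s)"
        by (rule Henstock_Kurzweil_Integration.integral_combine) (use s False gi in auto)
      moreover have "\<bar>integral {s..t} (G x s)\<bar> \<le> 2 * M * \<bar>s - t\<bar> * (t - s)" by (rule b) (use False s t in auto)
      moreover have "\<bar>s - t\<bar> = t - s" using False by simp
      ultimately show ?thesis by simp
    qed
    finally show ?thesis .
  qed
  have ut: "u t x = w t" using t by (simp add: w_def u_AB)
  have "((\<lambda>s. (u s x - w s) / (s - t)) \<longlongrightarrow> 0) (at t)"
  proof (rule Lim_null_comparison)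
    have "\<forall>\<^sub>F s in at t. s \<in> {0<..<t+1}" by (rule eventually_at_in_open') (use t in auto)
    then show "\<forall>\<^sub>F s in at t. norm ((u s x - w s) / (s - t)) \<le> M * \<bar>s - t\<bar>"
    proof eventually_elim
      case (elim s)
      then show ?case using Rb[of s] M(1) by (cases "s = t") (auto simp: divide_le_eq)
    qed
    show "((\<lambda>s. M * \<bar>s - t\<bar>) \<longlongrightarrow> 0) (at t)" by (auto intro!: tendsto_eq_intros)
  qed
  moreover have "((\<lambda>s. (w s - w t) / (s - t)) \<longlongrightarrow> A' t (x + t) - B' t (x - t)) (at t)"
    unfolding w_def by (rule has_L2_time_deriv_dAlembert(3)[OF A_deriv A'_cont A'_support B_deriv B'_cont B'_support])
  ultimately have "((\<lambda>s. (u s x - w s) / (s - t) + (w s - w t) / (s - t)) \<longlongrightarrow> 0 + (A' t (x + t) - B' t (x - t))) (at t)"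
    by (rule tendsto_add)
  then show ?thesis using ut by (simp flip: add_divide_distrib)
qed

lemma u_has_time_deriv: "has_L2_time_deriv u t (dt u t)"
proof -
  have "\<exists>z. has_L2_time_deriv u t z" using sol unfolding is_global_solution_def C1_L2_def by blast
  then show ?thesis unfolding dt_def by (rule someI_ex)
qed

lemma dt_u_AE:
  assumes "0 < t" shows "AE x in lborel. dt u t x = A' t (x + t) - B' t (x - t)"
proof (rule L2_time_deriv_pointwise[OF u_has_time_deriv u_time_deriv[OF assms]])
  show "(\<lambda>x. A' t (x + t) - B' t (x - t)) \<in> borel_measurable lborel"
    by (intro continuous_imp_borel_lborel continuous_intros continuous_on_compose2[OF A'_cont] continuous_on_compose2[OF B'_cont]) auto
  show "(\<lambda>x. u s x - u t x) \<in> L2" for s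
    using L2w_diff[of "\<lambda>_. 1" "u s" "u t"] u_in_H1 by (auto simp: H1_def)
qed

end

lemma interval_integral_cong_AE_lborel:
  fixes g g' :: "real \<Rightarrow> real"
  assumes "g \<in> borel_measurable lborel" "g' \<in> borel_measurable lborel" "AE x in lborel. g x = g' x"
  shows "(LBINT x=ereal a..ereal b. g x) = (LBINT x=ereal a..ereal b. g' x)"
proof -
  have *: "(LBINT x=ereal a..ereal b. g x) = (LBINT x=ereal a..ereal b. g' x)" if "a \<le> b" for a b
    by (rule interval_lebesgue_integral_cong_AE) (use assms that in auto)
  show ?thesis
    using *[of a b] *[of b a] interval_integral_endpoints_reverse[of "ereal a" "ereal b" g]
      interval_integral_endpoints_reverse[of "ereal a" "ereal b" g'] by (cases "a \<le> b") auto
qed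

context wave begin

text \<open>The state at time \<open>t\<close>, pulled back to time 0 by the linear group, is \<open>(A t + B t, A' t - B' t)\<close>.\<close>

lemma pulled_back:
  assumes t: "0 < t"
  shows "fst (lin_group (- t) (u t, dt u t)) = (\<lambda>x. A t x + B t x)"
    and "AE x in lborel. snd (lin_group (- t) (u t, dt u t)) x = A' t x - B' t x"
    and "snd (lin_group (- t) (u t, dt u t)) \<in> L2"
proof -
  have cz: "continuous_on UNIV (\<lambda>x. A' t (x + t) - B' t (x - t))"
    by (intro continuous_intros continuous_on_compose2[OF A'_cont] continuous_on_compose2[OF B'_cont]) auto
  have ls: "lin_sol (u t, dt u t) = (\<lambda>\<tau> x. A t (x + \<tau> + t) + B t (x - \<tau> - t))"
  proof (intro ext)
    fix \<tau> x
    have "(LBINT s=ereal (x - \<tau>)..ereal (x + \<tau>). dt u t s) = (LBINT s=ereal (x - \<tau>)..ereal (x + \<tau>). A' t (s + t) - B' t (s - t))"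
      by (rule interval_integral_cong_AE_lborel[OF _ continuous_imp_borel_lborel[OF cz] dt_u_AE[OF t]])
         (use u_has_time_deriv[of t] in \<open>simp add: has_L2_time_deriv_def L2w_def\<close>)
    also have "\<dots> = (A t (x + \<tau> + t) - B t (x + \<tau> - t)) - (A t (x - \<tau> + t) - B t (x - \<tau> - t))"
    proof (rule interval_integral_FTC_finite)
      fix y
      have "((\<lambda>y. A t (y + t) - B t (y - t)) has_real_derivative A' t (y + t) * (1 + 0) - B' t (y - t) * (1 - 0)) (at y)"
        by (intro DERIV_diff DERIV_add DERIV_chain2[OF A_deriv] DERIV_chain2[OF B_deriv] DERIV_ident DERIV_const)
      then have "((\<lambda>y. A t (y + t) - B t (y - t)) has_vector_derivative A' t (y + t) - B' t (y - t)) (at y)"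
        by (simp add: has_real_derivative_iff_has_vector_derivative)
      then show "((\<lambda>y. A t (y + t) - B t (y - t)) has_vector_derivative A' t (y + t) - B' t (y - t))
         (at y within {min (x - \<tau>) (x + \<tau>)..max (x - \<tau>) (x + \<tau>)})"
        by (rule has_vector_derivative_at_within)
    qed (rule continuous_on_subset[OF cz], simp)
    finally show "lin_sol (u t, dt u t) \<tau> x = A t (x + \<tau> + t) + B t (x - \<tau> - t)"
      using t by (simp add: lin_sol_def u_AB field_simps)
  qed
  show "fst (lin_group (- t) (u t, dt u t)) = (\<lambda>x. A t x + B t x)"
    by (simp add: lin_group_def ls)
  let ?A = "\<lambda>x. A t (x + t)" and ?B = "\<lambda>x. B t (x - t)" and ?A' = "\<lambda>x. A' t (x + t)" and ?B' = "\<lambda>x. B' t (x - t)"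
  define R where "R = R0 + \<bar>t\<bar> + 1 + \<bar>t\<bar>"
  have DA: "(?A has_real_derivative ?A' x) (at x)" for x
    using DERIV_chain2[OF A_deriv DERIV_add[OF DERIV_ident DERIV_const[of t]], of t x UNIV] by simp
  have DB: "(?B has_real_derivative ?B' x) (at x)" for x
    using DERIV_chain2[OF B_deriv DERIV_diff[OF DERIV_ident DERIV_const[of t]], of t x UNIV] by simp
  have cA: "continuous_on UNIV ?A'" and cB: "continuous_on UNIV ?B'"
    by (auto intro!: continuous_intros continuous_on_compose2[OF A'_cont] continuous_on_compose2[OF B'_cont])
  have zA: "R < \<bar>x\<bar> \<Longrightarrow> ?A' x = 0" and zB: "R < \<bar>x\<bar> \<Longrightarrow> ?B' x = 0" for x
    by (auto intro!: A'_support B'_support simp: R_def)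
  note dA = has_L2_time_deriv_dAlembert[where R = R and t = "-t", OF DA cA zA DB cB zB]
  have ls': "lin_sol (u t, dt u t) = (\<lambda>\<tau> x. ?A (x + \<tau>) + ?B (x - \<tau>))" unfolding ls ..
  have "has_L2_time_deriv (lin_sol (u t, dt u t)) (-t) (\<lambda>x. ?A' (x + - t) - ?B' (x - - t))"
    unfolding ls' by (rule dA(1))
  then have h: "has_L2_time_deriv (lin_sol (u t, dt u t)) (-t) (dt (lin_sol (u t, dt u t)) (-t))"
    unfolding dt_def[of "lin_sol (u t, dt u t)"] by (rule someI[of "has_L2_time_deriv (lin_sol (u t, dt u t)) (-t)"])
  then show "snd (lin_group (- t) (u t, dt u t)) \<in> L2" by (simp add: lin_group_def has_L2_time_deriv_def)
  have "AE x in lborel. dt (lin_sol (u t, dt u t)) (-t) x = ?A' (x + - t) - ?B' (x - - t)"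
  proof (rule L2_time_deriv_pointwise[OF h])
    show "(\<lambda>x. A' t (x + - t + t) - B' t (x - - t - t)) \<in> borel_measurable lborel"
      by (intro continuous_imp_borel_lborel continuous_intros continuous_on_compose2[OF A'_cont] continuous_on_compose2[OF B'_cont]) auto
    show "((\<lambda>s. (lin_sol (u t, dt u t) s x - lin_sol (u t, dt u t) (- t) x) / (s - - t)) \<longlongrightarrow>
        A' t (x + - t + t) - B' t (x - - t - t)) (at (- t))" for x
      unfolding ls' using dA(3)[of x] by simp
    show "(\<lambda>x. lin_sol (u t, dt u t) s x - lin_sol (u t, dt u t) (- t) x) \<in> L2" for s
      unfolding ls' using dA(2)[of s] by simp
  qed
  then show "AE x in lborel. snd (lin_group (- t) (u t, dt u t)) x = A' t x - B' t x"
    by (simp add: lin_group_def)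
qed

end

section \<open>Testing the scattering state\<close>

text \<open>The integral of \<open>(f' + g) \<phi>\<close> for \<open>d = (f, g)\<close>, with the derivative moved to \<open>\<phi>\<close>.  It sees the
  left-moving component of \<open>d\<close> only.\<close>

definition pairing :: "(real \<Rightarrow> real) \<Rightarrow> data \<Rightarrow> real" where
  "pairing \<phi> d = (LINT x|lborel. snd d x * \<phi> x) - (LINT x|lborel. fst d x * deriv \<phi> x)"

lemma test_weighted_integrable:
  assumes "test_function \<phi>"
  shows "integrable lborel (\<lambda>x. (\<phi> x)\<^sup>2 / jap_inv x)"
proof -
  obtain R where R: "\<And>x. R < \<bar>x\<bar> \<Longrightarrow> \<phi> x = 0" using test_function_props[OF assms] by metis
  have "continuous_on UNIV (\<lambda>x. (\<phi> x)\<^sup>2 * sqrt (1 + x\<^sup>2))"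
    by (intro continuous_intros test_function_continuous[OF assms])
  then show ?thesis using continuous_compact_support_integrable[of "\<lambda>x. (\<phi> x)\<^sup>2 * sqrt (1 + x\<^sup>2)" R] R
    by (simp add: jap_inv_def jap_def divide_inverse)
qed

lemma L2w_jap_inv_test:
  assumes "g \<in> L2w jap_inv" and t: "test_function \<phi>" and s: "\<And>x. \<phi> x \<noteq> 0 \<Longrightarrow> \<bar>x\<bar> \<le> 5"
  shows "integrable lborel (\<lambda>x. g x * \<phi> x)"
    and "\<bar>LINT x|lborel. g x * \<phi> x\<bar> \<le> L2w_norm jap_inv g * sqrt (6 * (LINT x|lborel. (\<phi> x)\<^sup>2))"
proof -
  note c = continuous_imp_borel_lborel[OF test_function_continuous(1)[OF t]]
  show "integrable lborel (\<lambda>x. g x * \<phi> x)"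
    by (rule Cauchy_Schwarz_L2w(1)[OF _ assms(1) c test_weighted_integrable[OF t]]) simp
  have i2: "integrable lborel (\<lambda>x. (\<phi> x)\<^sup>2)"
  proof -
    obtain R where R: "\<And>x. R < \<bar>x\<bar> \<Longrightarrow> \<phi> x = 0" using test_function_props[OF t] by metis
    show ?thesis using continuous_compact_support_L2[OF test_function_continuous(1)[OF t] R] by (simp add: L2w_def)
  qed
  have "(LINT x|lborel. (\<phi> x)\<^sup>2 / jap_inv x) \<le> (LINT x|lborel. 6 * (\<phi> x)\<^sup>2)"
  proof (rule integral_mono[OF test_weighted_integrable[OF t]])
    show "integrable lborel (\<lambda>x. 6 * (\<phi> x)\<^sup>2)" using i2 by simp
    fix x
    show "(\<phi> x)\<^sup>2 / jap_inv x \<le> 6 * (\<phi> x)\<^sup>2"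
    proof (cases "\<phi> x = 0")
      case False
      have "x\<^sup>2 \<le> 5\<^sup>2" using power_mono[OF s[OF False] abs_ge_zero, of 2] by simp
      then have "jap x \<le> 6" unfolding jap_def by (intro real_le_lsqrt) auto
      then show ?thesis using mult_right_mono[of "jap x" 6 "(\<phi> x)\<^sup>2"] by (simp add: jap_inv_def divide_inverse mult.commute)
    qed simp
  qed
  also have "\<dots> = 6 * (LINT x|lborel. (\<phi> x)\<^sup>2)" by simp
  finally have le: "sqrt (LINT x|lborel. (\<phi> x)\<^sup>2 / jap_inv x) \<le> sqrt (6 * (LINT x|lborel. (\<phi> x)\<^sup>2))" by simp
  have "\<bar>LINT x|lborel. g x * \<phi> x\<bar> \<le> L2w_norm jap_inv g * sqrt (LINT x|lborel. (\<phi> x)\<^sup>2 / jap_inv x)"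
    by (rule Cauchy_Schwarz_L2w(2)[OF _ assms(1) c test_weighted_integrable[OF t]]) simp
  also have "\<dots> \<le> L2w_norm jap_inv g * sqrt (6 * (LINT x|lborel. (\<phi> x)\<^sup>2))"
    by (rule mult_left_mono[OF le]) (simp add: L2w_norm_nonneg)
  finally show "\<bar>LINT x|lborel. g x * \<phi> x\<bar> \<le> L2w_norm jap_inv g * sqrt (6 * (LINT x|lborel. (\<phi> x)\<^sup>2))" .
qed

lemma Y_spaceE:
  assumes "d \<in> Y_space"
  obtains h where "continuous_on UNIV (fst d)" "h \<in> L2w jap_inv" "is_weak_deriv (fst d) h" "snd d \<in> L2w jap_inv"
  using assms unfolding Y_space_def by (auto split: prod.splits)

lemma Y_space_diff:
  assumes "d \<in> Y_space" "d' \<in> Y_space"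
  shows "d - d' \<in> Y_space"
proof -
  obtain h where h: "continuous_on UNIV (fst d)" "h \<in> L2w jap_inv" "is_weak_deriv (fst d) h" "snd d \<in> L2w jap_inv"
    using Y_spaceE[OF assms(1)] .
  obtain h' where h': "continuous_on UNIV (fst d')" "h' \<in> L2w jap_inv" "is_weak_deriv (fst d') h'" "snd d' \<in> L2w jap_inv"
    using Y_spaceE[OF assms(2)] .
  have 1: "continuous_on UNIV (fst (d - d'))" using h(1) h'(1) by (simp add: fun_diff_def continuous_on_diff)
  have 2: "is_weak_deriv (fst (d - d')) (\<lambda>x. h x - h' x)"
    using is_weak_deriv_diff[OF h(3) h'(3)] by (simp add: fun_diff_def)
  have 3: "(\<lambda>x. h x - h' x) \<in> L2w jap_inv" "snd (d - d') \<in> L2w jap_inv"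
    using L2w_diff[OF _ h(2) h'(2)] L2w_diff[OF _ h(4) h'(4)] by (auto simp: fun_diff_def)
  show ?thesis using 1 2 3 unfolding Y_space_def by (auto split: prod.splits simp: prod_eq_iff)
qed

lemma pairing_diff:
  assumes "d \<in> Y_space" "d' \<in> Y_space" and t: "test_function \<phi>" and s: "\<And>x. \<phi> x \<noteq> 0 \<Longrightarrow> \<bar>x\<bar> \<le> 5"
  shows "pairing \<phi> (d - d') = pairing \<phi> d - pairing \<phi> d'"
proof -
  obtain h where h: "continuous_on UNIV (fst d)" "h \<in> L2w jap_inv" "is_weak_deriv (fst d) h" "snd d \<in> L2w jap_inv"
    using Y_spaceE[OF assms(1)] .
  obtain h' where h': "continuous_on UNIV (fst d')" "h' \<in> L2w jap_inv" "is_weak_deriv (fst d') h'" "snd d' \<in> L2w jap_inv"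
    using Y_spaceE[OF assms(2)] .
  note l = locally_integrable_test(2)[OF locally_integrable_continuous t]
  show ?thesis
    using L2w_jap_inv_test(1)[OF h(4) t s] L2w_jap_inv_test(1)[OF h'(4) t s] l[OF h(1)] l[OF h'(1)]
    by (simp add: pairing_def left_diff_distrib)
qed

lemma pairing_bound:
  assumes tr: "transition \<Psi>" and d: "d \<in> Y_space" and t: "test_function \<phi>" and s: "\<And>x. \<phi> x \<noteq> 0 \<Longrightarrow> \<bar>x\<bar> \<le> 5"
  shows "\<bar>pairing \<phi> d\<bar> \<le> 2 * sqrt (6 * (LINT x|lborel. (\<phi> x)\<^sup>2)) * Y_norm d"
proof -
  obtain h where h: "continuous_on UNIV (fst d)" "h \<in> L2w jap_inv" "is_weak_deriv (fst d) h" "snd d \<in> L2w jap_inv"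
    using Y_spaceE[OF d] .
  let ?c = "sqrt (6 * (LINT x|lborel. (\<phi> x)\<^sup>2))"
  have c: "0 \<le> ?c" by (simp add: Bochner_Integration.integral_nonneg)
  have "wderiv (fst d) \<in> borel_measurable lborel"
    using wderiv_is_weak_deriv[OF h(3)] by (simp add: is_weak_deriv_def locally_integrable_def)
  then have n: "L2w_norm jap_inv (wderiv (fst d)) = L2w_norm jap_inv h"
    using L2w_cong_AE(2)[OF _ _ wderiv_AE_eq[OF tr h(3)]] h(2) by (auto simp: L2w_def)
  have Y: "Y_norm d = sqrt ((L2w_norm jap_inv h)\<^sup>2 + (L2w_norm jap_inv (snd d))\<^sup>2)"
    using n by (cases d) (simp add: Y_norm_def)
  have le: "L2w_norm jap_inv h \<le> Y_norm d" "L2w_norm jap_inv (snd d) \<le> Y_norm d"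
    unfolding Y by (auto intro!: real_le_rsqrt)
  have "pairing \<phi> d = (LINT x|lborel. snd d x * \<phi> x) + (LINT x|lborel. h x * \<phi> x)"
    using h(3) t by (simp add: pairing_def is_weak_deriv_def)
  then have "\<bar>pairing \<phi> d\<bar> \<le> L2w_norm jap_inv (snd d) * ?c + L2w_norm jap_inv h * ?c"
    using L2w_jap_inv_test(2)[OF h(4) t s] L2w_jap_inv_test(2)[OF h(2) t s] by linarith
  also have "\<dots> \<le> Y_norm d * ?c + Y_norm d * ?c" by (intro add_mono mult_right_mono le c)
  finally show ?thesis by (simp add: algebra_simps)
qed

context wave begin

text \<open>Minus the left-moving component of the scattering state, on the window \<open>-1 \<le> y \<le> 5\<close>: there \<open>F s (y - s)\<close>
  vanishes for \<open>s > 6\<close>.\<close>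

definition left_profile where "left_profile y = integral {0..6} (\<lambda>s. F s (y - s))"

lemma left_profile_cont: "continuous_on UNIV left_profile"
  using integral_char_cont[of 6 "-1"] by (simp add: left_profile_def[abs_def])

text \<open>After time 6 the pulled back states have constant pairing with \<open>\<phi>\<close>, and this pairing is continuous
  in the norm of \<open>Y\<close>.  The term \<open>f' + g\<close> of the data does not appear because \<open>f' + g = 0\<close>.\<close>

lemma scattering_pairing:
  assumes p: "d \<in> Y_space" and lim: "((\<lambda>t. Y_norm (lin_group (- t) (u t, dt u t) - d)) \<longlongrightarrow> 0) at_top"
    and t: "test_function \<phi>" and s: "\<And>x. \<phi> x \<noteq> 0 \<Longrightarrow> -1 \<le> x \<and> x \<le> 5"
  shows "pairing \<phi> d = - (LINT x|lborel. left_profile x * \<phi> x)"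
proof -
  have s': "\<phi> x \<noteq> 0 \<Longrightarrow> \<bar>x\<bar> \<le> 5" for x using s[of x] by auto
  define D where "D \<tau> = lin_group (- \<tau>) (u \<tau>, dt u \<tau>)" for \<tau>
  have *: "D \<tau> \<in> Y_space \<and> pairing \<phi> (D \<tau>) = - (LINT x|lborel. left_profile x * \<phi> x)" if \<tau>: "6 \<le> \<tau>" for \<tau>
  proof -
    have \<tau>0: "0 < \<tau>" using \<tau> by simp
    note pb = pulled_back[OF \<tau>0, folded D_def]
    have DAB: "((\<lambda>x. A \<tau> x + B \<tau> x) has_real_derivative A' \<tau> x + B' \<tau> x) (at x)" for x
      by (intro DERIV_add A_deriv B_deriv)
    have cAB: "continuous_on UNIV (\<lambda>x. A \<tau> x + B \<tau> x)" by (rule DERIV_continuous_on[OF has_field_derivative_at_within[OF DAB]])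
    have cAB': "continuous_on UNIV (\<lambda>x. A' \<tau> x + B' \<tau> x)" by (intro continuous_intros A'_cont B'_cont)
    have wd: "is_weak_deriv (\<lambda>x. A \<tau> x + B \<tau> x) (\<lambda>x. A' \<tau> x + B' \<tau> x)"
      by (rule is_weak_deriv_C1[OF DAB cAB'])
    have "(\<lambda>x. A' \<tau> x + B' \<tau> x) \<in> L2"
      by (rule continuous_compact_support_L2[OF cAB', of "R0 + \<bar>\<tau>\<bar> + 1"]) (simp add: A'_support B'_support)
    then have L: "(\<lambda>x. A' \<tau> x + B' \<tau> x) \<in> L2w jap_inv" "snd (D \<tau>) \<in> L2w jap_inv" using pb(3) L2_subset_L2w by auto
    have Y: "D \<tau> \<in> Y_space"
      unfolding Y_space_def using L cAB wd pb(1) by (auto split: prod.splits simp: prod_eq_iff)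
    have l: "locally_integrable (A' \<tau>)" "locally_integrable (B' \<tau>)" using locally_integrable_continuous A'_cont B'_cont by auto
    have "(LINT x|lborel. snd (D \<tau>) x * \<phi> x) = (LINT x|lborel. (A' \<tau> x - B' \<tau> x) * \<phi> x)"
    proof (rule integral_cong_AE)
      have "\<phi> \<in> borel_measurable lborel" "snd (D \<tau>) \<in> borel_measurable lborel"
        using continuous_imp_borel_lborel[OF test_function_continuous(1)[OF t]] L by (auto simp: L2w_def)
      then show "(\<lambda>x. snd (D \<tau>) x * \<phi> x) \<in> borel_measurable lborel" by simp
      show "(\<lambda>x. (A' \<tau> x - B' \<tau> x) * \<phi> x) \<in> borel_measurable lborel"
        by (intro continuous_imp_borel_lborel continuous_intros A'_cont B'_cont test_function_continuous(1)[OF t])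
      show "AE x in lborel. snd (D \<tau>) x * \<phi> x = (A' \<tau> x - B' \<tau> x) * \<phi> x"
        using pb(2) by auto
    qed
    moreover have "(LINT x|lborel. fst (D \<tau>) x * deriv \<phi> x) = - (LINT x|lborel. (A' \<tau> x + B' \<tau> x) * \<phi> x)"
      using wd t by (simp add: pb(1) is_weak_deriv_def)
    ultimately have "pairing \<phi> (D \<tau>) = (LINT x|lborel. 2 * (A' \<tau> x * \<phi> x))"
      using locally_integrable_test(1)[OF l(1) t] locally_integrable_test(1)[OF l(2) t]
      by (simp add: pairing_def distrib_right left_diff_distrib)
    also have "\<dots> = (LINT x|lborel. - (left_profile x * \<phi> x))"
    proof (rule Bochner_Integration.integral_cong[OF refl])
      fix x
      show "2 * (A' \<tau> x * \<phi> x) = - (left_profile x * \<phi> x)"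
      proof (cases "\<phi> x = 0")
        case False
        have i: "(\<lambda>s. F s (x - s)) integrable_on {a..b}" for a b
          by (intro integrable_continuous_interval continuous_on_pair_compose[OF F_cont] continuous_intros)
        have "integral {0..6} (\<lambda>s. F s (x - s)) + integral {6..\<tau>} (\<lambda>s. F s (x - s)) = integral {0..\<tau>} (\<lambda>s. F s (x - s))"
          by (rule Henstock_Kurzweil_Integration.integral_combine[OF _ _ i]) (use \<tau> in auto)
        moreover have "integral {6..\<tau>} (\<lambda>s. F s (x - s)) = 0"
        proof (cases "6 = \<tau>")
          case False
          have "(( \<lambda>s. F s (x - s)) has_integral 0) {6..\<tau>}"
            by (rule has_integral_spike_finite[where S = "{6}" and f = "\<lambda>s. 0"]) (use s[OF \<open>\<phi> x \<noteq> 0\<close>] in \<open>auto intro!: F_support\<close>)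
          then show ?thesis by (rule integral_unique)
        qed simp
        ultimately show ?thesis by (simp add: A'_def left_profile_def)
      qed simp
    qed
    finally show ?thesis using Y by simp
  qed
  let ?I = "- (LINT x|lborel. left_profile x * \<phi> x)"
  have "((\<lambda>\<tau>. ?I - pairing \<phi> d) \<longlongrightarrow> 0) (at_top :: real filter)"
  proof (rule Lim_null_comparison)
    show "\<forall>\<^sub>F \<tau> in at_top. norm (?I - pairing \<phi> d) \<le> 2 * sqrt (6 * (LINT x|lborel. (\<phi> x)\<^sup>2)) * Y_norm (D \<tau> - d)"
      using eventually_ge_at_top[of 6]
    proof eventually_elim
      case (elim \<tau>)
      then have "D \<tau> \<in> Y_space" "pairing \<phi> (D \<tau>) = ?I" using * by auto
      then show ?case
        using pairing_bound[OF tr Y_space_diff[OF _ p] t s'] pairing_diff[OF _ p t s'] by (metis real_norm_def)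
    qed
    show "((\<lambda>\<tau>. 2 * sqrt (6 * (LINT x|lborel. (\<phi> x)\<^sup>2)) * Y_norm (D \<tau> - d)) \<longlongrightarrow> 0) at_top"
      using tendsto_mult_left[OF lim, folded D_def] by simp
  qed
  then have "?I - pairing \<phi> d = 0" by (simp add: tendsto_const_iff)
  then show ?thesis by simp
qed

end

section \<open>Comparison with the linear wave\<close>

lemma integral_bound_indicators:
  fixes g :: "real \<Rightarrow> real"
  assumes c: "continuous_on {a..b} g" and ab: "a \<le> b"
    and le: "\<And>s. s \<in> {a..b} \<Longrightarrow> \<bar>g s\<bar> \<le> c * indicator {p..q} s + d * indicator {p'..q'} s"
    and "0 \<le> c" "0 \<le> d" "p \<le> q" "p' \<le> q'"
  shows "\<bar>integral {a..b} g\<bar> \<le> c * (q - p) + d * (q' - p')"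
proof -
  have si: "set_integrable lborel {a..b} g" by (rule borel_integrable_atLeastAtMost'[OF c])
  let ?m = "\<lambda>s. c * indicator {p..q} s + d * indicator {p'..q'} s :: real"
  have im: "integrable lborel ?m" using assms by (intro Bochner_Integration.integrable_add integrable_mult_right integrable_real_indicator) auto
  have "integral {a..b} g = (LINT s|lborel. indicator {a..b} s * g s)"
    using set_borel_integral_eq_integral(2)[OF si] by (simp add: set_lebesgue_integral_def)
  also have "\<bar>\<dots>\<bar> \<le> (LINT s|lborel. \<bar>indicator {a..b} s * g s\<bar>)" by (rule integral_abs_bound)
  also have "\<dots> \<le> (LINT s|lborel. ?m s)"
  proof (rule integral_mono[OF _ im])
    show "integrable lborel (\<lambda>s. \<bar>indicator {a..b} s * g s\<bar>)" using si by (simp add: set_integrable_def)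
    show "\<bar>indicator {a..b} s * g s\<bar> \<le> ?m s" for s using le[of s] assms(4,5) by (auto simp: indicator_def)
  qed
  also have "\<dots> = c * (q - p) + d * (q' - p')"
  proof -
    have "(LINT s|lborel. ?m s) = (LINT s|lborel. c * indicator {p..q} s) + (LINT s|lborel. d * indicator {p'..q'} s)"
      using assms by (intro Bochner_Integration.integral_add integrable_mult_right integrable_real_indicator) auto
    then show ?thesis using assms by simp
  qed
  finally show ?thesis .
qed

lemma cube_sum_bound: "\<bar>a + b\<bar> ^ 3 \<le> 4 * \<bar>a\<bar> ^ 3 + 4 * \<bar>b\<bar> ^ 3" for a b :: real
proof -
  have "\<bar>a + b\<bar> ^ 3 \<le> (\<bar>a\<bar> + \<bar>b\<bar>) ^ 3" by (intro power_mono abs_triangle_ineq) auto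
  also have "\<dots> \<le> 4 * \<bar>a\<bar> ^ 3 + 4 * \<bar>b\<bar> ^ 3"
  proof -
    have "0 \<le> 3 * (x + y) * (x - y)\<^sup>2" if "0 \<le> x" "0 \<le> y" for x y :: real using that by simp
    then have "(x + y) ^ 3 \<le> 4 * x ^ 3 + 4 * y ^ 3" if "0 \<le> x" "0 \<le> y" for x y :: real
      using that by (simp add: power2_eq_square power3_eq_cube algebra_simps)
    then show ?thesis by simp
  qed
  finally show ?thesis .
qed

lemma cube_diff_bound: "\<bar>(a + w) ^ 3 - a ^ 3\<bar> \<le> \<bar>w\<bar> * (5 * a\<^sup>2 + 3 * w\<^sup>2)" for a w :: real
proof -
  have e: "(a + w) ^ 3 - a ^ 3 = w * (3 * a\<^sup>2 + 3 * a * w + w\<^sup>2)"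
    by (simp add: power2_eq_square power3_eq_cube algebra_simps)
  have "0 \<le> (a + w)\<^sup>2" "0 \<le> (a - w)\<^sup>2" by simp_all
  then have ww: "2 * (a * w) \<le> a\<^sup>2 + w\<^sup>2" "- (2 * (a * w)) \<le> a\<^sup>2 + w\<^sup>2"
    by (auto simp: power2_eq_square algebra_simps)
  have "\<bar>3 * a\<^sup>2 + 3 * a * w + w\<^sup>2\<bar> \<le> 5 * a\<^sup>2 + 3 * w\<^sup>2"
    using ww zero_le_power2[of a] zero_le_power2[of w] by (intro abs_leI; simp only: mult.assoc; linarith)
  then show ?thesis unfolding e abs_mult by (rule mult_left_mono) simp
qed

context wave begin

lemma G_bound:
  assumes s: "0 \<le> s" "s \<le> t" and w: "\<And>y. \<bar>y\<bar> \<le> 1 \<Longrightarrow> \<bar>u s y - f (y - s)\<bar> \<le> \<omega>"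
    and KB: "\<And>y. K y \<le> Bd" and fB: "\<And>y. \<bar>f y\<bar> \<le> Bd" and fz: "\<And>y. h < \<bar>y + 2\<bar> \<Longrightarrow> f y = 0" and h: "0 < h"
  shows "\<bar>G x t s\<bar> \<le> 8 * Bd ^ 4 * h + 8 * Bd * \<omega> ^ 3"
proof -
  have Bd: "0 \<le> Bd" using fB[of 0] by linarith
  have \<omega>: "0 \<le> \<omega>" using w[of 0] by simp
  have c: "continuous_on S (F s)" for S using continuous_on_slice[OF F_cont] continuous_on_subset by blast
  have "G x t s = integral {x - (t - s)..x + (t - s)} (F s)"
    unfolding G_def F_primitive_def primitive_LBINT[OF continuous_on_slice[OF F_cont], symmetric]
    by (rule interval_integral_eq_integral) (use s c borel_integrable_atLeastAtMost' in auto)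
  also have "\<bar>\<dots>\<bar> \<le> 4 * Bd ^ 4 * ((s - 2 + h) - (s - 2 - h)) + 4 * Bd * \<omega> ^ 3 * (1 - (-1))"
  proof (rule integral_bound_indicators)
    fix y
    show "\<bar>F s y\<bar> \<le> 4 * Bd ^ 4 * indicator {s - 2 - h..s - 2 + h} y + 4 * Bd * \<omega> ^ 3 * indicator {-1..1} y"
    proof (cases "1 < \<bar>y\<bar>")
      case True
      then show ?thesis using Bd \<omega> by (simp add: F_support)
    next
      case False
      have f3: "\<bar>f (y - s)\<bar> ^ 3 \<le> Bd ^ 3 * indicator {s - 2 - h..s - 2 + h} y"
      proof (cases "y \<in> {s - 2 - h..s - 2 + h}")
        case True
        then show ?thesis using fB[of "y - s"] by (simp add: power_mono)
      next
        case False
        then have "f (y - s) = 0" by (intro fz) auto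
        then show ?thesis using False by simp
      qed
      have "\<bar>u s y\<bar> ^ 3 = \<bar>f (y - s) + (u s y - f (y - s))\<bar> ^ 3" by simp
      also have "\<dots> \<le> 4 * \<bar>f (y - s)\<bar> ^ 3 + 4 * \<bar>u s y - f (y - s)\<bar> ^ 3" by (rule cube_sum_bound)
      also have "\<dots> \<le> 4 * (Bd ^ 3 * indicator {s - 2 - h..s - 2 + h} y) + 4 * \<omega> ^ 3"
        using f3 power_mono[OF w[of y] abs_ge_zero, of 3] False by simp
      finally have u3: "\<bar>u s y\<bar> ^ 3 \<le> 4 * (Bd ^ 3 * indicator {s - 2 - h..s - 2 + h} y) + 4 * \<omega> ^ 3" .
      have "\<bar>F s y\<bar> = K y * \<bar>u s y\<bar> ^ 3" using admissibleD(2)[OF K, of y] by (simp add: F_def abs_mult power_abs)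
      also have "\<dots> \<le> Bd * (4 * (Bd ^ 3 * indicator {s - 2 - h..s - 2 + h} y) + 4 * \<omega> ^ 3)"
        by (intro mult_mono KB u3 Bd) simp
      also have "\<dots> = 4 * Bd ^ 4 * indicator {s - 2 - h..s - 2 + h} y + 4 * Bd * \<omega> ^ 3 * indicator {-1..1} y"
      proof -
        have "y \<in> {-1..1}" using False by auto
        then show ?thesis by (simp add: algebra_simps power_numeral_reduce)
      qed
      finally show ?thesis .
    qed
  qed (use s h Bd \<omega> c in auto)
  finally show ?thesis by (simp add: algebra_simps)
qed

text \<open>Continuity argument: at the earliest time at which the remainder reaches \<open>N h\<close> somewhere on the
  support of \<open>K\<close>, Duhamel's formula and the bound at earlier times give a value below \<open>N h\<close>.  The constant
  \<open>N = 48 Bd\<^sup>4\<close> is twice what the cube of the linear wave contributes.\<close>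

lemma remainder_bound:
  assumes KB: "\<And>y. K y \<le> Bd" and fB: "\<And>y. \<bar>f y\<bar> \<le> Bd" and fz: "\<And>y. h < \<bar>y + 2\<bar> \<Longrightarrow> f y = 0"
    and h: "0 < h" and Bd: "0 < Bd" and N: "N = 48 * Bd ^ 4" and small: "N ^ 3 * h\<^sup>2 < Bd ^ 3"
    and t: "0 \<le> t" "t \<le> 6" and x: "\<bar>x\<bar> \<le> 1"
  shows "\<bar>u t x - f (x - t)\<bar> \<le> N * h"
proof (rule ccontr)
  assume neg: "\<not> \<bar>u t x - f (x - t)\<bar> \<le> N * h"
  define w where "w p = \<bar>u (fst p) (snd p) - f (snd p - fst p)\<bar>" for p
  have cw: "continuous_on UNIV w" unfolding w_def
    by (intro continuous_intros continuous_on_pair_compose[OF u_cont] continuous_on_compose2[OF f_continuous]) auto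
  define S where "S = ({0..6} \<times> {-1..1}) \<inter> {p. N * h \<le> w p}"
  have "closed {p. N * h \<le> w p}" by (intro closed_Collect_le cw continuous_intros)
  then have "compact S" unfolding S_def by (intro compact_Int_closed compact_Times) auto
  moreover have "(t, x) \<in> S" using neg t x by (auto simp: S_def w_def)
  ultimately obtain p where p: "p \<in> S" "\<And>q. q \<in> S \<Longrightarrow> fst p \<le> fst q"
    using continuous_attains_inf[of S fst] continuous_on_fst[OF continuous_on_id] by (metis empty_iff)
  obtain t0 x0 where px: "p = (t0, x0)" by (cases p)
  have t0: "0 \<le> t0" "t0 \<le> 6" "\<bar>x0\<bar> \<le> 1" and big: "N * h \<le> \<bar>u t0 x0 - f (x0 - t0)\<bar>"
    using p(1) by (auto simp: S_def px w_def)
  let ?J = "8 * Bd ^ 4 * h + 8 * Bd * (N * h) ^ 3"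
  have J: "0 \<le> ?J" using Bd h N by simp
  have Gs: "\<bar>G x0 t0 s\<bar> \<le> ?J" if "s \<in> {0..t0}" for s
  proof (cases "s = t0")
    case True
    then show ?thesis using J by (simp add: G_def)
  next
    case False
    then have s: "0 \<le> s" "s < t0" using that by auto
    have "\<bar>u s y - f (y - s)\<bar> \<le> N * h" if "\<bar>y\<bar> \<le> 1" for y
    proof (rule ccontr)
      assume "\<not> \<bar>u s y - f (y - s)\<bar> \<le> N * h"
      then have "(s, y) \<in> S" using s t0 that by (auto simp: S_def w_def)
      then show False using p(2)[of "(s, y)"] s by (simp add: px)
    qed
    then show ?thesis using G_bound[of s t0 "N * h" Bd h x0] s KB fB fz h by auto
  qed
  have "norm (integral {0..t0} (G x0 t0)) \<le> ?J * (t0 - 0)"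
    by (rule integral_bound[OF t0(1) G_cont]) (use Gs in simp)
  also have "\<dots> \<le> ?J * 6" using J t0 by (intro mult_left_mono) auto
  finally have "\<bar>integral {0..t0} (G x0 t0)\<bar> \<le> ?J * 6" by simp
  then have "\<bar>u t0 x0 - f (x0 - t0)\<bar> \<le> 3 * ?J"
    using u_formula[OF t0(1), of x0] by (simp add: abs_mult)
  also have "\<dots> = 24 * Bd ^ 4 * h + 24 * Bd * h * (N ^ 3 * h\<^sup>2)"
    by (simp add: power_mult_distrib algebra_simps power_numeral_reduce)
  also have "\<dots> < 24 * Bd ^ 4 * h + 24 * Bd * h * Bd ^ 3"
    using small Bd h by (intro add_strict_left_mono mult_strict_left_mono) auto
  also have "\<dots> = N * h" by (simp add: N algebra_simps power_numeral_reduce)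
  finally show False using big by simp
qed

text \<open>The error of replacing \<open>u\<close> by the linear wave in \<open>left_profile\<close>.  The bump \<open>f(y - 2 s)\<close> is seen only
  during a time of length \<open>h\<close>, which yields the second factor \<open>h\<close>.\<close>

lemma nonlinear_error:
  assumes KB: "\<And>y. K y \<le> Bd" and fB: "\<And>y. \<bar>f y\<bar> \<le> Bd" and fz: "\<And>y. h < \<bar>y + 2\<bar> \<Longrightarrow> f y = 0"
    and h: "0 < h" "h \<le> 1" and Bd: "0 < Bd" and N: "N = 48 * Bd ^ 4" and small: "N ^ 3 * h\<^sup>2 < Bd ^ 3"
  shows "\<bar>left_profile y - integral {0..6} (\<lambda>s. K (y - s) * f (y - 2 * s) ^ 3)\<bar> \<le> Bd * N * (5 * Bd\<^sup>2 + 18 * N\<^sup>2) * h\<^sup>2"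
proof -
  have N0: "0 < N" using Bd N by simp
  have c1: "continuous_on {0..6} (\<lambda>s. F s (y - s))" by (intro continuous_on_pair_compose[OF F_cont] continuous_intros)
  have c2: "continuous_on {0..6} (\<lambda>s. K (y - s) * f (y - 2 * s) ^ 3)"
    by (intro continuous_intros continuous_on_compose2[OF K_continuous] continuous_on_compose2[OF f_continuous]) auto
  have "left_profile y - integral {0..6} (\<lambda>s. K (y - s) * f (y - 2 * s) ^ 3)
     = integral {0..6} (\<lambda>s. F s (y - s) - K (y - s) * f (y - 2 * s) ^ 3)"
    unfolding left_profile_def by (rule integral_diff[symmetric]) (intro integrable_continuous_interval c1 c2)+
  also have "\<bar>\<dots>\<bar> \<le> Bd * (N * h) * (5 * Bd\<^sup>2) * ((y + 2 + h) / 2 - (y + 2 - h) / 2) + Bd * (N * h) * (3 * (N * h)\<^sup>2) * (6 - 0)"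
  proof (rule integral_bound_indicators)
    fix s :: real assume s: "s \<in> {0..6}"
    let ?i = "indicator {(y + 2 - h) / 2..(y + 2 + h) / 2} s :: real"
    show "\<bar>F s (y - s) - K (y - s) * f (y - 2 * s) ^ 3\<bar> \<le> Bd * (N * h) * (5 * Bd\<^sup>2) * ?i + Bd * (N * h) * (3 * (N * h)\<^sup>2) * indicator {0..6} s"
    proof (cases "1 < \<bar>y - s\<bar>")
      case True
      then show ?thesis using admissibleD(3)[OF K True] Bd N0 h by (simp add: F_def)
    next
      case False
      define w where "w = u s (y - s) - f (y - 2 * s)"
      have w: "\<bar>w\<bar> \<le> N * h" using remainder_bound[OF KB fB fz h(1) Bd N small, of s "y - s"] s False by (simp add: w_def)
      have f2: "(f (y - 2 * s))\<^sup>2 \<le> Bd\<^sup>2 * ?i"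
      proof (cases "s \<in> {(y + 2 - h) / 2..(y + 2 + h) / 2}")
        case True
        then show ?thesis using power_mono[OF fB[of "y - 2 * s"] abs_ge_zero, of 2] by simp
      next
        case False
        then have "f (y - 2 * s) = 0" by (intro fz) (auto simp: field_simps)
        then show ?thesis using False by simp
      qed
      have w2: "w\<^sup>2 \<le> (N * h)\<^sup>2" using power_mono[OF w abs_ge_zero, of 2] by simp
      have "\<bar>F s (y - s) - K (y - s) * f (y - 2 * s) ^ 3\<bar> = K (y - s) * \<bar>(f (y - 2 * s) + w) ^ 3 - f (y - 2 * s) ^ 3\<bar>"
        using admissibleD(2)[OF K, of "y - s"] by (simp add: F_def w_def abs_mult flip: right_diff_distrib)
      also have "\<dots> \<le> Bd * (\<bar>w\<bar> * (5 * (f (y - 2 * s))\<^sup>2 + 3 * w\<^sup>2))"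
        using Bd by (intro mult_mono KB cube_diff_bound) auto
      also have "\<dots> \<le> Bd * ((N * h) * (5 * (Bd\<^sup>2 * ?i) + 3 * (N * h)\<^sup>2))"
        using w f2 w2 Bd N0 h by (intro mult_left_mono mult_mono add_mono) auto
      also have "\<dots> = Bd * (N * h) * (5 * Bd\<^sup>2) * ?i + Bd * (N * h) * (3 * (N * h)\<^sup>2) * indicator {0..6} s"
        using s by (simp add: algebra_simps)
      finally show ?thesis .
    qed
  qed (use c1 c2 Bd N0 h in \<open>auto intro!: continuous_on_diff simp: divide_right_mono\<close>)
  also have "\<dots> = Bd * N * (5 * Bd\<^sup>2 * h\<^sup>2 + 18 * N\<^sup>2 * (h\<^sup>2 * h))"
    by (simp add: field_simps power2_eq_square)
  also have "\<dots> \<le> Bd * N * (5 * Bd\<^sup>2 * h\<^sup>2 + 18 * N\<^sup>2 * (h\<^sup>2 * 1))"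
    using Bd N0 h by (intro mult_left_mono add_left_mono) auto
  finally show ?thesis by (simp add: algebra_simps)
qed

end

section \<open>Recovery of the coefficient\<close>

lemma LINT_rescale:
  fixes g :: "real \<Rightarrow> real" assumes "0 < r"
  shows "(LINT x|lborel. g ((x - c) / r)) = r * (LINT x|lborel. g x)"
  using lborel_integral_real_affine[of r "\<lambda>x. g ((x - c) / r)" c] assms by simp

lemma admissible_bounds:
  assumes "admissible K"
  obtains b where "1 \<le> b" "\<And>x. K x \<le> b" "\<And>x y. \<bar>K x - K y\<bar> \<le> b * \<bar>x - y\<bar>"
proof -
  have t: "test_function K" using admissibleD[OF assms] unfolding test_function_def by blast
  obtain B where B: "0 < B" "\<And>x. \<bar>K x\<bar> \<le> B" "\<And>x. \<bar>deriv K x\<bar> \<le> B" using test_function_props[OF t] by metis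
  have D: "\<bar>deriv K x\<bar> \<le> max B 1" "K x \<le> max B 1" for x using B(2)[of x] B(3)[of x] by auto
  have "\<bar>K x - K y\<bar> \<le> max B 1 * \<bar>x - y\<bar>" for x y
    using field_differentiable_bound[of UNIV K "deriv K" "max B 1" x y] smooth_real_has_deriv[OF admissibleD(1)[OF assms]] D
    by auto
  then show ?thesis using that[of "max B 1"] D by auto
qed

lemma admissible_continuous: "admissible K \<Longrightarrow> continuous_on UNIV K"
  using smooth_real_continuous admissibleD(1) by blast

lemma continuous_AE_eq_0:
  fixes g :: "real \<Rightarrow> real"
  assumes c: "continuous_on UNIV g" and ae: "AE x in lborel. g x = 0"
  shows "g x = 0"
proof (rule ccontr)
  assume x: "g x \<noteq> 0"
  have "open {x. g x \<noteq> 0}" by (intro open_Collect_neq c continuous_intros)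
  then have "\<not> negligible {x. g x \<noteq> 0}" using x by (intro open_not_negligible) auto
  moreover have "{x. g x \<noteq> 0} \<in> null_sets lborel"
    using ae \<open>open {x. g x \<noteq> 0}\<close> AE_iff_null_sets[of "{x. g x \<noteq> 0}" lborel] by auto
  ultimately show False by (simp add: negligible_iff_null_sets null_sets_completionI)
qed

lemma admissible_integral_pos:
  assumes "admissible K"
  shows "integrable lborel K" "0 < (LINT x|lborel. K x)"
proof -
  note c = admissible_continuous[OF assms]
  show i: "integrable lborel K" by (rule continuous_compact_support_integrable[OF c admissibleD(3)[OF assms]])
  show "0 < (LINT x|lborel. K x)"
  proof (rule ccontr)
    assume "\<not> ?thesis"
    moreover have "0 \<le> (LINT x|lborel. K x)" by (simp add: admissibleD(2)[OF assms])
    ultimately have "(LINT x|lborel. K x) = 0" by simp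
    then have "AE x in lborel. K x = 0"
      using integral_nonneg_eq_0_iff_AE[OF i] admissibleD(2)[OF assms] by simp
    then have "K 0 = 0" by (rule continuous_AE_eq_0[OF c])
    then show False using admissibleD(4)[OF assms] by simp
  qed
qed


lemma admissible_deriv_energy_pos:
  assumes "admissible K"
  shows "0 < (LINT x|lborel. (deriv K x)\<^sup>2)"
proof (rule ccontr)
  note s = admissibleD(1)[OF assms]
  have c: "continuous_on UNIV (deriv K)" using smooth_real_continuous smooth_real_deriv s by blast
  have "deriv K x = 0" if "1 < \<bar>x\<bar>" for x using deriv_eq_0_off_support[OF _ that] admissibleD(3)[OF assms] by blast
  then have i: "integrable lborel (\<lambda>x. (deriv K x)\<^sup>2)"
    using continuous_compact_support_L2[OF c, of 1] by (simp add: L2w_def)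
  assume "\<not> ?thesis"
  moreover have "0 \<le> (LINT x|lborel. (deriv K x)\<^sup>2)" by simp
  ultimately have "(LINT x|lborel. (deriv K x)\<^sup>2) = 0" by linarith
  then have "AE x in lborel. (deriv K x)\<^sup>2 = 0" using integral_nonneg_eq_0_iff_AE[OF i] by simp
  then have "AE x in lborel. deriv K x = 0" by simp
  then have "deriv K x = 0" for x using continuous_AE_eq_0[OF c] by blast
  then have "K 0 = K 2"
    using DERIV_isconst_all[of K 0 2] smooth_real_has_deriv[OF s] by metis
  then show False using admissibleD(3,4)[OF assms] by simp
qed

lemma C1_compact_support_X_space:
  assumes D: "\<And>x. (f has_real_derivative f' x) (at x)" and c: "continuous_on UNIV f'"
    and z: "\<And>x. R < \<bar>x\<bar> \<Longrightarrow> f x = 0"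
  shows "(f, \<lambda>x. - f' x) \<in> X_space" "R < \<bar>x\<bar> \<Longrightarrow> f' x = 0"
proof -
  have cf: "continuous_on UNIV f" by (rule DERIV_continuous_on[OF has_field_derivative_at_within[OF D]])
  have z': "f' x = 0" if "R < \<bar>x\<bar>" for x
    using deriv_eq_0_off_support[OF z that] DERIV_imp_deriv[OF D, of x] by simp
  then show "R < \<bar>x\<bar> \<Longrightarrow> f' x = 0" .
  have L: "f \<in> L2" "f' \<in> L2" "(\<lambda>x. - f' x) \<in> L2"
    using continuous_compact_support_L2[OF cf z] continuous_compact_support_L2[OF c z']
      continuous_compact_support_L2[OF continuous_on_minus[OF c], of R] z' by auto
  have "f \<in> H1" using L cf is_weak_deriv_C1[OF D c] unfolding H1_def by blast
  moreover have "ess_compact_support f" "ess_compact_support (\<lambda>x. - f' x)"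
    unfolding ess_compact_support_def using z z' by (auto intro!: exI[of _ R] AE_I2)
  ultimately show "(f, \<lambda>x. - f' x) \<in> X_space" using L by (simp add: X_space_def)
qed

lemma energy_norm_C1:
  assumes tr: "transition \<Psi>" and D: "\<And>x. (f has_real_derivative f' x) (at x)" and c: "continuous_on UNIV f'"
  shows "energy_norm (f, \<lambda>x. - f' x) = sqrt (2 * (LINT x|lborel. (f' x)\<^sup>2))"
proof -
  have wd: "is_weak_deriv f f'" by (rule is_weak_deriv_C1[OF D c])
  have "wderiv f \<in> borel_measurable lborel"
    using wderiv_is_weak_deriv[OF wd] by (simp add: is_weak_deriv_def locally_integrable_def)
  then have "L2_norm (wderiv f) = L2_norm f'"
    by (intro L2w_cong_AE(2) wderiv_AE_eq[OF tr wd] continuous_imp_borel_lborel[OF c]) auto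
  then show ?thesis by (simp add: energy_norm_def L2w_norm_sq) (simp add: L2w_norm_def)
qed

text \<open>All that is needed of one solution: the left-moving component of the scattering state, up to sign, is
  represented on the window by a continuous function \<open>P\<close> close to the average of \<open>K\<close> given by the linear wave.\<close>

lemma scattering_datum:
  assumes "admissible K" "transition \<Psi>" "is_scattering_map K \<Phi>"
    and D: "\<And>x. (f has_real_derivative f' x) (at x)" "continuous_on UNIV f'" "\<And>x. 3 < \<bar>x\<bar> \<Longrightarrow> f x = 0"
    and est: "\<And>y. K y \<le> Bd" "\<And>y. \<bar>f y\<bar> \<le> Bd" "\<And>y. h < \<bar>y + 2\<bar> \<Longrightarrow> f y = 0"
      "0 < h" "h \<le> 1" "0 < Bd" "N = 48 * Bd ^ 4" "N ^ 3 * h\<^sup>2 < Bd ^ 3"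
  obtains P where "continuous_on UNIV P" "\<Phi> (f, \<lambda>x. - f' x) \<in> Y_space"
    "\<And>\<phi>. test_function \<phi> \<Longrightarrow> (\<And>x. \<phi> x \<noteq> 0 \<Longrightarrow> -1 \<le> x \<and> x \<le> 5) \<Longrightarrow>
      pairing \<phi> (\<Phi> (f, \<lambda>x. - f' x)) = - (LINT x|lborel. P x * \<phi> x)"
    "\<And>y. \<bar>P y - integral {0..6} (\<lambda>s. K (y - s) * f (y - 2 * s) ^ 3)\<bar> \<le> Bd * N * (5 * Bd\<^sup>2 + 18 * N\<^sup>2) * h\<^sup>2"
proof -
  note X = C1_compact_support_X_space[OF D]
  obtain u where u: "is_global_solution K (f, \<lambda>x. - f' x) u" "\<Phi> (f, \<lambda>x. - f' x) \<in> Y_space"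
    "((\<lambda>t. Y_norm (lin_group (- t) (u t, dt u t) - \<Phi> (f, \<lambda>x. - f' x))) \<longlongrightarrow> 0) at_top"
    using assms(3) X(1) unfolding is_scattering_map_def by blast
  interpret wave K f f' \<Psi> u 3
    by unfold_locales (use assms(1,2) D X(2) u(1) in auto)
  show ?thesis
    by (rule that[OF left_profile_cont u(2) scattering_pairing[OF u(2,3)] nonlinear_error[OF est]])
qed

lemma continuous_on_integrand:
  assumes "continuous_on UNIV K" "continuous_on UNIV (f :: real \<Rightarrow> real)"
  shows "continuous_on S (\<lambda>s. K (y - s) * f (y - 2 * s) ^ 3 :: real)"
  by (intro continuous_intros continuous_on_compose2[OF assms(1)] continuous_on_compose2[OF assms(2)]) auto

text \<open>The hypothesis on \<open>\<delta>\<close> says that \<open>\<delta>\<close> bounds the scattering distance.  It is used for one datum, which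
  depends on \<open>x\<close> and on the size of \<open>K\<^sub>2 x - K\<^sub>1 x\<close>.\<close>

lemma coefficient_difference_cubed:
  assumes a1: "admissible K\<^sub>1" and a2: "admissible K\<^sub>2"
    and s1: "is_scattering_map K\<^sub>1 \<Phi>\<^sub>1" and s2: "is_scattering_map K\<^sub>2 \<Phi>\<^sub>2"
  shows "\<exists>C>0. \<forall>x \<delta>. 0 \<le> \<delta> \<longrightarrow> (\<forall>d \<in> X_space - X_zero. 0 < energy_norm d \<longrightarrow> Y_norm (\<Phi>\<^sub>2 d - \<Phi>\<^sub>1 d) \<le> \<delta> * energy_norm d)
    \<longrightarrow> \<bar>K\<^sub>2 x - K\<^sub>1 x\<bar> ^ 3 \<le> C * \<delta>"
proof -
  obtain \<Psi> where tr: "transition \<Psi>" using transition_exists[OF a1] by blast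
  obtain b1 where b1: "1 \<le> b1" "\<And>x. K\<^sub>1 x \<le> b1" "\<And>x y. \<bar>K\<^sub>1 x - K\<^sub>1 y\<bar> \<le> b1 * \<bar>x - y\<bar>"
    using admissible_bounds[OF a1] by metis
  obtain b2 where b2: "1 \<le> b2" "\<And>x. K\<^sub>2 x \<le> b2" "\<And>x y. \<bar>K\<^sub>2 x - K\<^sub>2 y\<bar> \<le> b2 * \<bar>x - y\<bar>"
    using admissible_bounds[OF a2] by metis
  define Bd where "Bd = max b1 b2"
  have Bd: "1 \<le> Bd" "0 < Bd" using b1(1) by (auto simp: Bd_def)
  have KB: "K\<^sub>1 x \<le> Bd" "K\<^sub>2 x \<le> Bd" for x using b1(2)[of x] b2(2)[of x] by (auto simp: Bd_def)
  have Lip: "\<bar>K\<^sub>1 x - K\<^sub>1 y\<bar> \<le> Bd * \<bar>x - y\<bar>" "\<bar>K\<^sub>2 x - K\<^sub>2 y\<bar> \<le> Bd * \<bar>x - y\<bar>" for x y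
    using b1(3)[of x y] b2(3)[of x y] mult_right_mono[of b1 Bd "\<bar>x - y\<bar>"] mult_right_mono[of b2 Bd "\<bar>x - y\<bar>"]
    by (auto simp: Bd_def)
  note nn = admissibleD(2)[OF a1] admissibleD(2)[OF a2]
  note c1 = admissible_continuous[OF a1] and c2 = admissible_continuous[OF a2]
  define N where "N = 48 * Bd ^ 4"
  have N: "1 \<le> N" using one_le_power[OF Bd(1), of 4] by (simp add: N_def)
  define Ce where "Ce = Bd * N * (5 * Bd\<^sup>2 + 18 * N\<^sup>2)"
  have Ce: "0 < Ce" using Bd N by (simp add: Ce_def add_pos_pos)
  define k0 where "k0 = K\<^sub>1 0"
  have k0: "0 < k0" using admissibleD(4)[OF a1] by (simp add: k0_def)
  define \<eta> where "\<eta> = min 1 (k0 / (2 * Bd))"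
  have \<eta>: "0 < \<eta>" "\<eta> \<le> 1" "Bd * \<eta> \<le> k0 / 2" using k0 Bd by (auto simp: \<eta>_def min_def field_simps)
  have klow: "k0 / 2 \<le> K\<^sub>1 z" if "\<bar>z\<bar> \<le> \<eta>" for z
  proof -
    have "Bd * \<bar>z - 0\<bar> \<le> Bd * \<eta>" using that Bd by (intro mult_left_mono) auto
    then show ?thesis using Lip(1)[of z 0] \<eta>(3) unfolding k0_def by linarith
  qed
  \<comment> \<open>a lower bound, up to the factor \<open>h\<close>, for half the integral of \<open>f(y - 2 s)\<^sup>3\<close>\<close>
  define c where "c = (1/2) * (k0 / 2) ^ 3 * \<eta>"
  have c: "0 < c" using k0 \<eta> by (simp add: c_def)
  \<comment> \<open>in turn: for the hypotheses of \<open>scattering_datum\<close>, for the variation of \<open>K\<^sub>2 - K\<^sub>1\<close> over a distance \<open>h\<close>, and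
    for the nonlinear errors to take at most half of the main term\<close>
  define c' where "c' = min (1 / (2 * Bd * N\<^sup>2)) (min (1 / (4 * Bd)) (c / (4 * Ce)))"
  have c': "0 < c'" "c' \<le> 1 / (2 * Bd * N\<^sup>2)" "c' \<le> 1 / (4 * Bd)" "c' \<le> c / (4 * Ce)"
    using Bd N Ce c by (auto simp: c'_def)
  define W where "W = (LINT x|lborel. K\<^sub>1 x)"
  have W: "0 < W" unfolding W_def by (rule admissible_integral_pos(2)[OF a1])
  define Q where "Q = (LINT x|lborel. (K\<^sub>1 x)\<^sup>2)"
  define E where "E = (LINT x|lborel. (deriv K\<^sub>1 x)\<^sup>2)"
  have QE: "0 \<le> Q" "0 \<le> E" by (auto simp: Q_def E_def)
  \<comment> \<open>the summand 1 only serves to make the constant positive\<close>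
  define C1 where "C1 = 2 * sqrt (6 * Q) * sqrt (2 * E) + 1"
  have C1: "0 < C1" using QE by (simp add: C1_def add_nonneg_pos)
  define C where "C = 2 * C1 / (c'\<^sup>2 * c * W)"
  have C: "0 < C" using C1 c' c W by (simp add: C_def)
  have "\<bar>K\<^sub>2 x - K\<^sub>1 x\<bar> ^ 3 \<le> C * \<delta>"
    if \<delta>: "0 \<le> \<delta>" and hyp: "\<forall>d \<in> X_space - X_zero. 0 < energy_norm d \<longrightarrow> Y_norm (\<Phi>\<^sub>2 d - \<Phi>\<^sub>1 d) \<le> \<delta> * energy_norm d" for x \<delta>
  proof (cases "K\<^sub>2 x = K\<^sub>1 x")
    case True
    then show ?thesis using C \<delta> by simp
  next
    case False
    define m where "m = \<bar>K\<^sub>2 x - K\<^sub>1 x\<bar>"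
    have m: "0 < m" "m \<le> Bd" using False KB[of x] nn[of x] by (auto simp: m_def)
    have x1: "\<bar>x\<bar> \<le> 1"
    proof (rule ccontr)
      assume "\<not> \<bar>x\<bar> \<le> 1"
      then show False using False admissibleD(3)[OF a1, of x] admissibleD(3)[OF a2, of x] by simp
    qed
    define h where "h = c' * m"
    have h0: "0 < h" using c' m by (simp add: h_def)
    have hN: "h \<le> 1 / (2 * N\<^sup>2)"
    proof -
      have "c' * m \<le> 1 / (2 * Bd * N\<^sup>2) * Bd" using c' m Bd by (intro mult_mono) auto
      then show ?thesis using Bd by (simp add: h_def)
    qed
    have h1: "h \<le> 1 / 2"
    proof -
      have "1 / (2 * N\<^sup>2) \<le> 1 / 2" using one_le_power[OF N, of 2] by (intro frac_le) auto
      then show ?thesis using hN by linarith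
    qed
    have hL: "2 * Bd * h \<le> m / 2"
    proof -
      have "c' * m \<le> 1 / (4 * Bd) * m" using c' m by (intro mult_right_mono) auto
      then show ?thesis using Bd by (simp add: h_def field_simps)
    qed
    have hc: "4 * Ce * h \<le> c * m"
    proof -
      have "c' * m \<le> c / (4 * Ce) * m" using c' m by (intro mult_right_mono) auto
      then show ?thesis using Ce by (simp add: h_def field_simps)
    qed
    have small: "N ^ 3 * h\<^sup>2 < Bd ^ 3"
    proof -
      have "h\<^sup>2 \<le> (1 / (2 * N\<^sup>2))\<^sup>2" using hN h0 by (intro power_mono) auto
      then have "N ^ 3 * h\<^sup>2 \<le> N ^ 3 * (1 / (2 * N\<^sup>2))\<^sup>2" using N by (intro mult_left_mono) auto
      also have "\<dots> = 1 / (4 * N)" using N by (simp add: field_simps power2_eq_square power3_eq_cube)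
      also have "\<dots> < 1" using N by simp
      also have "\<dots> \<le> Bd ^ 3" using Bd by simp
      finally show ?thesis .
    qed
    define f where "f z = K\<^sub>1 ((z + 2) / h)" for z
    define f' where "f' z = deriv K\<^sub>1 ((z + 2) / h) / h" for z
    note sm = admissibleD(1)[OF a1]
    have Df: "(f has_real_derivative f' z) (at z)" for z
      using smooth_real_rescale_has_deriv[OF sm, of 1 "-2" h z] by (simp add: f_def[abs_def] f'_def)
    have cdK: "continuous_on UNIV (deriv K\<^sub>1)" using smooth_real_continuous smooth_real_deriv sm by blast
    have cf': "continuous_on UNIV f'" unfolding f'_def[abs_def]
      by (intro continuous_intros continuous_on_compose2[OF cdK]) (use h0 in auto)
    have cf: "continuous_on UNIV f" by (rule DERIV_continuous_on[OF has_field_derivative_at_within[OF Df]])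
    have fz: "f z = 0" if "h < \<bar>z + 2\<bar>" for z
      unfolding f_def by (rule admissibleD(3)[OF a1]) (use that h0 in \<open>simp add: abs_divide\<close>)
    have f3: "f z = 0" if "3 < \<bar>z\<bar>" for z by (rule fz) (use that h1 in auto)
    have fB: "\<bar>f z\<bar> \<le> Bd" for z using KB nn by (simp add: f_def)
    have f0: "0 \<le> f z" for z using nn by (simp add: f_def)
    define d where "d = (f, \<lambda>z. - f' z)"
    have dX: "d \<in> X_space" unfolding d_def by (rule C1_compact_support_X_space(1)[OF Df cf' f3])
    have dZ: "d \<notin> X_zero"
    proof
      assume "d \<in> X_zero"
      then have "AE z in lborel. f z = 0" by (auto simp: X_zero_def d_def)
      then have "f (-2) = 0" by (rule continuous_AE_eq_0[OF cf])
      then show False using k0 by (simp add: f_def k0_def)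
    qed
    have "(LINT z|lborel. (f' z)\<^sup>2) = (LINT z|lborel. (deriv K\<^sub>1 ((z - (-2)) / h))\<^sup>2 / h\<^sup>2)"
      by (simp add: f'_def power_divide)
    also have "\<dots> = h * (LINT z|lborel. (deriv K\<^sub>1 z)\<^sup>2 / h\<^sup>2)" by (rule LINT_rescale[OF h0])
    also have "\<dots> = E / h" using h0 by (simp add: E_def power2_eq_square)
    finally have en: "energy_norm d = sqrt (2 * (E / h))"
      unfolding d_def energy_norm_C1[OF tr Df cf'] by simp
    have "0 < E" unfolding E_def by (rule admissible_deriv_energy_pos[OF a1])
    then have en0: "0 < energy_norm d" unfolding en using h0 by simp
    obtain P1 where P1: "continuous_on UNIV P1" "\<Phi>\<^sub>1 d \<in> Y_space"
      "\<And>\<phi>. test_function \<phi> \<Longrightarrow> (\<And>x. \<phi> x \<noteq> 0 \<Longrightarrow> -1 \<le> x \<and> x \<le> 5) \<Longrightarrow> pairing \<phi> (\<Phi>\<^sub>1 d) = - (LINT x|lborel. P1 x * \<phi> x)"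
      "\<And>y. \<bar>P1 y - integral {0..6} (\<lambda>s. K\<^sub>1 (y - s) * f (y - 2 * s) ^ 3)\<bar> \<le> Ce * h\<^sup>2"
      unfolding Ce_def d_def
      by (rule scattering_datum[OF a1 tr s1 Df cf' f3 KB(1) fB fz h0 _ Bd(2) N_def small]) (use h1 in auto)
    obtain P2 where P2: "continuous_on UNIV P2" "\<Phi>\<^sub>2 d \<in> Y_space"
      "\<And>\<phi>. test_function \<phi> \<Longrightarrow> (\<And>x. \<phi> x \<noteq> 0 \<Longrightarrow> -1 \<le> x \<and> x \<le> 5) \<Longrightarrow> pairing \<phi> (\<Phi>\<^sub>2 d) = - (LINT x|lborel. P2 x * \<phi> x)"
      "\<And>y. \<bar>P2 y - integral {0..6} (\<lambda>s. K\<^sub>2 (y - s) * f (y - 2 * s) ^ 3)\<bar> \<le> Ce * h\<^sup>2"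
      unfolding Ce_def d_def
      by (rule scattering_datum[OF a2 tr s2 Df cf' f3 KB(2) fB fz h0 _ Bd(2) N_def small]) (use h1 in auto)
    define \<sigma> where "\<sigma> = sgn (K\<^sub>2 x - K\<^sub>1 x)"
    have \<sigma>: "\<bar>\<sigma>\<bar> = 1" "\<sigma> * (K\<^sub>2 x - K\<^sub>1 x) = m" using False by (auto simp: \<sigma>_def m_def sgn_if)
    \<comment> \<open>the position, pulled back to time 0, of the wave that starts at \<open>-2\<close> and is reflected at \<open>x\<close>\<close>
    define ys where "ys = 2 * x + 2"
    have low: "c * m * h / 2 \<le> \<sigma> * (P2 y - P1 y)" if y: "\<bar>y - ys\<bar> \<le> h" for y
    proof -
      have yb: "- (1/2) \<le> y" "y \<le> 9/2" using y x1 h1 by (auto simp: ys_def abs_le_iff)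
      define g where "g s = \<sigma> * (K\<^sub>2 (y - s) - K\<^sub>1 (y - s)) * f (y - 2 * s) ^ 3" for s
      have gc: "continuous_on S g" for S unfolding g_def
        by (intro continuous_intros continuous_on_compose2[OF c1] continuous_on_compose2[OF c2] continuous_on_compose2[OF cf]) auto
      \<comment> \<open>the characteristic through \<open>y\<close> meets the bump only within \<open>h\<close> of \<open>x\<close>\<close>
      have near: "m / 2 \<le> \<sigma> * (K\<^sub>2 (y - s) - K\<^sub>1 (y - s))" if "\<bar>(y - 2 * s) + 2\<bar> \<le> h" for s
      proof -
        have xx: "\<bar>y - s - x\<bar> \<le> h" using that y unfolding ys_def abs_le_iff by linarith
        have "\<bar>(K\<^sub>2 (y - s) - K\<^sub>1 (y - s)) - (K\<^sub>2 x - K\<^sub>1 x)\<bar> \<le> 2 * (Bd * \<bar>y - s - x\<bar>)"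
          using Lip[of "y - s" x] by linarith
        also have "\<dots> \<le> 2 * (Bd * h)" using xx Bd by (intro mult_left_mono) auto
        also have "\<dots> \<le> m / 2" using hL by simp
        finally have "\<bar>\<sigma> * ((K\<^sub>2 (y - s) - K\<^sub>1 (y - s)) - (K\<^sub>2 x - K\<^sub>1 x))\<bar> \<le> m / 2" using \<sigma>(1) by (simp add: abs_mult)
        then show ?thesis using \<sigma>(2) unfolding right_diff_distrib by linarith
      qed
      have g0: "0 \<le> g s" for s
      proof (cases "h < \<bar>(y - 2 * s) + 2\<bar>")
        case True
        then show ?thesis using fz by (simp add: g_def)
      next
        case False
        then have "0 \<le> \<sigma> * (K\<^sub>2 (y - s) - K\<^sub>1 (y - s))" using near[of s] m by simp
        then show ?thesis unfolding g_def by (rule mult_nonneg_nonneg[OF _ zero_le_power[OF f0]])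
      qed
      \<comment> \<open>the times at which \<open>f(y - 2 s)\<close> is at least half its maximum\<close>
      define p where "p = (y + 2 - \<eta> * h) / 2"
      define q where "q = (y + 2 + \<eta> * h) / 2"
      have \<eta>h: "0 < \<eta> * h" "\<eta> * h \<le> h" using \<eta> h0 by auto
      have pq: "0 \<le> p" "p \<le> q" "q \<le> 6" "q - p = \<eta> * h" using yb \<eta>h h1 by (auto simp: p_def q_def field_simps)
      have "m / 2 * (k0 / 2) ^ 3 * (q - p) = integral {p..q} (\<lambda>s. m / 2 * (k0 / 2) ^ 3)" using pq by simp
      also have "\<dots> \<le> integral {p..q} g"
      proof (rule integral_le)
        fix s assume "s \<in> {p..q}"
        then have "\<bar>(y - 2 * s) + 2\<bar> \<le> \<eta> * h" by (auto simp: p_def q_def abs_le_iff field_simps)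
        moreover from this have "\<bar>((y - 2 * s) + 2) / h\<bar> \<le> \<eta>" using h0 by (simp add: abs_divide divide_le_eq)
        ultimately have "k0 / 2 \<le> f (y - 2 * s)" "m / 2 \<le> \<sigma> * (K\<^sub>2 (y - s) - K\<^sub>1 (y - s))"
          using klow near[of s] \<eta>h by (auto simp: f_def)
        then show "m / 2 * (k0 / 2) ^ 3 \<le> g s"
          unfolding g_def using m k0 by (intro mult_mono power_mono) auto
      qed (auto intro: integrable_continuous_interval gc)
      also have "\<dots> \<le> integral {0..6} g"
        by (rule integral_subset_le) (use pq g0 in \<open>auto intro: integrable_continuous_interval gc\<close>)
      finally have "c * m * h \<le> integral {0..6} g" unfolding pq(4) c_def by (simp add: mult_ac)
      moreover have "integral {0..6} g = \<sigma> * (integral {0..6} (\<lambda>s. K\<^sub>2 (y - s) * f (y - 2 * s) ^ 3) - integral {0..6} (\<lambda>s. K\<^sub>1 (y - s) * f (y - 2 * s) ^ 3))"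
      proof -
        have "integral {0..6} (\<lambda>s. K\<^sub>2 (y - s) * f (y - 2 * s) ^ 3) - integral {0..6} (\<lambda>s. K\<^sub>1 (y - s) * f (y - 2 * s) ^ 3)
          = integral {0..6} (\<lambda>s. K\<^sub>2 (y - s) * f (y - 2 * s) ^ 3 - K\<^sub>1 (y - s) * f (y - 2 * s) ^ 3)"
          by (rule integral_diff[symmetric]) (intro integrable_continuous_interval continuous_on_integrand c1 c2 cf)+
        then show ?thesis by (simp add: g_def[abs_def] algebra_simps flip: integral_mult_right)
      qed
      ultimately have main: "c * m * h \<le> \<sigma> * (integral {0..6} (\<lambda>s. K\<^sub>2 (y - s) * f (y - 2 * s) ^ 3) - integral {0..6} (\<lambda>s. K\<^sub>1 (y - s) * f (y - 2 * s) ^ 3))"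
        by simp
      let ?I1 = "integral {0..6} (\<lambda>s. K\<^sub>1 (y - s) * f (y - 2 * s) ^ 3)" and ?I2 = "integral {0..6} (\<lambda>s. K\<^sub>2 (y - s) * f (y - 2 * s) ^ 3)"
      have "\<bar>\<sigma> * ((P2 y - P1 y) - (?I2 - ?I1))\<bar> \<le> 2 * (Ce * h\<^sup>2)"
        using P1(4)[of y] P2(4)[of y] unfolding abs_mult \<sigma>(1) mult_1 abs_le_iff by linarith
      moreover have "2 * (Ce * h\<^sup>2) \<le> c * m * h / 2"
        using mult_right_mono[OF hc, of h] h0 by (simp add: power2_eq_square mult_ac)
      ultimately show ?thesis using main unfolding right_diff_distrib by linarith
    qed
    define \<phi> where "\<phi> y = K\<^sub>1 ((y - ys) / h)" for y
    have \<phi>0: "\<phi> y = 0" if "h < \<bar>y - ys\<bar>" for y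
      unfolding \<phi>_def by (rule admissibleD(3)[OF a1]) (use that h0 in \<open>simp add: abs_divide\<close>)
    have t: "test_function \<phi>"
    proof -
      have "smooth_real \<phi>" unfolding \<phi>_def[abs_def] by (rule smooth_real_rescale[OF sm])
      moreover have "\<phi> y = 0" if "\<bar>ys\<bar> + h < \<bar>y\<bar>" for y by (rule \<phi>0) (use that in auto)
      ultimately show ?thesis unfolding test_function_def by blast
    qed
    have supp: "-1 \<le> y \<and> y \<le> 5" if "\<phi> y \<noteq> 0" for y
    proof -
      have "\<bar>y - ys\<bar> \<le> h" using \<phi>0 that by force
      then show ?thesis using x1 h1 by (auto simp: ys_def abs_le_iff)
    qed
    have supp5: "\<bar>y\<bar> \<le> 5" if "\<phi> y \<noteq> 0" for y using supp[OF that] by auto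
    have i1: "integrable lborel (\<lambda>y. P1 y * \<phi> y)" and i2: "integrable lborel (\<lambda>y. P2 y * \<phi> y)"
      using locally_integrable_test(1)[OF locally_integrable_continuous t] P1(1) P2(1) by auto
    have i\<phi>: "integrable lborel \<phi>"
      using locally_integrable_test(1)[OF locally_integrable_continuous[OF continuous_on_const[of _ 1]] t] by simp
    have pd: "pairing \<phi> (\<Phi>\<^sub>2 d - \<Phi>\<^sub>1 d) = - (LINT y|lborel. (P2 y - P1 y) * \<phi> y)"
    proof -
      have "pairing \<phi> (\<Phi>\<^sub>2 d - \<Phi>\<^sub>1 d) = pairing \<phi> (\<Phi>\<^sub>2 d) - pairing \<phi> (\<Phi>\<^sub>1 d)"
        by (rule pairing_diff[OF P2(2) P1(2) t supp5])
      moreover have "pairing \<phi> (\<Phi>\<^sub>1 d) = - (LINT y|lborel. P1 y * \<phi> y)" by (rule P1(3)[OF t supp])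
      moreover have "pairing \<phi> (\<Phi>\<^sub>2 d) = - (LINT y|lborel. P2 y * \<phi> y)" by (rule P2(3)[OF t supp])
      ultimately show ?thesis using i1 i2 by (simp add: left_diff_distrib)
    qed
    have "(c * m * h / 2) * (h * W) = (LINT y|lborel. c * m * h / 2 * \<phi> y)"
      using LINT_rescale[OF h0, of K\<^sub>1 ys] by (simp add: \<phi>_def W_def)
    also have "\<dots> \<le> (LINT y|lborel. \<sigma> * ((P2 y - P1 y) * \<phi> y))"
    proof (rule integral_mono)
      show "integrable lborel (\<lambda>y. c * m * h / 2 * \<phi> y)" using i\<phi> by (rule integrable_mult_right)
      show "integrable lborel (\<lambda>y. \<sigma> * ((P2 y - P1 y) * \<phi> y))" using i1 i2 by (simp add: left_diff_distrib)
      fix y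
      show "c * m * h / 2 * \<phi> y \<le> \<sigma> * ((P2 y - P1 y) * \<phi> y)"
      proof (cases "h < \<bar>y - ys\<bar>")
        case False
        have "0 \<le> \<phi> y" using nn by (simp add: \<phi>_def)
        then show ?thesis using mult_right_mono[OF low[of y], of "\<phi> y"] False by (simp add: mult.assoc)
      qed (simp add: \<phi>0)
    qed
    also have "\<dots> = \<sigma> * (LINT y|lborel. (P2 y - P1 y) * \<phi> y)" by simp
    also have "\<dots> \<le> \<bar>pairing \<phi> (\<Phi>\<^sub>2 d - \<Phi>\<^sub>1 d)\<bar>"
      unfolding pd using \<sigma>(1) by (metis abs_ge_self abs_minus_cancel abs_mult mult_1)
    also have "\<dots> \<le> 2 * sqrt (6 * (LINT y|lborel. (\<phi> y)\<^sup>2)) * Y_norm (\<Phi>\<^sub>2 d - \<Phi>\<^sub>1 d)"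
      by (rule pairing_bound[OF tr Y_space_diff[OF P2(2) P1(2)] t supp5])
    also have "\<dots> \<le> 2 * sqrt (6 * (LINT y|lborel. (\<phi> y)\<^sup>2)) * (\<delta> * energy_norm d)"
      using hyp dX dZ en0 by (intro mult_left_mono) auto
    also have "(LINT y|lborel. (\<phi> y)\<^sup>2) = h * Q"
      using LINT_rescale[OF h0, of "\<lambda>y. (K\<^sub>1 y)\<^sup>2" ys] by (simp add: \<phi>_def Q_def)
    also have "2 * sqrt (6 * (h * Q)) * (\<delta> * energy_norm d) = 2 * sqrt (6 * Q) * sqrt (2 * E) * \<delta>"
      unfolding en using h0 by (simp add: real_sqrt_mult real_sqrt_divide)
    also have "\<dots> \<le> C1 * \<delta>" using \<delta> by (intro mult_right_mono) (simp_all add: C1_def)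
    finally have "c * m * h / 2 * (h * W) \<le> C1 * \<delta>" .
    then have "c * c'\<^sup>2 * W / 2 * m ^ 3 \<le> C1 * \<delta>"
      by (simp add: h_def power2_eq_square power3_eq_cube mult_ac)
    then have "m ^ 3 \<le> C * \<delta>" using c c' W by (simp add: C_def field_simps)
    then show ?thesis by (simp add: m_def)
  qed
  then show ?thesis using C by blast
qed


lemma Y_norm_eq_0:
  assumes tr: "transition \<Psi>" and "d \<in> Y_space" "d' \<in> Y_space" and eq: "Y_eq d d'"
  shows "Y_norm (d' - d) = 0"
proof -
  obtain h where h: "continuous_on UNIV (fst (d' - d))" "is_weak_deriv (fst (d' - d)) h" "snd (d' - d) \<in> L2w jap_inv"
    using Y_spaceE[OF Y_space_diff[OF assms(3,2)]] by metis
  obtain c where c: "AE x in lborel. fst d x - fst d' x = c" and g: "AE x in lborel. snd d x = snd d' x"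
    using eq by (auto simp: Y_eq_def split: prod.splits)
  have "fst (d' - d) x - (- c) = 0" for x
  proof (rule continuous_AE_eq_0[where g = "\<lambda>x. fst (d' - d) x - (- c)"])
    show "continuous_on UNIV (\<lambda>x. fst (d' - d) x - (- c))" using h(1) by (intro continuous_intros)
    show "AE x in lborel. fst (d' - d) x - (- c) = 0" using c by auto
  qed
  then have fc: "fst (d' - d) = (\<lambda>_. - c)" by (metis eq_iff_diff_eq_0)
  have wd: "is_weak_deriv (fst (d' - d)) (\<lambda>_. 0)" unfolding fc by (rule is_weak_deriv_C1) auto
  have "wderiv (fst (d' - d)) \<in> borel_measurable lborel"
    using wderiv_is_weak_deriv[OF wd] by (simp add: is_weak_deriv_def locally_integrable_def)
  then have "L2w_norm jap_inv (wderiv (fst (d' - d))) = L2w_norm jap_inv (\<lambda>_. 0)"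
    by (intro L2w_cong_AE(2) wderiv_AE_eq[OF tr wd]) auto
  moreover have "L2w_norm jap_inv (snd (d' - d)) = L2w_norm jap_inv (\<lambda>_. 0)"
    using h(3) g by (intro L2w_cong_AE(2)) (auto simp: L2w_def)
  moreover have "Y_norm (d' - d) = sqrt ((L2w_norm jap_inv (wderiv (fst (d' - d))))\<^sup>2 + (L2w_norm jap_inv (snd (d' - d)))\<^sup>2)"
    by (simp add: Y_norm_def split_beta)
  ultimately show ?thesis by (simp add: L2w_norm_def)
qed

lemma le_powr_eighth:
  fixes m z :: real
  assumes "0 \<le> m" "m ^ 8 \<le> z"
  shows "m \<le> z powr (1/8)"
proof (cases "m = 0")
  case False
  then have m: "0 < m" using assms(1) by simp
  have "m = (m ^ 8) powr (1/8)" using m by (simp add: powr_powr flip: powr_numeral)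
  also have "\<dots> \<le> z powr (1/8)" using m assms(2) by (intro powr_mono2) auto
  finally show ?thesis .
qed simp

theorem theorem1p2:
  fixes K\<^sub>1 K\<^sub>2 :: "real \<Rightarrow> real" and \<Phi>\<^sub>1 \<Phi>\<^sub>2 :: "data \<Rightarrow> data"
  assumes "admissible K\<^sub>1" and "admissible K\<^sub>2"
    and "is_scattering_map K\<^sub>1 \<Phi>\<^sub>1" and "is_scattering_map K\<^sub>2 \<Phi>\<^sub>2"
  shows "(\<exists>C::real. C > 0 \<and>
            Linfty_norm (\<lambda>x. K\<^sub>2 x - K\<^sub>1 x)
              \<le> ennreal C * ennreal_powr (scattering_distance \<Phi>\<^sub>1 \<Phi>\<^sub>2) (1/8))
         \<and> ((\<forall>d \<in> X_space. Y_eq (\<Phi>\<^sub>1 d) (\<Phi>\<^sub>2 d)) \<longrightarrow> K\<^sub>1 = K\<^sub>2)"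
proof -
  obtain C where C: "0 < C" and cube: "\<And>x \<delta>. 0 \<le> \<delta> \<Longrightarrow>
      (\<forall>d \<in> X_space - X_zero. 0 < energy_norm d \<longrightarrow> Y_norm (\<Phi>\<^sub>2 d - \<Phi>\<^sub>1 d) \<le> \<delta> * energy_norm d) \<Longrightarrow>
      \<bar>K\<^sub>2 x - K\<^sub>1 x\<bar> ^ 3 \<le> C * \<delta>"
    using coefficient_difference_cubed[OF assms] by blast
  obtain b1 where b1: "1 \<le> b1" "\<And>x. K\<^sub>1 x \<le> b1" using admissible_bounds[OF assms(1)] by metis
  obtain b2 where b2: "1 \<le> b2" "\<And>x. K\<^sub>2 x \<le> b2" using admissible_bounds[OF assms(2)] by metis
  define b where "b = max b1 b2"
  have b: "0 < b" using b1 by (simp add: b_def)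
  have mb: "\<bar>K\<^sub>2 x - K\<^sub>1 x\<bar> \<le> b" for x
    using b1(2)[of x] b2(2)[of x] admissibleD(2)[OF assms(1), of x] admissibleD(2)[OF assms(2), of x]
    by (auto simp: b_def abs_le_iff max_def)
  define C0 where "C0 = (C * b ^ 5) powr (1/8)"
  have C0: "0 < C0" using C b by (simp add: C0_def)
  have "Linfty_norm (\<lambda>x. K\<^sub>2 x - K\<^sub>1 x) \<le> ennreal C0 * ennreal_powr (scattering_distance \<Phi>\<^sub>1 \<Phi>\<^sub>2) (1/8)"
  proof (cases "scattering_distance \<Phi>\<^sub>1 \<Phi>\<^sub>2 = \<infinity>")
    case True
    then show ?thesis using C0 by (simp add: ennreal_powr_def ennreal_mult_top)
  next
    case False
    define \<delta> where "\<delta> = enn2real (scattering_distance \<Phi>\<^sub>1 \<Phi>\<^sub>2)"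
    have \<delta>: "0 \<le> \<delta>" "ennreal \<delta> = scattering_distance \<Phi>\<^sub>1 \<Phi>\<^sub>2"
      using False by (auto simp: \<delta>_def less_top)
    have dist: "\<forall>d \<in> X_space - X_zero. 0 < energy_norm d \<longrightarrow> Y_norm (\<Phi>\<^sub>2 d - \<Phi>\<^sub>1 d) \<le> \<delta> * energy_norm d"
    proof (intro ballI impI)
      fix d assume d: "d \<in> X_space - X_zero" "0 < energy_norm d"
      have "ennreal (Y_norm (\<Phi>\<^sub>2 d - \<Phi>\<^sub>1 d) / energy_norm d) \<le> ennreal \<delta>"
        unfolding \<delta>(2) scattering_distance_def using d(1) by (intro SUP_upper)
      then have "Y_norm (\<Phi>\<^sub>2 d - \<Phi>\<^sub>1 d) / energy_norm d \<le> \<delta>" using \<delta>(1) by (simp add: ennreal_le_iff)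
      then show "Y_norm (\<Phi>\<^sub>2 d - \<Phi>\<^sub>1 d) \<le> \<delta> * energy_norm d" using d(2) by (simp add: divide_le_eq)
    qed
    have pt: "\<bar>K\<^sub>2 x - K\<^sub>1 x\<bar> \<le> C0 * \<delta> powr (1/8)" for x
    proof -
      let ?m = "\<bar>K\<^sub>2 x - K\<^sub>1 x\<bar>"
      \<comment> \<open>five of the eight factors are estimated by the bound on the coefficients\<close>
      have "?m ^ 8 = ?m ^ 3 * ?m ^ 5" by (simp flip: power_add)
      also have "\<dots> \<le> (C * \<delta>) * b ^ 5"
        using cube[OF \<delta>(1) dist, of x] mb[of x] C \<delta>(1) by (intro mult_mono power_mono) auto
      finally have "?m ^ 8 \<le> (C * b ^ 5) * \<delta>" by (simp add: mult_ac)
      then have "?m \<le> ((C * b ^ 5) * \<delta>) powr (1/8)" by (intro le_powr_eighth) auto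
      then show ?thesis using C b \<delta>(1) by (simp add: C0_def powr_mult)
    qed
    have c: "continuous_on UNIV (\<lambda>x. K\<^sub>2 x - K\<^sub>1 x)"
      using admissible_continuous assms(1,2) by (intro continuous_intros) auto
    have "Linfty_norm (\<lambda>x. K\<^sub>2 x - K\<^sub>1 x) \<le> ennreal (C0 * \<delta> powr (1/8))"
      unfolding Linfty_norm_def
    proof (rule esssup_I)
      show "(\<lambda>x. ennreal \<bar>K\<^sub>2 x - K\<^sub>1 x\<bar>) \<in> borel_measurable lborel"
        using continuous_imp_borel_lborel[OF c] by measurable
      show "AE x in lborel. ennreal \<bar>K\<^sub>2 x - K\<^sub>1 x\<bar> \<le> ennreal (C0 * \<delta> powr (1/8))"
        using pt by (intro AE_I2 ennreal_leI)
    qed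
    also have "\<dots> = ennreal C0 * ennreal_powr (scattering_distance \<Phi>\<^sub>1 \<Phi>\<^sub>2) (1/8)"
      using False C0 by (simp add: ennreal_powr_def \<delta>_def ennreal_mult)
    finally show ?thesis .
  qed
  moreover have "K\<^sub>1 = K\<^sub>2" if eq: "\<forall>d \<in> X_space. Y_eq (\<Phi>\<^sub>1 d) (\<Phi>\<^sub>2 d)"
  proof
    fix x
    obtain \<Psi> where tr: "transition \<Psi>" using transition_exists[OF assms(1)] by blast
    have "Y_norm (\<Phi>\<^sub>2 d - \<Phi>\<^sub>1 d) = 0" if "d \<in> X_space" for d
      using that eq assms(3,4) by (intro Y_norm_eq_0[OF tr]) (auto simp: is_scattering_map_def)
    then have "\<bar>K\<^sub>2 x - K\<^sub>1 x\<bar> ^ 3 \<le> C * 0" by (intro cube) auto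
    then show "K\<^sub>1 x = K\<^sub>2 x" by simp
  qed
  ultimately show ?thesis using C0 by blast
qed

end
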